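(* Assume the standing assumptions in the context, and assume there are constants $C>0$ and $\beta_1\in(0,1)$ such that for all $N$, all $L\ge N^{0.01}$ and all $|k|\le N$: $$|\mathfrak{m}_{k+L}(1)-\mathfrak{m}_{k-L}(1)-2L|\le CL^{1-\beta_1},\quad \Big|\sum_{j=k-L}^{k+L}\rho_j\mathbf{1}-2La\Big|\le CL^{1-\beta_1},\quad \Big|\sum_{j=k-L}^{k+L}\rho_j\mathfrak{q}_j-2Lb\Big|\le CL^{1-\beta_1},$$ for some constants $a,b>0$. Let $D=b/a$ and $\upsilon=\frac12\min\left(\frac14,\beta_1\right)$. Then for each $\varepsilon>0$ there is $C_\varepsilon$ such that $$\sup_x\left|\mathbb{P}\left(\frac{X_N}{\sqrt{DN}}\le x\right)-\Phi(x)\right|\le C_\varepsilon N^{-(\upsilon-\varepsilon)},$$ where $\Phi$ is the standard normal distribution function.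
   Context: Fix $m\ge1$, $\mathbb{S}=\mathbb{Z}\times\{1,\dots,m\}$. Environment $(P_n,Q_n,R_n)_{n\in\mathbb{Z}}$, nonnegative $m\times m$ with $(P_n+Q_n+R_n)\mathbf{1}=\mathbf{1}$. The walk $\xi_t=(X_t,Y_t)$ jumps from $(n,i)$ to $(n+1,j),(n,j),(n-1,j)$ with probabilities $P_n(i,j),R_n(i,j),Q_n(i,j)$; $\mathbb{P}$ is its law from $(0,\mathfrak{i})$. Norm $\|x\|=\max|x_i|$. Standing assumptions: (1) Ellipticity: $\bar\varepsilon>0$, $k_0$ with $\|R_n^{k_0}\|\le1-\bar\varepsilon$, $((I-R_n)^{-1}P_n)(i,j)\ge\bar\varepsilon$, $((I-R_n)^{-1}Q_n)(i,j)\ge\bar\varepsilon$. (2) Bounded potential: $\zeta_n=\lim_{a\to-\infty}\psi_{n,a}$ ($\psi_{a,a}$ any stochastic, $\psi_{n,a}=(I-R_n-Q_n\psi_{n-1,a})^{-1}P_n$), $A_n=(I-R_n-Q_n\zeta_{n-1})^{-1}Q_n$, $|\log\|A_n\cdots A_1\||\le C_P$ ($n\ge1$), $|\log\|A_0\cdots A_{n+1}\||\le C_P$ ($n\le-1$). (3) Column vectors $\mathfrak{m}_n$ with $\mathfrak{m}_n=P_n\mathfrak{m}_{n+1}+R_n\mathfrak{m}_n+Q_n\mathfrak{m}_{n-1}$, $|\mathfrak{m}_{n'}(i')-\mathfrak{m}_{n''}(i'')|\le K$ for $|n'-n''|\le1$, $\sum_j\mathfrak{m}_n(j)/n\to m$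 as $|n|\to\infty$. (4) $\zeta^-_n$ the unique stochastic sequence with $\zeta^-_n=(I-R_n-P_n\zeta^-_{n+1})^{-1}Q_n$, $\alpha_n=Q_{n+1}(I-R_n-Q_n\zeta_{n-1})^{-1}$; positive bounded row vectors $\rho_n$ with $\rho_n=\rho_{n-1}P_{n-1}+\rho_nR_n+\rho_{n+1}Q_{n+1}$, $\rho_n=\rho_{n+1}\alpha_n$, $\rho_nP_n(\mathfrak{m}_{n+1}-\zeta^-_{n+1}\mathfrak{m}_n)=\frac1{2m}$. $\mathfrak{q}_n(i)$ is the conditional expectation of $(\mathfrak{m}(\xi_{k+1})-\mathfrak{m}(\xi_k))^2$ given $\xi_k=(n,i)$, with $\mathfrak{m}(n,i)=\mathfrak{m}_n(i)$. *)

theory Defs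
  imports "HOL-Analysis.Analysis" "HOL-Probability.Probability"
begin

text \<open>Index set {1..m} is represented by a finite type 'm (so m = CARD('m)).
  Matrices are real^'m^'m with entries A $ i $ j (row i, column j); column
  vectors and row vectors are both real^'m.\<close>

definition vnorm :: "real^'m \<Rightarrow> real" where
  "vnorm x = Max (range (\<lambda>i. \<bar>x $ i\<bar>))"

definition mnorm :: "real^'m^'m \<Rightarrow> real" where
  "mnorm A = Sup {vnorm (A *v x) | x. vnorm x \<le> 1}"

primrec matpow :: "real^'m^'m \<Rightarrow> nat \<Rightarrow> real^'m^'m" where
  "matpow A 0 = mat 1"
| "matpow A (Suc k) = A ** matpow A k"

primrec mprod_down :: "(int \<Rightarrow> real^'m^'m) \<Rightarrow> int \<Rightarrow> nat \<Rightarrow> real^'m^'m" where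
  "mprod_down A hi 0 = mat 1"
| "mprod_down A hi (Suc k) = A hi ** mprod_down A (hi - 1) k"

definition stochastic :: "real^'m^'m \<Rightarrow> bool" where
  "stochastic S \<longleftrightarrow> (\<forall>i j. S $ i $ j \<ge> 0) \<and> (\<forall>i. (\<Sum>j\<in>UNIV. S $ i $ j) = 1)"

text \<open>psi_{n,a} with n = a + k, started from psi_{a,a} = S a:
  psi_{n,a} = (I - R_n - Q_n psi_{n-1,a})^{-1} P_n.\<close>
primrec psi :: "(int \<Rightarrow> real^'m^'m) \<Rightarrow> (int \<Rightarrow> real^'m^'m) \<Rightarrow> (int \<Rightarrow> real^'m^'m)
    \<Rightarrow> (int \<Rightarrow> real^'m^'m) \<Rightarrow> int \<Rightarrow> nat \<Rightarrow> real^'m^'m" where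
  "psi P Q R S a 0 = S a"
| "psi P Q R S a (Suc k) =
     matrix_inv (mat 1 - R (a + int k + 1) - Q (a + int k + 1) ** psi P Q R S a k)
       ** P (a + int k + 1)"

text \<open>Marginal law of xi_t = (X_t, Y_t) started at (0, i0):
  walk_dist P Q R i0 t n j = probability that xi_t = (n, j).\<close>
primrec walk_dist :: "(int \<Rightarrow> real^'m^'m) \<Rightarrow> (int \<Rightarrow> real^'m^'m) \<Rightarrow> (int \<Rightarrow> real^'m^'m)
    \<Rightarrow> 'm \<Rightarrow> nat \<Rightarrow> int \<Rightarrow> 'm \<Rightarrow> real" where
  "walk_dist P Q R i0 0 n j = (if n = 0 \<and> j = i0 then 1 else 0)"
| "walk_dist P Q R i0 (Suc t) n j =
     (\<Sum>i\<in>UNIV. walk_dist P Q R i0 t (n - 1) i * P (n - 1) $ i $ j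
              + walk_dist P Q R i0 t n i * R n $ i $ j
              + walk_dist P Q R i0 t (n + 1) i * Q (n + 1) $ i $ j)"

text \<open>P(X_N <= y) for the walk started at (0,i0); X_N takes values in [-N,N].\<close>
definition walk_cdf :: "(int \<Rightarrow> real^'m^'m) \<Rightarrow> (int \<Rightarrow> real^'m^'m) \<Rightarrow> (int \<Rightarrow> real^'m^'m)
    \<Rightarrow> 'm \<Rightarrow> nat \<Rightarrow> real \<Rightarrow> real" where
  "walk_cdf P Q R i0 N y =
     (\<Sum>n\<in>{n\<in>{- int N..int N}. real_of_int n \<le> y}. \<Sum>j\<in>UNIV. walk_dist P Q R i0 N n j)"

text \<open>q_n(i) = E[(m(xi_{k+1}) - m(xi_k))^2 | xi_k = (n,i)].\<close>
definition qvec :: "(int \<Rightarrow> real^'m^'m) \<Rightarrow> (int \<Rightarrow> real^'m^'m) \<Rightarrow> (int \<Rightarrow> real^'m^'m)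
    \<Rightarrow> (int \<Rightarrow> real^'m) \<Rightarrow> int \<Rightarrow> real^'m" where
  "qvec P Q R mm n = (\<chi> i. \<Sum>j\<in>UNIV.
       P n $ i $ j * (mm (n + 1) $ j - mm n $ i)\<^sup>2
     + R n $ i $ j * (mm n $ j - mm n $ i)\<^sup>2
     + Q n $ i $ j * (mm (n - 1) $ j - mm n $ i)\<^sup>2)"

definition Phi :: "real \<Rightarrow> real" where
  "Phi x = cdf (density lborel std_normal_density) x"

end

theory Submission
  imports Defs
begin

text \<open>
  The process \<open>M\<^sub>t = m(\<xi>\<^sub>t)\<close> is a martingale with bounded increments and \<open>X\<^sub>t\<close> stays within
  \<open>O(|X\<^sub>t|\<^bsup>1 - \<beta>\<^esup>)\<close> of it, where \<open>\<beta> = min(1/4, \<beta>\<^sub>1)\<close>. Put \<open>\<sigma> = N\<^bsup>(1 - \<beta>)/2\<^esup>\<close>. We compare the law of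
  \<open>M\<^sub>N\<close> with the normal law by following \<open>f(t, M\<^sub>t)\<close> for the solution
  \<open>f(t, x) = \<Phi>((m\<^sub>y - x) / sqrt (D (N - t + \<sigma>\<^sup>2)))\<close> of the backward heat equation. One step changes it by
  \<open>f\<^sub>x\<^sub>x (q - D) / 2\<close> up to third order terms; the change is cancelled by subtracting \<open>f\<^sub>x\<^sub>x G / 2\<close>, where
  \<open>G\<close> solves the Poisson equation \<open>T G - G = q - D\<close>.

  The averaging hypotheses hold around every centre, so \<open>G\<close> can be centred at \<open>y\<close>: at distance \<open>r\<close> from
  \<open>y\<close> its gradient is \<open>O((r + \<sigma>)\<^bsup>1 - \<beta>\<^esup>)\<close>. To see this, write \<open>G\<^sub>n = \<zeta>\<^sub>n G\<^sub>n\<^sub>+\<^sub>1 + c\<^sub>n\<close>. The flux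
  \<open>\<rho>\<^sub>n\<^sub>+\<^sub>1 Q\<^sub>n\<^sub>+\<^sub>1 c\<^sub>n\<close> changes from \<open>n - 1\<close> to \<open>n\<close> by exactly \<open>- \<rho>\<^sub>n (q\<^sub>n - D)\<close>, and since the matrices \<open>A\<^sub>n\<close>
  are bounded below it controls all of \<open>c\<^sub>n\<close>; the contraction property of \<open>\<zeta>\<^sub>n\<close> passes the bound on to \<open>G\<close>.

  With \<open>s\<^sup>2 = N - t + \<sigma>\<^sup>2\<close> the remaining error of step \<open>t\<close> is
  \<open>O(s\<^bsup>-2 - \<beta>\<^esup>) E (1 + |X\<^sub>t - y| / s)\<^bsup>-2\<^esup>\<close>. Given \<open>P(|X\<^sub>t - k| \<le> r) \<le> C (r / sqrt t + t\<^bsup>-\<gamma>\<^esup>)\<close>, these errors sum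
  to \<open>O(N\<^bsup>-min(\<gamma> + \<beta>(1 - \<beta>)/4, \<beta>/2)\<^esup>)\<close>, which in turn improves \<open>\<gamma>\<close>. Starting from the trivial \<open>\<gamma> = 0\<close>,
  three rounds reach \<open>\<gamma> = \<beta>/2\<close>, the rate claimed.
\<close>

section \<open>The normal distribution function\<close>

text \<open>The corrector has to be small where the heat kernel is sharp. Near y the k-th space
  derivative of f is of order s^-k, so at distance s from y a corrector of order s^(2 - beta) with
  gradient s^(1 - beta) is wanted, for every s >= sigma. The gradient of a corrector normalised at
  the origin is controlled near y only by |y|^(1 - beta), hence one G for each pair (N, y), with
  constants that do not depend on the pair. Summing s^(-2 - beta) over all times yields only the
  bound sigma^-beta, short of the target N^(-beta/2); the missing factor is the probability that the
  walk is within s of y at all. The scale sigma is dictated by the cost of smoothing: sigma / sqrt N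
  = N^(-beta/2). It also satisfies sigma^3 >= N, so the restriction L >= N^0.01 in the averaging
  hypotheses is invisible at the scale (r + sigma)^(1 - beta). Expectations are finite sums over the
  range of the walk at one time, and conditional expectation is the transition operator, so no path
  space appears.\<close>

lemma Phi_diff_eq:
  assumes c: "c \<le> u" and F: "\<And>v. c \<le> v \<Longrightarrow> v \<le> u \<Longrightarrow> (F has_real_derivative std_normal_density v) (at v)"
  shows "Phi u - Phi c = F u - F c"
proof (cases "c < u")
  case True
  let ?M = "density lborel std_normal_density"
  interpret prob_space ?M by (rule prob_space_normal_density) simp
  interpret rd: real_distribution ?M by unfold_locales auto
  have me: "Phi u - Phi c = measure ?M {c<..u}"
    unfolding Phi_def using rd.cdf_diff_eq[OF True] by simp
  have "emeasure ?M {c<..u} = (\<integral>\<^sup>+x. ennreal (std_normal_density x) * indicator {c<..u} x \<partial>lborel)"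
    by (simp add: emeasure_density)
  \<comment> \<open>The endpoint \<open>c\<close> is a null set; the closed interval is the one the
    fundamental theorem asks for.\<close>
  also have "\<dots> = (\<integral>\<^sup>+x. ennreal (std_normal_density x) * indicator {c..u} x \<partial>lborel)"
    by (intro nn_integral_cong_AE eventually_mono[OF AE_lborel_singleton[of c]])
       (auto split: split_indicator)
  also have "\<dots> = ennreal (F u - F c)"
    by (rule nn_integral_FTC_Icc) (use F c in simp_all)
  finally have em: "emeasure ?M {c<..u} = ennreal (F u - F c)" .
  have "F c \<le> F u"
    by (rule DERIV_nonneg_imp_nondecreasing[OF c]) (use F normal_density_nonneg in blast)
  then show ?thesis using em me by (simp add: emeasure_eq_measure)
qed (use c in simp)

lemma has_real_derivative_Phi [derivative_intros]:
  "(Phi has_real_derivative std_normal_density x) (at x)"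
proof -
  \<comment> \<open>Integrating from \<open>x - 2\<close> keeps the whole window from
    \<open>x - 1\<close> to \<open>x + 1\<close> in the interior of the interval from
    \<open>x - 2\<close> to \<open>x + 2\<close>, so the derivative within that interval is a
    two-sided one.\<close>
  define g where "g = (\<lambda>u. integral {x - 2..u} std_normal_density)"
  have cont: "continuous_on S std_normal_density" for S
    unfolding std_normal_density_def by (intro continuous_intros) auto
  have g: "(g has_real_derivative std_normal_density v) (at v)" if "x - 1 \<le> v" "v \<le> x + 1" for v
  proof -
    have "(g has_real_derivative std_normal_density v) (at v within {x - 2..x + 2})"
      unfolding g_def by (rule integral_has_real_derivative[OF cont]) (use that in auto)
    moreover have "at v within {x - 2..x + 2} = at v"
      by (rule at_within_interior) (use that in auto)
    ultimately show ?thesis by simp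
  qed
  have eq: "Phi u = g u - g (x - 1) + Phi (x - 1)" if "x - 1 \<le> u" "u \<le> x + 1" for u
  proof -
    have "Phi u - Phi (x - 1) = g u - g (x - 1)"
      by (rule Phi_diff_eq) (use g that in auto)
    then show ?thesis by simp
  qed
  have "((\<lambda>u. g u - g (x - 1) + Phi (x - 1)) has_real_derivative std_normal_density x) (at x)"
    by (auto intro!: derivative_eq_intros g)
  then show ?thesis
  proof (rule has_field_derivative_transform_within[where d = 1])
    fix u assume "dist u x < 1"
    then show "g u - g (x - 1) + Phi (x - 1) = Phi u"
      using eq[of u] unfolding dist_real_def by linarith
  qed auto
qed

lemma Phi_nonneg: "0 \<le> Phi x" and Phi_le_1: "Phi x \<le> 1"
proof -
  let ?M = "density lborel std_normal_density"
  interpret prob_space ?M by (rule prob_space_normal_density) simp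
  interpret rd: real_distribution ?M by unfold_locales auto
  show "0 \<le> Phi x" "Phi x \<le> 1"
    unfolding Phi_def by (auto simp: rd.cdf_nonneg rd.cdf_bounded_prob)
qed

lemma Phi_at_top: "(Phi \<longlongrightarrow> 1) at_top" and Phi_at_bot: "(Phi \<longlongrightarrow> 0) at_bot"
proof -
  let ?M = "density lborel std_normal_density"
  interpret prob_space ?M by (rule prob_space_normal_density) simp
  interpret rd: real_distribution ?M by unfold_locales auto
  show "(Phi \<longlongrightarrow> 1) at_top" "(Phi \<longlongrightarrow> 0) at_bot"
    unfolding Phi_def using rd.cdf_lim_at_top_prob rd.cdf_lim_at_bot by auto
qed

lemma Phi_mono: "x \<le> y \<Longrightarrow> Phi x \<le> Phi y"
  using DERIV_nonneg_imp_nondecreasing[of x y Phi] has_real_derivative_Phi normal_density_nonneg by blast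

text \<open>The inequality u <= exp u at u = (1 + |z|) / p, raised to the power p, bounds the
  polynomial by an exponential of |z|, and completing the square absorbs that exponential into the
  Gaussian.\<close>

lemma std_normal_density_decay:
  "\<exists>C\<ge>1. \<forall>z. std_normal_density z * (1 + \<bar>z\<bar>) ^ p \<le> C"
proof -
  have bd: "std_normal_density z * (1 + \<bar>z\<bar>) ^ p \<le> real p ^ p * exp 2" for z
  proof -
    have "(1 + \<bar>z\<bar>) ^ p \<le> real p ^ p * exp (1 + \<bar>z\<bar>)"
    proof (cases "p = 0")
      case False
      have "(1 + \<bar>z\<bar>) / real p \<le> exp ((1 + \<bar>z\<bar>) / real p)" 
        using exp_ge_add_one_self[of "(1 + \<bar>z\<bar>) / real p"] by linarith
      then have "((1 + \<bar>z\<bar>) / real p) ^ p \<le> exp ((1 + \<bar>z\<bar>) / real p) ^ p"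
        by (intro power_mono) auto
      also have "\<dots> = exp (1 + \<bar>z\<bar>)" using False by (simp flip: exp_of_nat_mult)
      finally show ?thesis using False by (simp add: power_divide field_simps)
    qed auto
    moreover have "std_normal_density z \<le> exp (- z\<^sup>2 / 2)"
    proof -
      have "1 \<le> sqrt (2 * pi)" using pi_gt3 by simp
      then show ?thesis unfolding std_normal_density_def by (simp add: field_simps)
    qed
    ultimately have "std_normal_density z * (1 + \<bar>z\<bar>) ^ p \<le> exp (- z\<^sup>2 / 2) * (real p ^ p * exp (1 + \<bar>z\<bar>))"
      by (intro mult_mono) auto
    also have "\<dots> = real p ^ p * exp (1 + \<bar>z\<bar> - z\<^sup>2 / 2)" by (simp flip: exp_add add: mult.left_commute)
    also have "\<dots> \<le> real p ^ p * exp 2"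
    proof -
      have "0 \<le> (\<bar>z\<bar> - 1)\<^sup>2" by simp
      then have "1 + \<bar>z\<bar> - z\<^sup>2 / 2 \<le> 2" by (simp add: power2_eq_square algebra_simps)
      then show ?thesis by (intro mult_left_mono) auto
    qed
    finally show ?thesis .
  qed
  show ?thesis
    by (rule exI[of _ "max 1 (real p ^ p * exp 2)"]) (use bd in \<open>auto simp: le_max_iff_disj\<close>)
qed

text \<open>The sign \<open>s\<close> is 1 for the upper tail and -1 for the lower tail in
  \<open>Phi_tail\<close>.\<close>

lemma has_real_derivative_inverse_square:
  assumes "1 + s * w \<noteq> (0::real)"
  shows "((\<lambda>u. C / (1 + s * u)\<^sup>2) has_real_derivative - 2 * s * C / (1 + s * w) ^ 3) (at w)"
proof -
  have eq: "- (C * (2 * q * s)) / (q\<^sup>2 * q\<^sup>2) = - 2 * s * C / q ^ 3" if "q \<noteq> 0" for q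
    using that by (simp add: field_simps power2_eq_square power3_eq_cube)
  have "((\<lambda>u. C / (1 + s * u)\<^sup>2) has_real_derivative
      - (C * (2 * (1 + s * w) * s)) / ((1 + s * w)\<^sup>2 * (1 + s * w)\<^sup>2)) (at w)"
    using assms by (auto intro!: derivative_eq_intros)
  then show ?thesis using eq[OF assms] by simp
qed

text \<open>Quadratic decay matches the weights (1 + d / s)^-2 used throughout. In each tail the
  auxiliary function \<open>h\<close> is nondecreasing, because the density is at most 2 C / (1 +
  |w|)^3, and it tends to 0 at the relevant infinity, which fixes its sign.\<close>

lemma Phi_tail:
  "\<exists>C\<ge>1. (\<forall>u\<ge>0. 1 - Phi u \<le> C / (1 + u)\<^sup>2) \<and> (\<forall>u\<le>0. Phi u \<le> C / (1 + \<bar>u\<bar>)\<^sup>2)"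
proof -
  obtain C where C: "C \<ge> 1" "\<forall>z. std_normal_density z * (1 + \<bar>z\<bar>) ^ 3 \<le> C"
    using std_normal_density_decay by blast
  have t0: "((\<lambda>u. C / (1 + u)\<^sup>2) \<longlongrightarrow> 0) at_top"
    by (rule tendsto_divide_0[OF tendsto_const]) (intro filterlim_at_top_imp_at_infinity filterlim_pow_at_top
        filterlim_tendsto_add_at_top[OF tendsto_const] filterlim_ident, auto)
  have top: "1 - Phi u \<le> C / (1 + u)\<^sup>2" if "u \<ge> 0" for u
  proof -
    define h where "h = (\<lambda>u. 1 - Phi u - C / (1 + u)\<^sup>2)"
    have "(h \<longlongrightarrow> 1 - 1 - 0) at_top" unfolding h_def
      by (intro tendsto_intros Phi_at_top t0)
    moreover have "\<forall>\<^sub>F v in at_top. h u \<le> h v"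
      using eventually_ge_at_top[of u]
    proof eventually_elim
      case (elim v)
      show ?case
      proof (rule DERIV_nonneg_imp_nondecreasing[OF elim])
        fix w assume w: "u \<le> w" "w \<le> v"
        have "(h has_real_derivative (- std_normal_density w + 2 * C / (1 + w)^3)) (at w)"
          using DERIV_diff[OF DERIV_diff[OF DERIV_const has_real_derivative_Phi]
              has_real_derivative_inverse_square[of 1 w C], of 1] that w by (simp add: h_def)
        moreover have "std_normal_density w \<le> 2 * C / (1 + w)^3"
          using C(2)[rule_format, of w] C(1) that w by (simp add: field_simps)
        ultimately show "\<exists>y. (h has_real_derivative y) (at w) \<and> 0 \<le> y" by (intro exI conjI) auto
      qed
    qed
    ultimately have "h u \<le> 1 - 1 - 0"
      by (intro tendsto_lowerbound[of h _ at_top]) auto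
    then show ?thesis by (simp add: h_def)
  qed
  have bot: "Phi u \<le> C / (1 + \<bar>u\<bar>)\<^sup>2" if "u \<le> 0" for u
  proof -
    define h where "h = (\<lambda>u. C / (1 - u)\<^sup>2 - Phi u)"
    have "((\<lambda>u::real. C / (1 - u)\<^sup>2) \<longlongrightarrow> 0) at_bot"
      using t0 by (subst filterlim_at_bot_mirror) (simp add: field_simps)
    then have "(h \<longlongrightarrow> 0 - 0) at_bot" unfolding h_def
      by (intro tendsto_intros Phi_at_bot)
    moreover have "\<forall>\<^sub>F v in at_bot. h v \<le> h u"
      using eventually_le_at_bot[of u]
    proof eventually_elim
      case (elim v)
      show ?case
      proof (rule DERIV_nonneg_imp_nondecreasing[OF elim])
        fix w assume w: "v \<le> w" "w \<le> u"
        have "(h has_real_derivative (2 * C / (1 - w)^3 - std_normal_density w)) (at w)"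
          using DERIV_diff[OF has_real_derivative_inverse_square[of "-1" w C] has_real_derivative_Phi] that w
          by (simp add: h_def)
        moreover have "std_normal_density w \<le> 2 * C / (1 - w)^3"
          using C(2)[rule_format, of w] C(1) that w by (simp add: field_simps)
        ultimately show "\<exists>y. (h has_real_derivative y) (at w) \<and> 0 \<le> y" by (intro exI conjI) auto
      qed
    qed
    ultimately have "0 - 0 \<le> h u"
      by (intro tendsto_upperbound[of h _ at_bot]) auto
    then show ?thesis using that by (simp add: h_def)
  qed
  show ?thesis using C(1) top bot by blast
qed

lemma Phi_diff_le:
  assumes "\<And>w. min u z \<le> w \<Longrightarrow> w \<le> max u z \<Longrightarrow> std_normal_density w \<le> B"
  shows "\<bar>Phi u - Phi z\<bar> \<le> B * \<bar>u - z\<bar>"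
proof -
  have *: "\<bar>Phi v - Phi u\<bar> \<le> B * \<bar>v - u\<bar>" if uv: "u < v" and B: "\<And>w. u \<le> w \<Longrightarrow> w \<le> v \<Longrightarrow> std_normal_density w \<le> B" for u v
  proof -
    obtain w where w: "u < w" "w < v" "Phi v - Phi u = (v - u) * std_normal_density w"
      using MVT2[OF uv has_real_derivative_Phi] by blast
    have "\<bar>Phi v - Phi u\<bar> = (v - u) * std_normal_density w" using uv Phi_mono[of u v] w(3) by simp
    also have "\<dots> \<le> (v - u) * B" using uv B w by (intro mult_left_mono) auto
    finally show ?thesis using uv by (simp add: mult.commute)
  qed
  show ?thesis
  proof (cases u z rule: linorder_cases)
    case less
    then show ?thesis using *[OF less] assms by (simp add: abs_minus_commute)
  next
    case greater
    then show ?thesis using *[OF greater] assms by simp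
  qed simp
qed

lemma std_normal_density_le_1: "std_normal_density z \<le> 1"
proof -
  have "1 \<le> sqrt (2 * pi)" using pi_gt3 by simp
  moreover have "exp (- z\<^sup>2 / 2) \<le> 1" by simp
  ultimately have "exp (- z\<^sup>2 / 2) \<le> sqrt (2 * pi)" by linarith
  then show ?thesis unfolding std_normal_density_def by (simp add: divide_le_eq)
qed

lemma Phi_Lipschitz: "\<bar>Phi u - Phi z\<bar> \<le> \<bar>u - z\<bar>"
  using Phi_diff_le[of u z 1] std_normal_density_le_1 by simp

text \<open>An error proportional to 1 + |z| is harmless, since for
  \<open>\<delta> \<le> 1/2\<close> every point between u and z has modulus comparable with z and
  the density there is O(1 / (1 + |z|)). For larger \<open>\<delta>\<close> the bound exceeds 1.
  This is what allows the initial profile to be compared with \<open>Phi\<close> uniformly in the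
  threshold.\<close>

lemma Phi_perturb:
  "\<exists>C\<ge>1. \<forall>u z \<delta>. \<bar>u - z\<bar> \<le> \<delta> * (1 + \<bar>z\<bar>) \<longrightarrow> \<bar>Phi u - Phi z\<bar> \<le> C * \<delta>"
proof -
  obtain C where C: "C \<ge> 1" "\<forall>z. std_normal_density z * (1 + \<bar>z\<bar>) ^ 1 \<le> C"
    using std_normal_density_decay by blast
  have "\<bar>Phi u - Phi z\<bar> \<le> (4 * C) * \<delta>" if d: "\<bar>u - z\<bar> \<le> \<delta> * (1 + \<bar>z\<bar>)" for u z \<delta>
  proof (cases "\<delta> \<le> 1/2")
    case True
    have d0: "0 \<le> \<delta>" using order_trans[OF abs_ge_zero d] abs_ge_zero[of z] by (auto simp: zero_le_mult_iff)
    have "\<bar>Phi u - Phi z\<bar> \<le> (4 * C / (1 + \<bar>z\<bar>)) * \<bar>u - z\<bar>"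
    proof (rule Phi_diff_le)
      fix w assume w: "min u z \<le> w" "w \<le> max u z"
      have "\<delta> * (1 + \<bar>z\<bar>) \<le> (1/2) * (1 + \<bar>z\<bar>)" using True by (intro mult_right_mono) auto
      then have "1 + \<bar>z\<bar> \<le> 4 * (1 + \<bar>w\<bar>)" 
      proof -
        assume "\<delta> * (1 + \<bar>z\<bar>) \<le> (1/2) * (1 + \<bar>z\<bar>)"
        moreover have "\<bar>w - z\<bar> \<le> \<bar>u - z\<bar>" using w by (auto simp: min_def max_def split: if_splits)
        ultimately show ?thesis using d by argo
      qed
      then have "std_normal_density w * (1 + \<bar>z\<bar>) \<le> std_normal_density w * (4 * (1 + \<bar>w\<bar>))"
        by (intro mult_left_mono) auto
      also have "\<dots> = 4 * (std_normal_density w * (1 + \<bar>w\<bar>))" by simp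
      also have "\<dots> \<le> 4 * C" using C(2) by (intro mult_left_mono) auto
      finally show "std_normal_density w \<le> 4 * C / (1 + \<bar>z\<bar>)" by (simp add: field_simps)
    qed
    also have "\<dots> \<le> (4 * C / (1 + \<bar>z\<bar>)) * (\<delta> * (1 + \<bar>z\<bar>))"
      using d C(1) by (intro mult_left_mono) auto
    also have "\<dots> = 4 * C * \<delta>" by (simp add: field_simps)
    finally show ?thesis .
  next
    case False
    have "\<bar>Phi u - Phi z\<bar> \<le> 1" using Phi_nonneg[of u] Phi_le_1[of u] Phi_nonneg[of z] Phi_le_1[of z] by linarith
    also have "1 \<le> 4 * C * \<delta>" using mult_mono[of 1 C "1/2" \<delta>] C(1) False by simp
    finally show ?thesis .
  qed
  then show ?thesis using C(1) by (intro exI[of _ "4 * C"]) auto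
qed

section \<open>The heat kernel\<close>

lemma has_real_derivative_std_normal_density:
  "((\<lambda>x. std_normal_density x) has_real_derivative - z * std_normal_density z) (at z)"
  unfolding std_normal_density_def
  by (auto intro!: derivative_eq_intros simp: power2_eq_square field_simps)

text \<open>Probability that a normal variable with mean x and standard deviation w is at most Y.
  \<open>heat1\<close> to \<open>heat4\<close> are its x-derivatives in closed form, Hermite
  polynomials times the density at (Y - x) / w.\<close>

definition heat0 :: "real \<Rightarrow> real \<Rightarrow> real \<Rightarrow> real" where
  "heat0 Y w x = Phi ((Y - x) / w)"

definition heat1 :: "real \<Rightarrow> real \<Rightarrow> real \<Rightarrow> real" where
  "heat1 Y w x = - std_normal_density ((Y - x) / w) / w"

definition heat2 :: "real \<Rightarrow> real \<Rightarrow> real \<Rightarrow> real" where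
  "heat2 Y w x = - ((Y - x) / w) * std_normal_density ((Y - x) / w) / w\<^sup>2"

definition heat3 :: "real \<Rightarrow> real \<Rightarrow> real \<Rightarrow> real" where
  "heat3 Y w x = (1 - ((Y - x) / w)\<^sup>2) * std_normal_density ((Y - x) / w) / w ^ 3"

definition heat4 :: "real \<Rightarrow> real \<Rightarrow> real \<Rightarrow> real" where
  "heat4 Y w x = (3 * ((Y - x) / w) - ((Y - x) / w) ^ 3) * std_normal_density ((Y - x) / w) / w ^ 4"

lemma deriv_z_x: "w \<noteq> 0 \<Longrightarrow> ((\<lambda>x. (Y - x) / w) has_real_derivative - 1 / w) (at x)"
  by (auto intro!: derivative_eq_intros)

lemma deriv_z_w: "w \<noteq> 0 \<Longrightarrow> ((\<lambda>w. (Y - x) / w) has_real_derivative - ((Y - x) / w) / w) (at w)"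
  by (auto intro!: derivative_eq_intros simp: field_simps)

text \<open>Up to sign this is the Hermite recursion, p becoming z p - p'; one rule serves the last
  three derivatives.\<close>

lemma deriv_hermite_x:
  assumes w: "w \<noteq> 0" and p: "(p has_real_derivative p') (at ((Y - x) / w))"
  shows "((\<lambda>x. p ((Y - x) / w) * std_normal_density ((Y - x) / w) / c) has_real_derivative
    ((Y - x) / w * p ((Y - x) / w) - p') * std_normal_density ((Y - x) / w) / (w * c)) (at x)"
proof -
  have "((\<lambda>z. p z * std_normal_density z) has_real_derivative
      p' * std_normal_density ((Y - x) / w) + - ((Y - x) / w) * std_normal_density ((Y - x) / w) * p ((Y - x) / w))
      (at ((Y - x) / w))"
    by (rule DERIV_mult[OF p has_real_derivative_std_normal_density])
  from DERIV_cdivide[OF DERIV_chain2[OF this deriv_z_x[OF w]]]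
  have "((\<lambda>x. p ((Y - x) / w) * std_normal_density ((Y - x) / w) / c) has_real_derivative
    ((p' * std_normal_density ((Y - x) / w) + - ((Y - x) / w) * std_normal_density ((Y - x) / w) * p ((Y - x) / w))
       * (- 1 / w)) / c) (at x)" .
  moreover have "((p' * s + - z * s * q) * (- 1 / w)) / c = (z * q - p') * s / (w * c)" for s z q
    using w by (cases "c = 0") (simp_all add: field_simps)
  ultimately show ?thesis by metis
qed

lemma heat_deriv_x:
  assumes "w > 0"
  shows "(heat0 Y w has_real_derivative heat1 Y w x) (at x)"
    and "(heat1 Y w has_real_derivative heat2 Y w x) (at x)"
    and "(heat2 Y w has_real_derivative heat3 Y w x) (at x)"
    and "(heat3 Y w has_real_derivative heat4 Y w x) (at x)"
proof -
  have w: "w \<noteq> 0" using assms by simp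
  show "(heat0 Y w has_real_derivative heat1 Y w x) (at x)"
    using DERIV_chain2[OF has_real_derivative_Phi deriv_z_x[OF w]] by (simp add: heat0_def[abs_def] heat1_def)
  have p1: "((\<lambda>z::real. - 1) has_real_derivative 0) (at z)" for z by simp
  have p2: "((\<lambda>z::real. - z) has_real_derivative - 1) (at z)" for z by (auto intro!: derivative_eq_intros)
  have p3: "((\<lambda>z::real. 1 - z\<^sup>2) has_real_derivative - 2 * z) (at z)" for z by (auto intro!: derivative_eq_intros)
  show "(heat1 Y w has_real_derivative heat2 Y w x) (at x)"
    using deriv_hermite_x[OF w p1, where Y = Y and x = x and c = w] by (simp add: heat1_def[abs_def] heat2_def power2_eq_square)
  show "(heat2 Y w has_real_derivative heat3 Y w x) (at x)"
    using deriv_hermite_x[OF w p2, where Y = Y and x = x and c = "w\<^sup>2"]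
    by (simp add: heat2_def[abs_def] heat3_def power2_eq_square power3_eq_cube mult.assoc)
  have e: "z * (1 - z\<^sup>2) - - 2 * z = 3 * z - z ^ 3" for z :: real
    by (simp add: power2_eq_square power3_eq_cube algebra_simps)
  show "(heat3 Y w has_real_derivative heat4 Y w x) (at x)"
    using deriv_hermite_x[OF w p3, where Y = Y and x = x and c = "w ^ 3"] unfolding e
    by (simp add: heat3_def[abs_def] heat4_def power_Suc[symmetric] del: power_Suc)
qed

text \<open>The heat equation with the variance w^2 as time: a derivative in w^2 is half the second
  derivative in x. The second claim is the same equation for the second derivative and controls the
  Taylor remainder in time.\<close>

lemma heat_deriv_w:
  assumes "w > 0"
  shows "((\<lambda>w. heat0 Y w x) has_real_derivative w * heat2 Y w x) (at w)"
    and "((\<lambda>w. heat2 Y w x) has_real_derivative w * heat4 Y w x) (at w)"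
proof -
  have w: "w \<noteq> 0" using assms by simp
  define z where "z = (Y - x) / w"
  have dz: "((\<lambda>w. (Y - x) / w) has_real_derivative - z / w) (at w)"
    unfolding z_def by (rule deriv_z_w[OF w])
  show "((\<lambda>w. heat0 Y w x) has_real_derivative w * heat2 Y w x) (at w)"
  proof -
    have "((\<lambda>w. Phi ((Y - x) / w)) has_real_derivative std_normal_density z * (- z / w)) (at w)"
      unfolding z_def by (rule DERIV_chain2[OF has_real_derivative_Phi dz[unfolded z_def]])
    moreover have "std_normal_density z * (- z / w) = w * heat2 Y w x"
      using w by (simp add: heat2_def z_def power2_eq_square)
    ultimately show ?thesis by (simp add: heat0_def)
  qed
  have "((\<lambda>z. - z * std_normal_density z) has_real_derivative (z\<^sup>2 - 1) * std_normal_density z) (at z)"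
    by (rule DERIV_cong[OF DERIV_mult[OF DERIV_minus[OF DERIV_ident] has_real_derivative_std_normal_density]])
      (simp add: algebra_simps power2_eq_square)
  then have "((\<lambda>z. - z * std_normal_density z) has_real_derivative (z\<^sup>2 - 1) * std_normal_density z) (at ((Y - x) / w))"
    unfolding z_def .
  from DERIV_chain2[OF this dz]
  have "((\<lambda>w. - ((Y - x) / w) * std_normal_density ((Y - x) / w)) has_real_derivative
      (z\<^sup>2 - 1) * std_normal_density z * (- z / w)) (at w)" .
  moreover have "((\<lambda>w. w\<^sup>2) has_real_derivative 2 * w) (at w)" by (auto intro!: derivative_eq_intros)
  ultimately have "((\<lambda>w. - ((Y - x) / w) * std_normal_density ((Y - x) / w) / w\<^sup>2) has_real_derivative
      ((z\<^sup>2 - 1) * std_normal_density z * (- z / w) * w\<^sup>2 -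
        (- ((Y - x) / w) * std_normal_density ((Y - x) / w)) * (2 * w)) / (w\<^sup>2 * w\<^sup>2)) (at w)"
    using w by (intro DERIV_divide) auto
  then show "((\<lambda>w. heat2 Y w x) has_real_derivative w * heat4 Y w x) (at w)"
    unfolding heat2_def heat4_def z_def[symmetric]
  proof (rule DERIV_cong)
    have "((z\<^sup>2 - 1) * s * (- z / w) * w\<^sup>2 - (- z * s) * (2 * w)) / (w\<^sup>2 * w\<^sup>2) = w * ((3 * z - z ^ 3) * s / w ^ 4)" for s
    proof -
      have "((z\<^sup>2 - 1) * s * (- z / w) * w\<^sup>2 - (- z * s) * (2 * w)) = w * ((3 * z - z ^ 3) * s)"
        using w by (simp add: field_simps power2_eq_square power3_eq_cube)
      then show ?thesis using w by (simp add: power2_eq_square power4_eq_xxxx)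
    qed
    then show "((z\<^sup>2 - 1) * std_normal_density z * (- z / w) * w\<^sup>2 -
        (- z * std_normal_density z) * (2 * w)) / (w\<^sup>2 * w\<^sup>2) =
        w * ((3 * z - z ^ 3) * std_normal_density z / w ^ 4)" .
  qed
qed

lemma heat_deriv_time:
  assumes "D > 0" "t > 0"
  shows "((\<lambda>t. heat0 Y (sqrt (D * t)) x) has_real_derivative D / 2 * heat2 Y (sqrt (D * t)) x) (at t)"
    and "((\<lambda>t. heat2 Y (sqrt (D * t)) x) has_real_derivative D / 2 * heat4 Y (sqrt (D * t)) x) (at t)"
proof -
  have s: "((\<lambda>t. sqrt (D * t)) has_real_derivative D / (2 * sqrt (D * t))) (at t)"
  proof -
    have "D * t > 0" using assms by simp
    then show ?thesis
      by (auto intro!: derivative_eq_intros simp: field_simps)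
  qed
  have pos: "sqrt (D * t) > 0" using assms by simp
  show "((\<lambda>t. heat0 Y (sqrt (D * t)) x) has_real_derivative D / 2 * heat2 Y (sqrt (D * t)) x) (at t)"
    using DERIV_chain2[OF heat_deriv_w(1)[OF pos] s, of Y x] by (rule DERIV_cong) (use pos assms in \<open>simp add: divide_simps\<close>)
  show "((\<lambda>t. heat2 Y (sqrt (D * t)) x) has_real_derivative D / 2 * heat4 Y (sqrt (D * t)) x) (at t)"
    using DERIV_chain2[OF heat_deriv_w(2)[OF pos] s, of Y x] by (rule DERIV_cong) (use pos assms in \<open>simp add: divide_simps\<close>)
qed

text \<open>The weight has exponent 4 because two powers will be spent on the growth of the
  corrector and two must remain as the weight whose expectation is estimated.\<close>

lemma heat_bounds:
  "\<exists>C\<ge>1. \<forall>Y w x. w > 0 \<longrightarrow> \<bar>heat2 Y w x\<bar> \<le> C / (w\<^sup>2 * (1 + \<bar>Y - x\<bar> / w) ^ 4) \<and>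
     \<bar>heat3 Y w x\<bar> \<le> C / (w ^ 3 * (1 + \<bar>Y - x\<bar> / w) ^ 4) \<and>
     \<bar>heat4 Y w x\<bar> \<le> C / (w ^ 4 * (1 + \<bar>Y - x\<bar> / w) ^ 4)"
proof -
  \<comment> \<open>7 = 3 + 4: the Hermite polynomials have degree at most 3, and the weight has
    exponent 4.\<close>
  obtain C where C: "C \<ge> 1" "\<forall>z. std_normal_density z * (1 + \<bar>z\<bar>) ^ 7 \<le> C"
    using std_normal_density_decay by blast
  have key: "\<bar>p * std_normal_density z / v\<bar> \<le> 3 * C / (v * (1 + \<bar>z\<bar>) ^ 4)"
    if "v > 0" "\<bar>p\<bar> \<le> 3 * (1 + \<bar>z\<bar>) ^ 3" for p z v
  proof -
    have "\<bar>p\<bar> * std_normal_density z * (1 + \<bar>z\<bar>) ^ 4 \<le> (3 * (1 + \<bar>z\<bar>) ^ 3) * std_normal_density z * (1 + \<bar>z\<bar>) ^ 4"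
      using that by (intro mult_right_mono) auto
    also have "\<dots> = 3 * (std_normal_density z * (1 + \<bar>z\<bar>) ^ 7)"
      by (simp add: power_add[of _ 3 4, simplified])
    also have "\<dots> \<le> 3 * C" using C(2) by (intro mult_left_mono) auto
    finally show ?thesis using that(1) by (simp add: abs_mult field_simps)
  qed
  have cube: "(1 + \<bar>z\<bar>) ^ 3 = 1 + 3 * \<bar>z\<bar> + 3 * \<bar>z\<bar>\<^sup>2 + \<bar>z\<bar> ^ 3" for z :: real
    by (simp add: power3_eq_cube power2_eq_square algebra_simps)
  have p2: "\<bar>- z\<bar> \<le> 3 * (1 + \<bar>z\<bar>) ^ 3" for z :: real
    unfolding cube using zero_le_power[of "\<bar>z\<bar>" 2] zero_le_power[of "\<bar>z\<bar>" 3] by simp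
  have p3: "\<bar>1 - z\<^sup>2\<bar> \<le> 3 * (1 + \<bar>z\<bar>) ^ 3" for z :: real
    unfolding cube using zero_le_power[of "\<bar>z\<bar>" 3] by (simp add: abs_le_iff)
  have p4: "\<bar>3 * z - z ^ 3\<bar> \<le> 3 * (1 + \<bar>z\<bar>) ^ 3" for z :: real
  proof -
    have "\<bar>3 * z - z ^ 3\<bar> \<le> 3 * \<bar>z\<bar> + \<bar>z\<bar> ^ 3"
      using abs_triangle_ineq4[of "3 * z" "z ^ 3"] by (simp add: abs_mult power_abs)
    moreover have "0 \<le> \<bar>z\<bar>\<^sup>2" "0 \<le> \<bar>z\<bar> ^ 3" by simp_all
    ultimately show ?thesis unfolding cube using abs_ge_zero[of z] by argo
  qed
  show ?thesis
  proof (intro exI[of _ "3 * C"] conjI allI impI)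
    fix Y w x :: real assume w: "w > 0"
    have z: "\<bar>(Y - x) / w\<bar> = \<bar>Y - x\<bar> / w" using w by simp
    show "\<bar>heat2 Y w x\<bar> \<le> 3 * C / (w\<^sup>2 * (1 + \<bar>Y - x\<bar> / w) ^ 4)"
      using key[OF _ p2, of "w\<^sup>2" "(Y - x) / w"] w unfolding heat2_def z by simp
    show "\<bar>heat3 Y w x\<bar> \<le> 3 * C / (w ^ 3 * (1 + \<bar>Y - x\<bar> / w) ^ 4)"
      using key[OF _ p3, of "w ^ 3" "(Y - x) / w"] w unfolding heat3_def z by simp
    show "\<bar>heat4 Y w x\<bar> \<le> 3 * C / (w ^ 4 * (1 + \<bar>Y - x\<bar> / w) ^ 4)"
      using key[OF _ p4, of "w ^ 4" "(Y - x) / w"] w unfolding heat4_def z by simp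
  qed (use C(1) in simp)
qed

section \<open>Taylor remainders and a single step of the heat flow\<close>

lemma Taylor1:
  fixes f :: "real \<Rightarrow> real"
  assumes f: "\<And>\<xi>. \<xi> \<in> closed_segment x x' \<Longrightarrow> (f has_real_derivative f' \<xi>) (at \<xi>)"
    and B: "\<And>\<xi>. \<xi> \<in> closed_segment x x' \<Longrightarrow> \<bar>f' \<xi>\<bar> \<le> B"
  shows "\<bar>f x' - f x\<bar> \<le> B * \<bar>x' - x\<bar>"
proof (cases x x' rule: linorder_cases)
  case less
  obtain z where z: "x < z" "z < x'" "f x' - f x = (x' - x) * f' z"
    using MVT2[OF less, of f f'] f less by (auto simp: closed_segment_eq_real_ivl)
  have "\<bar>f' z\<bar> * \<bar>x' - x\<bar> \<le> B * \<bar>x' - x\<bar>" using z less by (intro mult_right_mono B) (auto simp: closed_segment_eq_real_ivl)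
  then show ?thesis using z(3) by (simp add: abs_mult mult.commute)
next
  case greater
  obtain z where z: "x' < z" "z < x" "f x - f x' = (x - x') * f' z"
    using MVT2[OF greater, of f f'] f greater by (auto simp: closed_segment_eq_real_ivl)
  have "\<bar>f' z\<bar> * \<bar>x' - x\<bar> \<le> B * \<bar>x' - x\<bar>" using z greater by (intro mult_right_mono B) (auto simp: closed_segment_eq_real_ivl)
  then show ?thesis using z(3) by (simp add: abs_mult mult.commute abs_minus_commute)
qed simp


text \<open>The remainder, as a function of the endpoint, has as derivative the remainder of one
  order less for f', so \<open>Taylor1\<close> applies to it. The constants omit factorials, and
  segments cover both orders of the endpoints.\<close>

lemma Taylor2:
  fixes f :: "real \<Rightarrow> real"
  assumes f: "\<And>\<xi>. \<xi> \<in> closed_segment x x' \<Longrightarrow> (f has_real_derivative f' \<xi>) (at \<xi>)"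
    and f': "\<And>\<xi>. \<xi> \<in> closed_segment x x' \<Longrightarrow> (f' has_real_derivative f'' \<xi>) (at \<xi>)"
    and B: "\<And>\<xi>. \<xi> \<in> closed_segment x x' \<Longrightarrow> \<bar>f'' \<xi>\<bar> \<le> B"
  shows "\<bar>f x' - f x - f' x * (x' - x)\<bar> \<le> B * (x' - x)\<^sup>2"
proof -
  define g where "g = (\<lambda>u. f u - f x - f' x * (u - x))"
  have "\<bar>g x' - g x\<bar> \<le> (B * \<bar>x' - x\<bar>) * \<bar>x' - x\<bar>"
  proof (rule Taylor1)
    fix \<xi> assume xi: "\<xi> \<in> closed_segment x x'"
    have sub: "closed_segment x \<xi> \<subseteq> closed_segment x x'" and le: "\<bar>\<xi> - x\<bar> \<le> \<bar>x' - x\<bar>"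
      using xi by (auto simp: subset_closed_segment dest: segment_bound1)
    show "(g has_real_derivative f' \<xi> - f' x) (at \<xi>)"
      unfolding g_def by (auto intro!: derivative_eq_intros f xi)
    have "\<bar>f' \<xi> - f' x\<bar> \<le> B * \<bar>\<xi> - x\<bar>"
      by (rule Taylor1[where f' = f'']) (use sub f' B in blast)+
    also have "\<dots> \<le> B * \<bar>x' - x\<bar>" using le B[of x] by (intro mult_left_mono) auto
    finally show "\<bar>f' \<xi> - f' x\<bar> \<le> B * \<bar>x' - x\<bar>" .
  qed
  then show ?thesis by (simp add: g_def power2_eq_square)
qed

lemma Taylor3:
  fixes f :: "real \<Rightarrow> real"
  assumes f: "\<And>\<xi>. \<xi> \<in> closed_segment x x' \<Longrightarrow> (f has_real_derivative f' \<xi>) (at \<xi>)"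
    and f': "\<And>\<xi>. \<xi> \<in> closed_segment x x' \<Longrightarrow> (f' has_real_derivative f'' \<xi>) (at \<xi>)"
    and f'': "\<And>\<xi>. \<xi> \<in> closed_segment x x' \<Longrightarrow> (f'' has_real_derivative f''' \<xi>) (at \<xi>)"
    and B: "\<And>\<xi>. \<xi> \<in> closed_segment x x' \<Longrightarrow> \<bar>f''' \<xi>\<bar> \<le> B"
  shows "\<bar>f x' - f x - f' x * (x' - x) - f'' x * (x' - x)\<^sup>2 / 2\<bar> \<le> B * \<bar>x' - x\<bar> ^ 3"
proof -
  define g where "g = (\<lambda>u. f u - f x - f' x * (u - x) - f'' x * (u - x)\<^sup>2 / 2)"
  have "\<bar>g x' - g x\<bar> \<le> (B * (x' - x)\<^sup>2) * \<bar>x' - x\<bar>"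
  proof (rule Taylor1)
    fix \<xi> assume xi: "\<xi> \<in> closed_segment x x'"
    have sub: "closed_segment x \<xi> \<subseteq> closed_segment x x'" and le: "\<bar>\<xi> - x\<bar> \<le> \<bar>x' - x\<bar>"
      using xi by (auto simp: subset_closed_segment dest: segment_bound1)
    show "(g has_real_derivative f' \<xi> - f' x - f'' x * (\<xi> - x)) (at \<xi>)"
      unfolding g_def by (auto intro!: derivative_eq_intros f xi)
    have "\<bar>f' \<xi> - f' x - f'' x * (\<xi> - x)\<bar> \<le> B * (\<xi> - x)\<^sup>2"
      by (rule Taylor2[where f'' = f''']) (use sub f' f'' B in blast)+
    also have "\<dots> \<le> B * (x' - x)\<^sup>2" using le B[of x]
      by (intro mult_left_mono) (auto simp: abs_le_square_iff)
    finally show "\<bar>f' \<xi> - f' x - f'' x * (\<xi> - x)\<bar> \<le> B * (x' - x)\<^sup>2" .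
  qed
  then show ?thesis by (simp add: g_def power2_eq_square power3_eq_cube mult.assoc)
qed

text \<open>The subtracted expression is chosen so that its transition average is known exactly: G'
  stays at the new point, where the Poisson equation acts, and the change of \<open>heat2\<close> is
  linearised against the old value G, so that this linear term averages to 0 for a martingale. A
  direct bound of that term would cost B3 * g0, of order s^(-1 - beta); what remains costs only B3 *
  g1 and B4 * g0, of order s^(-2 - beta).\<close>

lemma heat_space_step:
  assumes w: "w > 0" and \<delta>: "\<bar>x' - x\<bar> \<le> K"
    and B3: "\<And>\<xi>. \<bar>\<xi> - x\<bar> \<le> K \<Longrightarrow> \<bar>heat3 Y w \<xi>\<bar> \<le> B3"
    and B4: "\<And>\<xi>. \<bar>\<xi> - x\<bar> \<le> K \<Longrightarrow> \<bar>heat4 Y w \<xi>\<bar> \<le> B4"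
    and G: "\<bar>G' - G\<bar> \<le> g1" "\<bar>G\<bar> \<le> g0"
  shows "\<bar>heat0 Y w x' - heat2 Y w x' * G' / 2 -
      (heat0 Y w x + heat1 Y w x * (x' - x) + heat2 Y w x * (x' - x)\<^sup>2 / 2
        - heat2 Y w x * G' / 2 - heat3 Y w x * (x' - x) * G / 2)\<bar>
    \<le> K ^ 3 * B3 + K * B3 * g1 + K\<^sup>2 * B4 * g0"
proof -
  have K: "K \<ge> 0" using \<delta> by linarith
  have B0: "B3 \<ge> 0" "B4 \<ge> 0" using B3[of x] B4[of x] K by (auto intro: order_trans[OF abs_ge_zero])
  note H = heat_deriv_x[OF w]
  have seg: "\<bar>\<xi> - x\<bar> \<le> K" if "\<xi> \<in> closed_segment x x'" for \<xi>
    using segment_bound1[OF that] \<delta> by simp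
  have 1: "\<bar>heat0 Y w x' - heat0 Y w x - heat1 Y w x * (x' - x) - heat2 Y w x * (x' - x)\<^sup>2 / 2\<bar> \<le> B3 * \<bar>x' - x\<bar> ^ 3"
    by (rule Taylor3[OF H(1) H(2) H(3)]) (use seg B3 \<delta> in auto)
  have 2: "\<bar>heat2 Y w x' - heat2 Y w x - heat3 Y w x * (x' - x)\<bar> \<le> B4 * (x' - x)\<^sup>2"
    by (rule Taylor2[OF H(3) H(4)]) (use seg B4 \<delta> in auto)
  have 3: "\<bar>heat2 Y w x' - heat2 Y w x\<bar> \<le> B3 * \<bar>x' - x\<bar>"
    by (rule Taylor1[OF H(3)]) (use seg B3 \<delta> in auto)
  have "heat0 Y w x' - heat2 Y w x' * G' / 2 -
      (heat0 Y w x + heat1 Y w x * (x' - x) + heat2 Y w x * (x' - x)\<^sup>2 / 2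
        - heat2 Y w x * G' / 2 - heat3 Y w x * (x' - x) * G / 2)
    = (heat0 Y w x' - heat0 Y w x - heat1 Y w x * (x' - x) - heat2 Y w x * (x' - x)\<^sup>2 / 2)
      - (heat2 Y w x' - heat2 Y w x) * (G' - G) / 2
      - (heat2 Y w x' - heat2 Y w x - heat3 Y w x * (x' - x)) * G / 2" (is "_ = ?a - ?b / 2 - ?c / 2")
    by (simp add: field_simps)
  moreover have "\<bar>?a\<bar> \<le> K ^ 3 * B3"
  proof -
    have "B3 * \<bar>x' - x\<bar> ^ 3 \<le> B3 * K ^ 3" using B0 \<delta> by (intro mult_left_mono power_mono) auto
    then show ?thesis using 1 by (simp add: mult.commute)
  qed
  moreover have "\<bar>?b\<bar> \<le> K * B3 * g1"
  proof -
    have "\<bar>heat2 Y w x' - heat2 Y w x\<bar> \<le> B3 * K" using 3 mult_left_mono[OF \<delta> B0(1)] by linarith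
    then have "\<bar>?b\<bar> \<le> (B3 * K) * g1" unfolding abs_mult using G B0 K by (intro mult_mono) auto
    then show ?thesis by (simp add: mult.commute)
  qed
  moreover have "\<bar>?c\<bar> \<le> K\<^sup>2 * B4 * g0"
  proof -
    have "(x' - x)\<^sup>2 \<le> K\<^sup>2" using \<delta> by (simp add: abs_le_square_iff[symmetric] K)
    then have "\<bar>heat2 Y w x' - heat2 Y w x - heat3 Y w x * (x' - x)\<bar> \<le> B4 * K\<^sup>2" 
      using 2 mult_left_mono[OF _ B0(2)] by fastforce
    then have "\<bar>?c\<bar> \<le> (B4 * K\<^sup>2) * g0" unfolding abs_mult using G B0 K by (intro mult_mono) auto
    then show ?thesis by (simp add: mult.commute)
  qed
  ultimately show ?thesis by linarith
qed

text \<open>The expansion is made around the later time, that is around remaining time t - 1, since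
  the space step is taken there as well; the term with D / 2 is the one that cancels the averaged
  quadratic term.\<close>

lemma heat_time_step:
  assumes D: "D > 0" and t: "t > 1"
    and B4: "\<And>s. t - 1 \<le> s \<Longrightarrow> s \<le> t \<Longrightarrow> \<bar>heat4 Y (sqrt (D * s)) x\<bar> \<le> B4"
  shows "\<bar>heat0 Y (sqrt (D * t)) x - heat0 Y (sqrt (D * (t - 1))) x
      - D / 2 * heat2 Y (sqrt (D * (t - 1))) x\<bar> \<le> D\<^sup>2 * B4"
    and "\<bar>heat2 Y (sqrt (D * t)) x - heat2 Y (sqrt (D * (t - 1))) x\<bar> \<le> D * B4"
proof -
  note H = heat_deriv_time[OF D]
  have seg: "s > 0" "t - 1 \<le> s" "s \<le> t" if "s \<in> closed_segment (t - 1) t" for s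
    using that t by (auto simp: closed_segment_eq_real_ivl)
  have 2: "\<bar>D / 2 * heat4 Y (sqrt (D * s)) x\<bar> \<le> D * B4" if "s \<in> closed_segment (t - 1) t" for s
    using mult_mono[of "D / 2" D "\<bar>heat4 Y (sqrt (D * s)) x\<bar>" B4] B4[of s] seg[OF that] D by (simp add: abs_mult)
  have 1: "\<bar>D / 2 * (D / 2 * heat4 Y (sqrt (D * s)) x)\<bar> \<le> D * (D * B4)" if "s \<in> closed_segment (t - 1) t" for s
    using mult_mono[OF _ 2[OF that], of "D / 2" D] D by (simp add: abs_mult)
  have "\<bar>heat0 Y (sqrt (D * t)) x - heat0 Y (sqrt (D * (t - 1))) x
      - D / 2 * heat2 Y (sqrt (D * (t - 1))) x * (t - (t - 1))\<bar> \<le> (D * (D * B4)) * (t - (t - 1))\<^sup>2"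
    by (rule Taylor2[OF H(1) DERIV_cmult[OF H(2)] 1]) (use seg in auto)
  then show "\<bar>heat0 Y (sqrt (D * t)) x - heat0 Y (sqrt (D * (t - 1))) x
      - D / 2 * heat2 Y (sqrt (D * (t - 1))) x\<bar> \<le> D\<^sup>2 * B4" by (simp add: power2_eq_square mult.assoc)
  have "\<bar>heat2 Y (sqrt (D * t)) x - heat2 Y (sqrt (D * (t - 1))) x\<bar> \<le> (D * B4) * \<bar>t - (t - 1)\<bar>"
    by (rule Taylor1[OF H(2) 2]) (use seg in auto)
  then show "\<bar>heat2 Y (sqrt (D * t)) x - heat2 Y (sqrt (D * (t - 1))) x\<bar> \<le> D * B4" by simp
qed

section \<open>Power sums and averaging\<close>

text \<open>Integral comparison in discrete form: by the mean value theorem each term is at most the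
  increment of \<open>real N powr (1 - p) / (1 - p)\<close>.\<close>

lemma sum_powr_neg_le:
  fixes p :: real
  assumes "0 \<le> p" "p < 1"
  shows "(\<Sum>k\<in>{1..N}. real k powr - p) \<le> real N powr (1 - p) / (1 - p)"
proof (induction N)
  case (Suc N)
  have step: "real (Suc N) powr - p \<le> (real (Suc N) powr (1 - p) - real N powr (1 - p)) / (1 - p)"
  proof (cases "N = 0")
    case True
    then show ?thesis using assms by simp
  next
    case False
    have "\<exists>z>real N. z < real (Suc N) \<and> real (Suc N) powr (1 - p) - real N powr (1 - p)
        = (real (Suc N) - real N) * ((1 - p) * z powr (1 - p - 1))"
      by (rule MVT2) (use False in \<open>auto intro!: derivative_eq_intros\<close>)
    then obtain z where z: "real N < z" "z < real (Suc N)"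
      "real (Suc N) powr (1 - p) - real N powr (1 - p) = (1 - p) * z powr - p" by auto
    have "real (Suc N) powr - p \<le> z powr - p"
      using z False assms by (intro powr_mono2') auto
    then show ?thesis using z(3) assms by simp
  qed
  then show ?case using Suc by (simp add: diff_divide_distrib)
qed simp

lemma sum_powr_neg_bounded:
  fixes d :: real
  assumes "d > 0"
  shows "\<exists>C\<ge>0. \<forall>N. (\<Sum>k\<in>{1..N}. real k powr (- 1 - d)) \<le> C"
proof -
  have "summable (\<lambda>k. real k powr (- 1 - d))"
    using assms by (simp add: summable_real_powr_iff)
  then have "(\<Sum>k\<in>{1..N}. real k powr (- 1 - d)) \<le> (\<Sum>k. real k powr (- 1 - d))" for N
    by (intro sum_le_suminf) auto
  moreover have "0 \<le> (\<Sum>k. real k powr (- 1 - d))" using \<open>summable _\<close> by (intro suminf_nonneg) auto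
  ultimately show ?thesis by blast
qed

text \<open>One of t and N - t is at least N / 2, and its power is replaced by that of N / 2. The
  other factor is then summed over the full range.\<close>

lemma sum_powr_convolution_le:
  fixes p q :: real
  assumes "0 \<le> p" "0 \<le> q" "N \<ge> 1"
  shows "(\<Sum>t\<in>{1..<N}. (real N - real t) powr - p * real t powr - q)
    \<le> (real N / 2) powr - q * (\<Sum>k\<in>{1..N}. real k powr - p)
      + (real N / 2) powr - p * (\<Sum>k\<in>{1..N}. real k powr - q)"
proof -
  have "(\<Sum>t\<in>{1..<N}. (real N - real t) powr - p * real t powr - q)
    \<le> (\<Sum>t\<in>{1..<N}. (real N / 2) powr - q * (real (N - t) powr - p) + (real N / 2) powr - p * real t powr - q)"
  proof (rule sum_mono)
    fix t assume t: "t \<in> {1..<N}"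
    then have e: "real (N - t) = real N - real t" by auto
    show "(real N - real t) powr - p * real t powr - q
      \<le> (real N / 2) powr - q * (real (N - t) powr - p) + (real N / 2) powr - p * real t powr - q"
    proof (cases "real t \<ge> real N / 2")
      case True
      then have "real t powr - q \<le> (real N / 2) powr - q"
        using assms t by (intro powr_mono2') auto
      then have "(real N - real t) powr - p * real t powr - q \<le> (real N - real t) powr - p * (real N / 2) powr - q"
        by (intro mult_left_mono) auto
      also have "\<dots> \<le> (real N / 2) powr - q * (real (N - t) powr - p) + (real N / 2) powr - p * real t powr - q"
        by (simp add: e mult.commute)
      finally show ?thesis .
    next
      case False
      then have "(real N - real t) powr - p \<le> (real N / 2) powr - p"
        using assms t by (intro powr_mono2') auto
      then have "(real N - real t) powr - p * real t powr - q \<le> (real N / 2) powr - p * real t powr - q"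
        by (intro mult_right_mono) auto
      also have "\<dots> \<le> (real N / 2) powr - q * (real (N - t) powr - p) + (real N / 2) powr - p * real t powr - q"
        by simp
      finally show ?thesis .
    qed
  qed
  also have "\<dots> = (real N / 2) powr - q * (\<Sum>t\<in>{1..<N}. real (N - t) powr - p)
      + (real N / 2) powr - p * (\<Sum>t\<in>{1..<N}. real t powr - q)"
    by (simp add: sum.distrib sum_distrib_left)
  also have "(\<Sum>t\<in>{1..<N}. real (N - t) powr - p) = (\<Sum>t\<in>{1..<N}. real t powr - p)"
    by (rule sum.reindex_bij_witness[of _ "\<lambda>t. N - t" "\<lambda>t. N - t"]) auto
  also have "(real N / 2) powr - q * (\<Sum>t\<in>{1..<N}. real t powr - p)
      + (real N / 2) powr - p * (\<Sum>t\<in>{1..<N}. real t powr - q)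
      \<le> (real N / 2) powr - q * (\<Sum>k\<in>{1..N}. real k powr - p)
      + (real N / 2) powr - p * (\<Sum>k\<in>{1..N}. real k powr - q)"
    by (intro add_mono mult_left_mono sum_mono2) auto
  finally show ?thesis .
qed

lemma half_powr_neg_le:
  fixes p N :: real
  assumes "0 \<le> p" "p \<le> 2" "N \<ge> 0"
  shows "(N / 2) powr - p \<le> 4 * N powr - p"
proof -
  have "(N / 2) powr - p = 2 powr p * N powr - p"
    using assms by (simp add: powr_divide powr_minus field_simps)
  also have "2 powr p \<le> (2::real) powr 2" using assms by (intro powr_mono) auto
  finally show ?thesis by (simp add: mult_right_mono)
qed

lemma sqrt_powr: "x \<ge> 0 \<Longrightarrow> sqrt x powr a = x powr (a / 2)"
  by (subst powr_half_sqrt[symmetric]) (simp_all only: powr_powr, simp_all)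

lemma divide_le_cmult:
  fixes x :: real
  assumes "0 \<le> x" "0 < d" "1 \<le> c * d"
  shows "x / d \<le> c * x"
  using mult_right_mono[OF assms(3,1)] assms(2) by (simp add: divide_le_eq mult_ac)

text \<open>The two summands scale differently. With 1 / sqrt t the sum behaves like a Beta integral
  and gives N^(-beta/2) outright. With t^-gamma there is no such help near t = N, so a power of the
  smoothing scale has to be extracted; this is the gain beta (1 - beta) / 4 of one round of the
  iteration.\<close>

lemma error_sum_le:
  fixes \<beta> \<gamma> :: real
  assumes \<beta>: "0 < \<beta>" "\<beta> \<le> 1/4" and \<gamma>: "0 \<le> \<gamma>" "\<gamma> \<le> \<beta> / 2"
  shows "\<exists>C\<ge>0. \<forall>N\<ge>1. (\<Sum>t\<in>{1..<N}. sqrt (real N - real t + (real N powr ((1 - \<beta>) / 2))\<^sup>2) powr (- 2 - \<beta>)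
      * (sqrt (real N - real t + (real N powr ((1 - \<beta>) / 2))\<^sup>2) / sqrt (real t) + real t powr - \<gamma>))
    \<le> C * (real N powr - (\<beta> / 2) + real N powr - (\<gamma> + \<beta> * (1 - \<beta>) / 4))"
proof -
  obtain C0 where C0: "C0 \<ge> 0" "\<And>N. (\<Sum>k\<in>{1..N}. real k powr (- 1 - \<beta> / 4)) \<le> C0"
    using sum_powr_neg_bounded[of "\<beta> / 4"] \<beta> by auto
  show ?thesis
  proof (intro exI[of _ "4 * C0 + 32"] conjI allI impI)
    fix N :: nat assume N: "N \<ge> 1"
    define \<sigma> where "\<sigma> = real N powr ((1 - \<beta>) / 2)"
    define s where "s = (\<lambda>t. sqrt (real N - real t + \<sigma>\<^sup>2))"
    have \<sigma>: "\<sigma> > 0" using N by (simp add: \<sigma>_def)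
    have sig: "\<sigma> powr - (\<beta> / 2) = real N powr - (\<beta> * (1 - \<beta>) / 4)"
      by (simp add: \<sigma>_def powr_powr field_simps)
    have term_le: "s t powr (- 2 - \<beta>) * (s t / sqrt (real t) + real t powr - \<gamma>)
       \<le> (real N - real t) powr - ((1 + \<beta>) / 2) * real t powr - (1/2)
        + \<sigma> powr - (\<beta> / 2) * ((real N - real t) powr - (1 + \<beta> / 4) * real t powr - \<gamma>)" if t: "t \<in> {1..<N}" for t
    proof -
      have pos: "real N - real t > 0" using t by auto
      have s: "s t > 0" "s t \<ge> \<sigma>" "s t \<ge> sqrt (real N - real t)"
        using pos \<sigma> by (auto simp: s_def real_le_rsqrt add_pos_nonneg)
      have "s t powr (- 2 - \<beta>) * (s t / sqrt (real t)) = s t powr (- 1 - \<beta>) * real t powr - (1/2)"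
      proof -
        have "s t powr (- 1 - \<beta>) = s t powr (- 2 - \<beta>) * s t"
          using s(1) powr_add[of "s t" "- 2 - \<beta>" 1] by simp
        moreover have "1 / sqrt (real t) = real t powr - (1/2)"
          using sqrt_powr[of "real t" "- 1"] by (simp add: powr_minus_divide)
        ultimately show ?thesis by (metis mult.assoc times_divide_eq_right mult.right_neutral)
      qed
      also have "\<dots> \<le> (sqrt (real N - real t)) powr (- 1 - \<beta>) * real t powr - (1/2)"
        using s pos \<beta> by (intro mult_right_mono powr_mono2') auto
      also have "(sqrt (real N - real t)) powr (- 1 - \<beta>) = (real N - real t) powr - ((1 + \<beta>) / 2)"
        unfolding sqrt_powr[OF less_imp_le[OF pos]] by (rule arg_cong[of _ _ "\<lambda>e. _ powr e"]) (simp add: field_simps)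
      finally have 1: "s t powr (- 2 - \<beta>) * (s t / sqrt (real t))
        \<le> (real N - real t) powr - ((1 + \<beta>) / 2) * real t powr - (1/2)" .
      \<comment> \<open>Half of the surplus exponent is turned into a power of
        \<open>\<sigma>\<close>; the other half keeps the exponent of N - t below -1, so the
        remaining sum is bounded.\<close>
      have "s t powr (- 2 - \<beta>) = s t powr - (\<beta> / 2) * s t powr (- 2 - \<beta> / 2)"
        unfolding powr_add[symmetric] by (rule arg_cong[of _ _ "\<lambda>e. _ powr e"]) (simp add: field_simps)
      also have "\<dots> \<le> \<sigma> powr - (\<beta> / 2) * sqrt (real N - real t) powr (- 2 - \<beta> / 2)"
        using s \<sigma> pos \<beta> by (intro mult_mono powr_mono2') auto
      also have "sqrt (real N - real t) powr (- 2 - \<beta> / 2) = (real N - real t) powr - (1 + \<beta> / 4)"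
        unfolding sqrt_powr[OF less_imp_le[OF pos]] by (rule arg_cong[of _ _ "\<lambda>e. _ powr e"]) (simp add: field_simps)
      finally have 2: "s t powr (- 2 - \<beta>) * real t powr - \<gamma>
          \<le> \<sigma> powr - (\<beta> / 2) * (real N - real t) powr - (1 + \<beta> / 4) * real t powr - \<gamma>"
        by (intro mult_right_mono) auto
      show ?thesis using 1 2 by (simp add: algebra_simps)
    qed
    have A: "(\<Sum>t\<in>{1..<N}. (real N - real t) powr - ((1 + \<beta>) / 2) * real t powr - (1/2)) \<le> 32 * real N powr - (\<beta> / 2)"
    proof -
      have p: "0 \<le> (1 + \<beta>) / 2" "(1 + \<beta>) / 2 < 1" using \<beta> by auto
      have e: "1 - (1 + \<beta>) / 2 = (1 - \<beta>) / 2" by (simp add: field_simps)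
      have "(\<Sum>t\<in>{1..<N}. (real N - real t) powr - ((1 + \<beta>) / 2) * real t powr - (1/2))
        \<le> (real N / 2) powr - (1/2) * (\<Sum>k\<in>{1..N}. real k powr - ((1 + \<beta>) / 2))
          + (real N / 2) powr - ((1 + \<beta>) / 2) * (\<Sum>k\<in>{1..N}. real k powr - (1/2))"
        by (rule sum_powr_convolution_le) (use p N in auto)
      also have "\<dots> \<le> (4 * real N powr - (1/2)) * (4 * real N powr ((1 - \<beta>) / 2))
          + (4 * real N powr - ((1 + \<beta>) / 2)) * (4 * real N powr (1/2))"
      proof (intro add_mono mult_mono half_powr_neg_le)
        have "(\<Sum>k\<in>{1..N}. real k powr - ((1 + \<beta>) / 2)) \<le> real N powr ((1 - \<beta>) / 2) / ((1 - \<beta>) / 2)"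
          using sum_powr_neg_le[OF p, of N] by (simp only: e)
        also have "\<dots> \<le> 4 * real N powr ((1 - \<beta>) / 2)"
          by (rule divide_le_cmult) (use \<beta> in auto)
        finally show "(\<Sum>k\<in>{1..N}. real k powr - ((1 + \<beta>) / 2)) \<le> 4 * real N powr ((1 - \<beta>) / 2)" .
        have "(\<Sum>k\<in>{1..N}. real k powr - (1/2)) \<le> real N powr (1 - 1/2) / (1 - 1/2)"
          by (rule sum_powr_neg_le) auto
        also have "\<dots> \<le> 4 * real N powr (1/2)" by simp
        finally show "(\<Sum>k\<in>{1..N}. real k powr - (1/2)) \<le> 4 * real N powr (1/2)" .
      qed (use p in \<open>auto intro: sum_nonneg\<close>)
      also have "\<dots> = 32 * real N powr - (\<beta> / 2)"
        by (simp add: powr_add[symmetric] diff_divide_distrib add_divide_distrib)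
      finally show ?thesis .
    qed
    have B: "(\<Sum>t\<in>{1..<N}. (real N - real t) powr - (1 + \<beta> / 4) * real t powr - \<gamma>) \<le> (4 * C0 + 8) * real N powr - \<gamma>"
    proof -
      have "(\<Sum>t\<in>{1..<N}. (real N - real t) powr - (1 + \<beta> / 4) * real t powr - \<gamma>)
        \<le> (real N / 2) powr - \<gamma> * (\<Sum>k\<in>{1..N}. real k powr - (1 + \<beta> / 4))
          + (real N / 2) powr - (1 + \<beta> / 4) * (\<Sum>k\<in>{1..N}. real k powr - \<gamma>)"
        by (rule sum_powr_convolution_le) (use \<beta> \<gamma> N in auto)
      also have "\<dots> \<le> (4 * real N powr - \<gamma>) * C0 + (4 * real N powr - (1 + \<beta> / 4)) * (2 * real N powr (1 - \<gamma>))"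
      proof (intro add_mono mult_mono half_powr_neg_le)
        have "- (1 + \<beta> / 4) = - 1 - \<beta> / 4" by simp
        then show "(\<Sum>k\<in>{1..N}. real k powr - (1 + \<beta> / 4)) \<le> C0" using C0(2)[of N] by (simp only:)
        have "(\<Sum>k\<in>{1..N}. real k powr - \<gamma>) \<le> real N powr (1 - \<gamma>) / (1 - \<gamma>)"
          by (rule sum_powr_neg_le) (use \<beta> \<gamma> in auto)
        also have "\<dots> \<le> 2 * real N powr (1 - \<gamma>)"
          by (rule divide_le_cmult) (use \<beta> \<gamma> in auto)
        finally show "(\<Sum>k\<in>{1..N}. real k powr - \<gamma>) \<le> 2 * real N powr (1 - \<gamma>)" .
      qed (use \<beta> \<gamma> C0 in \<open>auto intro: sum_nonneg\<close>)
      also have "\<dots> = 4 * C0 * real N powr - \<gamma> + 8 * (real N powr - (\<beta> / 4) * real N powr - \<gamma>)"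
        by (simp add: powr_add[symmetric])
      also have "\<dots> \<le> 4 * C0 * real N powr - \<gamma> + 8 * (1 * real N powr - \<gamma>)"
        using N \<beta> by (intro add_left_mono mult_left_mono mult_right_mono) (auto simp: powr_minus inverse_le_1_iff ge_one_powr_ge_zero)
      finally show ?thesis by (simp add: algebra_simps)
    qed
    have "(\<Sum>t\<in>{1..<N}. s t powr (- 2 - \<beta>) * (s t / sqrt (real t) + real t powr - \<gamma>))
      \<le> (\<Sum>t\<in>{1..<N}. (real N - real t) powr - ((1 + \<beta>) / 2) * real t powr - (1/2)
        + \<sigma> powr - (\<beta> / 2) * ((real N - real t) powr - (1 + \<beta> / 4) * real t powr - \<gamma>))"
      by (intro sum_mono term_le)
    also have "\<dots> \<le> 32 * real N powr - (\<beta> / 2) + \<sigma> powr - (\<beta> / 2) * ((4 * C0 + 8) * real N powr - \<gamma>)"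
      unfolding sum.distrib sum_distrib_left[symmetric] by (intro add_mono A mult_left_mono B) auto
    also have "\<dots> = 32 * real N powr - (\<beta> / 2) + (4 * C0 + 8) * real N powr - (\<gamma> + \<beta> * (1 - \<beta>) / 4)"
      by (simp add: sig powr_add[symmetric] mult.left_commute add.commute)
    also have "\<dots> \<le> (4 * C0 + 32) * (real N powr - (\<beta> / 2) + real N powr - (\<gamma> + \<beta> * (1 - \<beta>) / 4))"
      using C0(1) by (simp add: algebra_simps)
    finally show "(\<Sum>t\<in>{1..<N}. sqrt (real N - real t + (real N powr ((1 - \<beta>) / 2))\<^sup>2) powr (- 2 - \<beta>)
      * (sqrt (real N - real t + (real N powr ((1 - \<beta>) / 2))\<^sup>2) / sqrt (real t) + real t powr - \<gamma>))
      \<le> (4 * C0 + 32) * (real N powr - (\<beta> / 2) + real N powr - (\<gamma> + \<beta> * (1 - \<beta>) / 4))"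
      unfolding s_def \<sigma>_def .
  qed (use C0 in simp)
qed

section \<open>From averages over centred windows to increments over arbitrary intervals\<close>

lemma sublinear_le:
  fixes C \<beta> :: real
  assumes "C \<ge> 0" "0 < \<beta>" "\<beta> < 1"
  shows "\<exists>C'\<ge>0. \<forall>v\<ge>0. C * v powr (1 - \<beta>) \<le> v / 2 + C'"
proof -
  \<comment> \<open>Here \<open>v0 powr \<beta>\<close> is 2 C: beyond \<open>v0\<close> the left
    side is at most v / 2, below it monotonicity gives the additive constant.\<close>
  define v0 where "v0 = (2 * C) powr (1 / \<beta>)"
  show ?thesis
  proof (intro exI[of _ "C * v0 powr (1 - \<beta>)"] conjI allI impI)
    fix v :: real assume v: "v \<ge> 0"
    show "C * v powr (1 - \<beta>) \<le> v / 2 + C * v0 powr (1 - \<beta>)"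
    proof (cases "v \<le> v0")
      case True
      then have "C * v powr (1 - \<beta>) \<le> C * v0 powr (1 - \<beta>)"
        using assms v by (intro mult_left_mono powr_mono2) auto
      then show ?thesis using v by simp
    next
      case False
      have vpos: "v > 0" using False powr_ge_zero[of "2 * C" "1 / \<beta>"] unfolding v0_def by linarith
      have "2 * C = v0 powr \<beta>" using assms by (simp add: v0_def powr_powr)
      also have "\<dots> \<le> v powr \<beta>" using False assms by (intro powr_mono2) (auto simp: v0_def)
      finally have "2 * C * v powr (1 - \<beta>) \<le> v powr \<beta> * v powr (1 - \<beta>)" by (intro mult_right_mono) auto
      also have "\<dots> = v" using vpos by (simp flip: powr_add)
      finally show ?thesis using assms mult_nonneg_nonneg[of C "v0 powr (1 - \<beta>)"] powr_ge_zero[of v0 "1 - \<beta>"] by linarith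
    qed
  qed (use assms in simp)
qed

text \<open>The averaging bound is applied around the midpoint of u and v. If the interval is too
  short for it, the Lipschitz bound suffices: the length is then O(|k|^0.01), and |k| is at most a
  multiple of the cube of the scale on the right. Only v needs a bound, since a remote u is paid for
  by the distance.\<close>

lemma interval_growth:
  fixes h :: "int \<Rightarrow> real" and \<beta> \<kappa> K C0 :: real
  assumes \<beta>: "0 < \<beta>" "\<beta> \<le> 1/4" and \<kappa>: "\<kappa> \<ge> 1" and C0: "C0 \<ge> 0"
    and lip: "\<And>n. \<bar>h (n + 1) - h n\<bar> \<le> K"
    and avg: "\<And>k L. real_of_int L \<ge> max 1 \<bar>real_of_int k\<bar> powr 0.01 \<Longrightarrow>
        \<bar>h (k + L) - h (k - L)\<bar> \<le> C0 * real_of_int L powr (1 - \<beta>)"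
  shows "\<exists>C\<ge>1. \<forall>N\<ge>1. \<forall>u v. \<bar>real_of_int v\<bar> \<le> \<kappa> * real N \<longrightarrow>
    \<bar>h u - h v\<bar> \<le> C * (\<bar>real_of_int (u - v)\<bar> + real N powr ((1 - \<beta>) / 2)) powr (1 - \<beta>)"
proof -
  have K: "K \<ge> 0" using lip[of 0] by linarith
  have lips: "\<bar>h (n + int k) - h n\<bar> \<le> K * real k" for n k
  proof (induction k)
    case (Suc k)
    have "\<bar>h (n + int (Suc k)) - h (n + int k)\<bar> \<le> K" using lip[of "n + int k"] by (simp add: add_ac)
    then show ?case using Suc by (simp add: algebra_simps)
  qed simp
  define C where "C = 1 + C0 + K + 6 * K * \<kappa>"
  show ?thesis
  proof (intro exI[of _ C] conjI allI impI)
    show "1 \<le> C" using C0 K \<kappa> by (simp add: C_def)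
    fix N :: nat and u v :: int assume N: "N \<ge> 1" and v: "\<bar>real_of_int v\<bar> \<le> \<kappa> * real N"
    define \<sigma> where "\<sigma> = real N powr ((1 - \<beta>) / 2)"
    define lo hi where "lo = min u v" and "hi = max u v"
    define L where "L = (hi - lo) div 2"
    define k where "k = lo + L"
    define g where "g = real_of_int (hi - lo) + \<sigma>"
    have \<sigma>: "\<sigma> \<ge> 1" using N \<beta> by (simp add: \<sigma>_def ge_one_powr_ge_zero)
    have lohi: "lo \<le> hi" by (simp add: lo_def hi_def)
    have g: "g \<ge> 1" using \<sigma> lohi by (simp add: g_def)
    have L: "0 \<le> L" "hi = k + L \<or> hi = k + L + 1" "lo = k - L" "2 * L \<le> hi - lo" "hi - lo \<le> 2 * L + 1"
      using lohi by (auto simp: L_def k_def)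
    have gpow: "1 \<le> g powr (1 - \<beta>)" using g \<beta> by (intro ge_one_powr_ge_zero) auto
    have goal: "\<bar>h hi - h lo\<bar> \<le> C * g powr (1 - \<beta>)"
    proof (cases "real_of_int L \<ge> max 1 \<bar>real_of_int k\<bar> powr 0.01")
      case True
      have "\<bar>h hi - h (k + L)\<bar> \<le> K" using L(2) lip[of "k + L"] K by auto
      \<comment> \<open>An interval of odd length exceeds the window around its midpoint by one
        site, which costs one further K.\<close>
      then have "\<bar>h hi - h lo\<bar> \<le> C0 * real_of_int L powr (1 - \<beta>) + K"
        using avg[OF True] unfolding L(3) by linarith
      also have "\<dots> \<le> C0 * g powr (1 - \<beta>) + K * g powr (1 - \<beta>)"
      proof (intro add_mono mult_left_mono powr_mono2)
        show "real_of_int L \<le> g" using L(1,4) \<sigma> by (simp add: g_def)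
        show "K \<le> K * g powr (1 - \<beta>)" using mult_left_mono[OF gpow K] by simp
      qed (use L(1) C0 \<beta> in auto)
      also have "\<dots> \<le> C * g powr (1 - \<beta>)"
        unfolding C_def distrib_right[symmetric] using K \<kappa> by (intro mult_right_mono) auto
      finally show ?thesis .
    next
      case False
      have "\<bar>k\<bar> \<le> \<bar>v\<bar> + (hi - lo)"
      proof (cases "u \<le> v")
        case True
        then show ?thesis using L lohi by (auto simp: lo_def hi_def)
      next
        case False
        then show ?thesis using L lohi by (auto simp: lo_def hi_def)
      qed
      then have "\<bar>real_of_int k\<bar> \<le> \<bar>real_of_int v\<bar> + real_of_int (hi - lo)" by linarith
      \<comment> \<open>Since beta <= 1/4, the exponent 3 (1 - beta) / 2 is at least 1. This turns a
        bound in terms of N into one in terms of \<open>g\<close>, with 0.03 below 1 - beta.\<close>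
      moreover have "real N \<le> g ^ 3"
      proof -
        have "real N powr 1 \<le> real N powr ((1 - \<beta>) / 2 * 3)" using N \<beta> by (intro powr_mono) auto
        also have "\<dots> = \<sigma> powr 3" by (simp add: \<sigma>_def powr_powr)
        also have "\<dots> = \<sigma> ^ 3" using \<sigma> by (simp add: powr_realpow)
        also have "\<dots> \<le> g ^ 3" using \<sigma> lohi by (intro power_mono) (auto simp: g_def)
        finally show ?thesis by simp
      qed
      moreover have "real_of_int (hi - lo) \<le> g ^ 3"
      proof -
        have "g \<le> g ^ 3" using g self_le_power[of g 3] by simp
        then show ?thesis using \<sigma> by (simp add: g_def)
      qed
      ultimately have "\<bar>real_of_int k\<bar> \<le> \<kappa> * g ^ 3 + \<kappa> * g ^ 3"
        using v \<kappa> g mult_left_mono[of "real N" "g ^ 3" \<kappa>] mult_right_mono[of 1 \<kappa> "g ^ 3"] by linarith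
      moreover have "1 \<le> \<kappa> * g ^ 3" using \<kappa> g mult_mono[of 1 \<kappa> 1 "g ^ 3"] by simp
      ultimately have kb: "max 1 \<bar>real_of_int k\<bar> \<le> (2 * \<kappa>) * g ^ 3" by (simp add: max_def)
      have "max 1 \<bar>real_of_int k\<bar> powr 0.01 \<le> ((2 * \<kappa>) * g ^ 3) powr 0.01"
        using kb by (intro powr_mono2) auto
      also have "\<dots> = (2 * \<kappa>) powr 0.01 * g powr 0.03"
        using \<kappa> g by (simp add: powr_mult powr_powr flip: powr_numeral)
      also have "\<dots> \<le> (2 * \<kappa>) powr 1 * g powr (1 - \<beta>)"
        using \<kappa> g \<beta> by (intro mult_mono powr_mono) auto
      finally have m: "max 1 \<bar>real_of_int k\<bar> powr 0.01 \<le> (2 * \<kappa>) * g powr (1 - \<beta>)" using \<kappa> by simp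
      have "1 \<le> max 1 \<bar>real_of_int k\<bar> powr 0.01" by (intro ge_one_powr_ge_zero) auto
      then have "real_of_int (hi - lo) \<le> 3 * (max 1 \<bar>real_of_int k\<bar> powr 0.01)"
        using False L(5) by linarith
      then have d: "real_of_int (hi - lo) \<le> 6 * \<kappa> * g powr (1 - \<beta>)" using m by linarith
      have "\<bar>h hi - h lo\<bar> \<le> K * real_of_int (hi - lo)"
        using lips[of lo "nat (hi - lo)"] lohi by simp
      also have "\<dots> \<le> K * (6 * \<kappa> * g powr (1 - \<beta>))" by (intro mult_left_mono d K)
      also have "\<dots> = (6 * K * \<kappa>) * g powr (1 - \<beta>)" by simp
      also have "\<dots> \<le> C * g powr (1 - \<beta>)"
        using K \<kappa> C0 by (intro mult_right_mono) (auto simp: C_def)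
      finally show ?thesis .
    qed
    have "\<bar>h u - h v\<bar> = \<bar>h hi - h lo\<bar>" "real_of_int (hi - lo) = \<bar>real_of_int (u - v)\<bar>"
      by (auto simp: hi_def lo_def min_def max_def)
    then show "\<bar>h u - h v\<bar> \<le> C * (\<bar>real_of_int (u - v)\<bar> + real N powr ((1 - \<beta>) / 2)) powr (1 - \<beta>)"
      using goal by (simp add: g_def \<sigma>_def)
  qed
qed

section \<open>Expectations along the walk\<close>

text \<open>If u lies between 2^J and 2^(J + 1), the left side is at most (1/4)^J, which the last
  summand alone provides. Bounds on the probabilities of balls thereby become bounds on expected
  weights.\<close>

lemma dyadic_square_bound:
  fixes u :: real
  assumes "0 \<le> u" "u \<le> 2 ^ J"
  shows "1 / (1 + u)\<^sup>2 \<le> 4 * (\<Sum>j\<le>J. (1/4) ^ j * of_bool (u \<le> 2 ^ j))"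
  using assms
proof (induction J)
  case 0
  have "1 / (1 + u)\<^sup>2 \<le> 1" using 0 by (simp add: one_le_power)
  then show ?case using 0 by (simp add: order_trans[of _ 1 4])
next
  case (Suc J)
  have nn: "0 \<le> (\<Sum>j\<le>J. (1/4) ^ j * of_bool (u \<le> 2 ^ j) :: real)" by (intro sum_nonneg) auto
  show ?case
  proof (cases "u \<le> 2 ^ J")
    case True
    then show ?thesis using Suc.IH[OF Suc.prems(1) True] by (simp add: add_increasing2)
  next
    case False
    have "(2 ^ J)\<^sup>2 \<le> (1 + u)\<^sup>2" using False Suc.prems by (intro power_mono) auto
    then have "1 / (1 + u)\<^sup>2 \<le> 1 / (2 ^ J)\<^sup>2" using Suc.prems by (intro divide_left_mono) auto
    also have "\<dots> = (1/4) ^ J" by (simp add: power_one_over power2_eq_square flip: power_mult_distrib)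
    finally show ?thesis using nn Suc.prems by simp
  qed
qed

locale strip_walk =
  fixes P Q R :: "int \<Rightarrow> real^'m^'m" and i0 :: 'm
  assumes nonneg: "\<And>n i j. P n $ i $ j \<ge> 0 \<and> Q n $ i $ j \<ge> 0 \<and> R n $ i $ j \<ge> 0"
    and rowsum: "\<And>n i. (\<Sum>j\<in>UNIV. P n $ i $ j + Q n $ i $ j + R n $ i $ j) = 1"
begin

text \<open>The Markov operator: expectation of h at the next position, given the present position
  (n, i).\<close>

definition T :: "(int \<Rightarrow> 'm \<Rightarrow> real) \<Rightarrow> int \<Rightarrow> 'm \<Rightarrow> real" where
  "T h n i = (\<Sum>j\<in>UNIV. P n $ i $ j * h (n + 1) j + Q n $ i $ j * h (n - 1) j + R n $ i $ j * h n j)"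

text \<open>Expectation of h at time t. The walk is confined to |n| <= t at that time, so a finite
  sum captures it for every h.\<close>

definition Ex :: "nat \<Rightarrow> (int \<Rightarrow> 'm \<Rightarrow> real) \<Rightarrow> real" where
  "Ex t h = (\<Sum>n\<in>{- int t..int t}. \<Sum>i\<in>UNIV. walk_dist P Q R i0 t n i * h n i)"

lemma P_nonneg: "0 \<le> P n $ i $ j" and Q_nonneg: "0 \<le> Q n $ i $ j" and R_nonneg: "0 \<le> R n $ i $ j"
  using nonneg by auto

lemma walk_dist_nonneg: "0 \<le> walk_dist P Q R i0 t n j"
  by (induction t arbitrary: n j)
     (auto intro!: sum_nonneg add_nonneg_nonneg mult_nonneg_nonneg P_nonneg Q_nonneg R_nonneg)

lemma walk_dist_support: "\<bar>n\<bar> > int t \<Longrightarrow> walk_dist P Q R i0 t n j = 0"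
proof (induction t arbitrary: n j)
  case (Suc t)
  have "\<bar>n - 1\<bar> > int t" "\<bar>n\<bar> > int t" "\<bar>n + 1\<bar> > int t" using Suc.prems by auto
  then show ?case using Suc.IH by simp
qed simp

lemma shifted_sum:
  fixes F :: "int \<Rightarrow> real"
  assumes "\<And>n. \<bar>n\<bar> > int t \<Longrightarrow> F n = 0" "\<bar>c\<bar> \<le> 1"
  shows "(\<Sum>n\<in>{- int (Suc t)..int (Suc t)}. F (n + c)) = (\<Sum>n\<in>{- int t..int t}. F n)"
proof -
  have "(\<Sum>n\<in>{- int (Suc t)..int (Suc t)}. F (n + c)) = (\<Sum>n\<in>{- int (Suc t) + c..int (Suc t) + c}. F n)"
    by (rule sum.reindex_bij_witness[of _ "\<lambda>n. n - c" "\<lambda>n. n + c"]) auto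
  also have "\<dots> = (\<Sum>n\<in>{- int t..int t}. F n)"
    by (rule sum.mono_neutral_right) (use assms in auto)
  finally show ?thesis .
qed

text \<open>Duality between the forward evolution of \<open>walk_dist\<close> and the backward
  operator \<open>T\<close>: each of the three kinds of jump is reindexed by its starting layer, and
  the confinement to |n| <= t makes the shifted ranges agree.\<close>

lemma Ex_Suc: "Ex (Suc t) h = Ex t (T h)"
proof -
  let ?w = "walk_dist P Q R i0 t"
  let ?B = "{- int (Suc t)..int (Suc t)}"
  define FP where "FP = (\<lambda>n. \<Sum>i\<in>UNIV. \<Sum>j\<in>UNIV. ?w n i * P n $ i $ j * h (n + 1) j)"
  define FR where "FR = (\<lambda>n. \<Sum>i\<in>UNIV. \<Sum>j\<in>UNIV. ?w n i * R n $ i $ j * h n j)"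
  define FQ where "FQ = (\<lambda>n. \<Sum>i\<in>UNIV. \<Sum>j\<in>UNIV. ?w n i * Q n $ i $ j * h (n - 1) j)"
  have z: "FP n = 0" "FR n = 0" "FQ n = 0" if "\<bar>n\<bar> > int t" for n
    using that by (simp_all add: FP_def FR_def FQ_def walk_dist_support)
  have "Ex (Suc t) h = (\<Sum>n\<in>?B. \<Sum>j\<in>UNIV. \<Sum>i\<in>UNIV. ?w (n - 1) i * P (n - 1) $ i $ j * h n j
      + ?w n i * R n $ i $ j * h n j + ?w (n + 1) i * Q (n + 1) $ i $ j * h n j)"
    unfolding Ex_def by (simp only: walk_dist.simps sum_distrib_right distrib_right)
  also have "\<dots> = (\<Sum>n\<in>?B. FP (n + - 1) + FR (n + 0) + FQ (n + 1))"
  proof (rule sum.cong[OF refl])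
    fix n
    show "(\<Sum>j\<in>UNIV. \<Sum>i\<in>UNIV. ?w (n - 1) i * P (n - 1) $ i $ j * h n j
      + ?w n i * R n $ i $ j * h n j + ?w (n + 1) i * Q (n + 1) $ i $ j * h n j) = FP (n + - 1) + FR (n + 0) + FQ (n + 1)"
      unfolding FP_def FR_def FQ_def by (subst sum.swap) (simp add: sum.distrib)
  qed
  also have "\<dots> = (\<Sum>n\<in>{- int t..int t}. FP n) + (\<Sum>n\<in>{- int t..int t}. FR n) + (\<Sum>n\<in>{- int t..int t}. FQ n)"
    unfolding sum.distrib
    by (intro arg_cong2[of _ _ _ _ "(+)"] shifted_sum z) simp_all
  also have "\<dots> = Ex t (T h)"
    unfolding Ex_def T_def FP_def FR_def FQ_def sum.distrib[symmetric] sum_distrib_left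
    by (intro sum.cong refl) (simp add: algebra_simps)
  finally show ?thesis .
qed

lemma Ex_0: "Ex 0 h = h 0 i0"
proof -
  have "Ex 0 h = (\<Sum>i\<in>UNIV. if i = i0 then h 0 i else 0)"
    unfolding Ex_def by (simp add: if_distrib[of "\<lambda>x. x * _"] cong: if_cong)
  then show ?thesis by simp
qed

lemma T_const: "T (\<lambda>n i. c) n i = c"
proof -
  have "T (\<lambda>n i. c) n i = (\<Sum>j\<in>UNIV. P n $ i $ j + Q n $ i $ j + R n $ i $ j) * c"
    unfolding T_def sum_distrib_right by (simp add: algebra_simps)
  then show ?thesis using rowsum by simp
qed

lemma Ex_const: "Ex t (\<lambda>n i. c) = c"
proof (induction t)
  case (Suc t)
  then show ?case by (simp add: Ex_Suc T_const[abs_def])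
qed (simp add: Ex_0)

lemma Ex_add: "Ex t (\<lambda>n i. h n i + g n i) = Ex t h + Ex t g"
  by (simp add: Ex_def distrib_left sum.distrib)

lemma Ex_diff: "Ex t (\<lambda>n i. h n i - g n i) = Ex t h - Ex t g"
  by (simp add: Ex_def right_diff_distrib sum_subtractf)

lemma Ex_cmult: "Ex t (\<lambda>n i. c * h n i) = c * Ex t h"
  by (simp add: Ex_def sum_distrib_left mult.left_commute)

lemma Ex_sum: "Ex t (\<lambda>n i. \<Sum>k\<in>A. h k n i) = (\<Sum>k\<in>A. Ex t (h k))"
  by (induction A rule: infinite_finite_induct) (simp_all add: Ex_add Ex_const)

lemma Ex_mono: "(\<And>n i. \<bar>n\<bar> \<le> int t \<Longrightarrow> h n i \<le> g n i) \<Longrightarrow> Ex t h \<le> Ex t g"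
  unfolding Ex_def by (intro sum_mono mult_left_mono walk_dist_nonneg) auto

lemma Ex_abs_le: "(\<And>n i. \<bar>n\<bar> \<le> int t \<Longrightarrow> \<bar>h n i\<bar> \<le> g n i) \<Longrightarrow> \<bar>Ex t h\<bar> \<le> Ex t g"
proof -
  assume le: "\<And>n i. \<bar>n\<bar> \<le> int t \<Longrightarrow> \<bar>h n i\<bar> \<le> g n i"
  have "Ex t h \<le> Ex t g" by (rule Ex_mono) (use le in \<open>auto simp: abs_le_iff\<close>)
  moreover have "Ex t (\<lambda>n i. (- 1) * h n i) \<le> Ex t g" by (rule Ex_mono) (use le in \<open>auto simp: abs_le_iff\<close>)
  ultimately show ?thesis unfolding Ex_cmult by simp
qed

lemma T_diff: "T (\<lambda>n i. h n i - g n i) n i = T h n i - T g n i"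
  by (simp add: T_def algebra_simps sum.distrib sum_subtractf)

lemma T_abs_le:
  assumes "\<And>n' j. \<bar>n' - n\<bar> \<le> 1 \<Longrightarrow> \<bar>h n' j\<bar> \<le> e"
  shows "\<bar>T h n i\<bar> \<le> e"
proof -
  have "\<bar>T h n i\<bar> \<le> (\<Sum>j\<in>UNIV. (P n $ i $ j + Q n $ i $ j + R n $ i $ j) * e)"
    unfolding T_def
  proof (rule order_trans[OF sum_abs sum_mono])
    fix j
    have "\<bar>P n $ i $ j * h (n + 1) j + Q n $ i $ j * h (n - 1) j + R n $ i $ j * h n j\<bar>
      \<le> P n $ i $ j * \<bar>h (n + 1) j\<bar> + Q n $ i $ j * \<bar>h (n - 1) j\<bar> + R n $ i $ j * \<bar>h n j\<bar>"
      using P_nonneg[of n i j] Q_nonneg[of n i j] R_nonneg[of n i j]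
      by (intro order_trans[OF abs_triangle_ineq] add_mono) (simp_all add: abs_mult order_trans[OF abs_triangle_ineq])
    also have "\<dots> \<le> P n $ i $ j * e + Q n $ i $ j * e + R n $ i $ j * e"
      by (intro add_mono mult_left_mono assms P_nonneg Q_nonneg R_nonneg) auto
    finally show "\<bar>P n $ i $ j * h (n + 1) j + Q n $ i $ j * h (n - 1) j + R n $ i $ j * h n j\<bar>
        \<le> (P n $ i $ j + Q n $ i $ j + R n $ i $ j) * e" by (simp add: algebra_simps)
  qed
  also have "\<dots> = e" by (simp add: rowsum flip: sum_distrib_right)
  finally show ?thesis .
qed

text \<open>Discrete Dynkin formula for a time dependent function: the defect of \<open>u\<close>
  from solving the backward equation, summed over time, is the whole error.\<close>

lemma Ex_telescope: "Ex N (u N) - u 0 0 i0 = (\<Sum>t<N. Ex t (\<lambda>n i. T (u (Suc t)) n i - u t n i))"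
proof (induction N)
  case (Suc N)
  then show ?case by (simp add: Ex_Suc Ex_diff[of N "T (u (Suc N))"])
qed (simp add: Ex_0)

lemma walk_cdf_eq: "walk_cdf P Q R i0 N y = Ex N (\<lambda>n i. of_bool (real_of_int n \<le> y))"
proof -
  have "walk_cdf P Q R i0 N y = (\<Sum>n\<in>{- int N..int N}. if real_of_int n \<le> y then \<Sum>j\<in>UNIV. walk_dist P Q R i0 N n j else 0)"
    unfolding walk_cdf_def by (subst sum.inter_filter) auto
  then show ?thesis unfolding Ex_def by (auto intro!: sum.cong)
qed

text \<open>The Gaussian order r / sqrt t, up to a resolution t^-gamma that does not shrink with the
  ball. The exponent gamma is the quantity improved by iteration; uniformity in k is essential,
  since k will be the threshold y.\<close>

definition anticonc :: "real \<Rightarrow> real \<Rightarrow> bool" where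
  "anticonc C \<gamma> \<longleftrightarrow> (\<forall>t\<ge>1. \<forall>k. \<forall>r\<ge>0.
     Ex t (\<lambda>n i. of_bool (\<bar>real_of_int (n - k)\<bar> \<le> r)) \<le> C * (r / sqrt (real t) + real t powr - \<gamma>))"

text \<open>Over dyadic balls the weights (1/4)^j beat the radii 2^j s, leaving a geometric series
  with sum at most 2. For fixed t and k finitely many balls cover the range of the walk.\<close>

lemma anticonc_weight:
  assumes ac: "anticonc C \<gamma>" and C: "C \<ge> 0" and t: "t \<ge> 1" and s: "s > 0"
  shows "Ex t (\<lambda>n i. 1 / (1 + \<bar>real_of_int (n - k)\<bar> / s)\<^sup>2) \<le> 8 * C * (s / sqrt (real t) + real t powr - \<gamma>)"
proof -
  obtain J where J: "(real t + \<bar>real_of_int k\<bar>) / s < 2 ^ J"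
    using real_arch_pow[of 2] by auto
  have "Ex t (\<lambda>n i. 1 / (1 + \<bar>real_of_int (n - k)\<bar> / s)\<^sup>2)
      \<le> Ex t (\<lambda>n i. \<Sum>j\<le>J. (4 * (1/4) ^ j) * of_bool (\<bar>real_of_int (n - k)\<bar> \<le> 2 ^ j * s))"
  proof (rule Ex_mono)
    fix n i assume n: "\<bar>n\<bar> \<le> int t"
    have "\<bar>real_of_int (n - k)\<bar> \<le> real t + \<bar>real_of_int k\<bar>" using n by linarith
    then have "\<bar>real_of_int (n - k)\<bar> / s \<le> (real t + \<bar>real_of_int k\<bar>) / s"
      using s by (intro divide_right_mono) auto
    then have le: "\<bar>real_of_int (n - k)\<bar> / s \<le> 2 ^ J" using J by linarith
    have nn: "0 \<le> \<bar>real_of_int (n - k)\<bar> / s" using s by simp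
    have iff: "\<bar>real_of_int (n - k)\<bar> / s \<le> 2 ^ j \<longleftrightarrow> \<bar>real_of_int (n - k)\<bar> \<le> 2 ^ j * s" for j :: nat
      using s by (simp add: divide_le_eq)
    show "1 / (1 + \<bar>real_of_int (n - k)\<bar> / s)\<^sup>2
        \<le> (\<Sum>j\<le>J. (4 * (1/4) ^ j) * of_bool (\<bar>real_of_int (n - k)\<bar> \<le> 2 ^ j * s))"
      using dyadic_square_bound[OF nn le] unfolding iff sum_distrib_left by (simp add: mult.assoc)
  qed
  also have "\<dots> = (\<Sum>j\<le>J. (4 * (1/4) ^ j) * Ex t (\<lambda>n i. of_bool (\<bar>real_of_int (n - k)\<bar> \<le> 2 ^ j * s)))"
    unfolding Ex_sum Ex_cmult ..
  also have "\<dots> \<le> (\<Sum>j\<le>J. (4 * (1/4) ^ j) * (C * (2 ^ j * s / sqrt (real t) + real t powr - \<gamma>)))"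
    using ac t s unfolding anticonc_def by (intro sum_mono mult_left_mono) auto
  also have "\<dots> \<le> (\<Sum>j\<le>J. 4 * C * (s / sqrt (real t) + real t powr - \<gamma>) * (1/2) ^ j)"
  proof (rule sum_mono)
    fix j :: nat
    have e: "(1/4 :: real) ^ j * 2 ^ j = (1/2) ^ j" by (simp flip: power_mult_distrib)
    have "(1/4 :: real) ^ j \<le> (1/2) ^ j" by (intro power_mono) auto
    then have "(1/4) ^ j * real t powr - \<gamma> \<le> (1/2) ^ j * real t powr - \<gamma>" by (intro mult_right_mono) auto
    moreover have "(1/4) ^ j * (2 ^ j * s / sqrt (real t)) = (1/2) ^ j * (s / sqrt (real t))"
      by (metis e mult.assoc times_divide_eq_right)
    ultimately have "(1/4) ^ j * (2 ^ j * s / sqrt (real t) + real t powr - \<gamma>) \<le> (1/2) ^ j * (s / sqrt (real t) + real t powr - \<gamma>)"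
      unfolding distrib_left by linarith
    then have "(4 * C) * ((1/4) ^ j * (2 ^ j * s / sqrt (real t) + real t powr - \<gamma>))
        \<le> (4 * C) * ((1/2) ^ j * (s / sqrt (real t) + real t powr - \<gamma>))"
      using C by (intro mult_left_mono) auto
    then show "(4 * (1/4) ^ j) * (C * (2 ^ j * s / sqrt (real t) + real t powr - \<gamma>))
        \<le> 4 * C * (s / sqrt (real t) + real t powr - \<gamma>) * (1/2) ^ j" by (simp only: mult_ac)
  qed
  also have "\<dots> = 4 * C * (s / sqrt (real t) + real t powr - \<gamma>) * (\<Sum>j\<le>J. (1/2) ^ j)"
    by (simp add: sum_distrib_left)
  also have "\<dots> \<le> 4 * C * (s / sqrt (real t) + real t powr - \<gamma>) * 2"
  proof (rule mult_left_mono)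
    have "(\<Sum>j\<le>J. (1/2 :: real) ^ j) = 2 - (1/2) ^ J"
      by (induction J) (simp_all add: field_simps)
    then show "(\<Sum>j\<le>J. (1/2 :: real) ^ j) \<le> 2" by simp
    show "0 \<le> 4 * C * (s / sqrt (real t) + real t powr - \<gamma>)" using C s by (intro mult_nonneg_nonneg add_nonneg_nonneg) auto
  qed
  finally show ?thesis by simp
qed

lemma anticonc_0: "anticonc 1 0"
  unfolding anticonc_def
proof (intro allI impI)
  fix t :: nat and k :: int and r :: real assume "1 \<le> t" "0 \<le> r"
  have "Ex t (\<lambda>n i. of_bool (\<bar>real_of_int (n - k)\<bar> \<le> r)) \<le> Ex t (\<lambda>n i. 1)"
    by (rule Ex_mono) simp
  then show "Ex t (\<lambda>n i. of_bool (\<bar>real_of_int (n - k)\<bar> \<le> r)) \<le> 1 * (r / sqrt (real t) + real t powr - 0)"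
    using \<open>0 \<le> r\<close> \<open>1 \<le> t\<close> by (simp add: Ex_const add_increasing)
qed

end

section \<open>Comparison with the heat flow\<close>

text \<open>Interface between the probabilistic comparison and the analysis of the environment: the
  last two assumptions are the form in which the averaging hypotheses are used. The function G may
  depend on N and y, its constant only on \<open>\<kappa>\<close>; that factor admits thresholds
  somewhat outside the range of the walk.\<close>

locale strip_clt = strip_walk P Q R i0 for P Q R :: "int \<Rightarrow> real^'m^'m" and i0 :: 'm +
  fixes mm q :: "int \<Rightarrow> 'm \<Rightarrow> real" and i1 :: 'm and D \<beta> K :: real
  assumes D: "D > 0" and \<beta>: "0 < \<beta>" "\<beta> \<le> 1/4"
    and mm_harmonic: "\<And>n i. T mm n i = mm n i"
    and mm_lip: "\<And>n n' i j. \<bar>n - n'\<bar> \<le> 1 \<Longrightarrow> \<bar>mm n i - mm n' j\<bar> \<le> K"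
    and q_eq: "\<And>n i. T (\<lambda>n' j. (mm n' j - mm n i)\<^sup>2) n i = q n i"
    and mm_linear: "\<And>\<kappa>. \<kappa> \<ge> 1 \<Longrightarrow> \<exists>C\<ge>1. \<forall>N\<ge>1. \<forall>u v. \<bar>real_of_int v\<bar> \<le> \<kappa> * real N \<longrightarrow>
        \<bar>mm u i1 - mm v i1 - real_of_int (u - v)\<bar> \<le> C * (\<bar>real_of_int (u - v)\<bar> + real N powr ((1 - \<beta>) / 2)) powr (1 - \<beta>)"
    and corrector: "\<And>\<kappa>. \<kappa> \<ge> 1 \<Longrightarrow> \<exists>C\<ge>1. \<forall>N\<ge>1. \<forall>y. \<bar>real_of_int y\<bar> \<le> \<kappa> * real N \<longrightarrow>
        (\<exists>G. (\<forall>n i. \<bar>n\<bar> \<le> int N \<longrightarrow> T G n i = G n i + (q n i - D))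
           \<and> (\<forall>n i. \<bar>n\<bar> \<le> int N \<longrightarrow> \<bar>G n i\<bar> \<le> C * (\<bar>real_of_int (n - y)\<bar> + real N powr ((1 - \<beta>) / 2)) powr (2 - \<beta>))
           \<and> (\<forall>n n' i j. \<bar>n\<bar> \<le> int N \<longrightarrow> \<bar>n' - n\<bar> \<le> 1 \<longrightarrow>
                \<bar>G n' j - G n i\<bar> \<le> C * (\<bar>real_of_int (n - y)\<bar> + real N powr ((1 - \<beta>) / 2)) powr (1 - \<beta>)))"
begin

definition sg :: "nat \<Rightarrow> real" where "sg N = real N powr ((1 - \<beta>) / 2)"

lemma sg_ge_1: "N \<ge> 1 \<Longrightarrow> sg N \<ge> 1"
  using \<beta> by (simp add: sg_def ge_one_powr_ge_zero)

lemma K_nonneg: "K \<ge> 0"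
  using mm_lip[of 0 0 i1 i1] by simp

text \<open>A sublinear error is at most half the distance plus O(sigma). Distances measured by
  \<open>mm\<close> and by sites are then comparable beyond the smoothing scale, which is all that
  weights need.\<close>

lemma coarse:
  assumes "\<kappa> \<ge> 1"
  shows "\<exists>C\<ge>1. \<forall>N\<ge>1. \<forall>u v i. \<bar>real_of_int v\<bar> \<le> \<kappa> * real N \<longrightarrow>
    \<bar>mm u i - mm v i1 - real_of_int (u - v)\<bar> \<le> \<bar>real_of_int (u - v)\<bar> / 2 + C * sg N"
proof -
  obtain C where C: "C \<ge> 1" "\<forall>N\<ge>1. \<forall>u v. \<bar>real_of_int v\<bar> \<le> \<kappa> * real N \<longrightarrow>
        \<bar>mm u i1 - mm v i1 - real_of_int (u - v)\<bar> \<le> C * (\<bar>real_of_int (u - v)\<bar> + sg N) powr (1 - \<beta>)"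
    using mm_linear[OF assms] unfolding sg_def by blast
  obtain C' where C': "C' \<ge> 0" "\<forall>v\<ge>0. C * v powr (1 - \<beta>) \<le> v / 2 + C'"
    using sublinear_le[of C \<beta>] C(1) \<beta> by auto
  show ?thesis
  proof (intro exI[of _ "1 + C' + K"] conjI allI impI)
    fix N u v i assume N: "1 \<le> N" and v: "\<bar>real_of_int v\<bar> \<le> \<kappa> * real N"
    have s: "sg N \<ge> 1" by (rule sg_ge_1[OF N])
    have "\<bar>mm u i1 - mm v i1 - real_of_int (u - v)\<bar> \<le> C * (\<bar>real_of_int (u - v)\<bar> + sg N) powr (1 - \<beta>)"
      using C N v by blast
    also have "\<dots> \<le> (\<bar>real_of_int (u - v)\<bar> + sg N) / 2 + C'" using C'(2) s by simp
    finally have "\<bar>mm u i - mm v i1 - real_of_int (u - v)\<bar> \<le> (\<bar>real_of_int (u - v)\<bar> + sg N) / 2 + C' + K"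
      using mm_lip[of u u i i1] by linarith
    moreover have "C' \<le> C' * sg N" "K \<le> K * sg N"
      using mult_left_mono[OF s C'(1)] mult_left_mono[OF s K_nonneg] by auto
    ultimately show "\<bar>mm u i - mm v i1 - real_of_int (u - v)\<bar> \<le> \<bar>real_of_int (u - v)\<bar> / 2 + (1 + C' + K) * sg N"
      using s by (simp add: algebra_simps add_divide_distrib)
  qed (use C'(1) K_nonneg in simp)
qed

text \<open>Derivative bounds rewritten with the site distance |n - y| in place of the distance of
  martingale values. The slack in \<open>\<xi>\<close> accommodates intermediate points of a Taylor
  expansion over one jump, and the slack in \<open>\<tau>\<close> those over one unit of
  time.\<close>

lemma heat_weight_bounds:
  assumes "\<kappa> \<ge> 1"
  shows "\<exists>C\<ge>1. \<forall>N y n i s \<xi> \<tau>. N \<ge> 1 \<longrightarrow> \<bar>real_of_int y\<bar> \<le> \<kappa> * real N \<longrightarrow> s \<ge> sg N \<longrightarrow> \<bar>\<xi> - mm n i\<bar> \<le> K \<longrightarrow>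
     s\<^sup>2 / 2 \<le> \<tau> \<longrightarrow> \<tau> \<le> s\<^sup>2 \<longrightarrow>
     \<bar>heat2 (mm y i1) (sqrt (D * \<tau>)) \<xi>\<bar> \<le> C / (s\<^sup>2 * (1 + \<bar>real_of_int (n - y)\<bar> / s) ^ 4) \<and>
     \<bar>heat3 (mm y i1) (sqrt (D * \<tau>)) \<xi>\<bar> \<le> C / (s ^ 3 * (1 + \<bar>real_of_int (n - y)\<bar> / s) ^ 4) \<and>
     \<bar>heat4 (mm y i1) (sqrt (D * \<tau>)) \<xi>\<bar> \<le> C / (s ^ 4 * (1 + \<bar>real_of_int (n - y)\<bar> / s) ^ 4)"
proof -
  obtain C0 where C0: "C0 \<ge> 1" "\<forall>Y w x. w > 0 \<longrightarrow> \<bar>heat2 Y w x\<bar> \<le> C0 / (w\<^sup>2 * (1 + \<bar>Y - x\<bar> / w) ^ 4) \<and>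
     \<bar>heat3 Y w x\<bar> \<le> C0 / (w ^ 3 * (1 + \<bar>Y - x\<bar> / w) ^ 4) \<and>
     \<bar>heat4 Y w x\<bar> \<le> C0 / (w ^ 4 * (1 + \<bar>Y - x\<bar> / w) ^ 4)"
    using heat_bounds by blast
  obtain C1 where C1: "C1 \<ge> 1" "\<forall>N\<ge>1. \<forall>u v i. \<bar>real_of_int v\<bar> \<le> \<kappa> * real N \<longrightarrow>
    \<bar>mm u i - mm v i1 - real_of_int (u - v)\<bar> \<le> \<bar>real_of_int (u - v)\<bar> / 2 + C1 * sg N"
    using coarse[OF assms] by blast
  \<comment> \<open>Used for c s <= w <= sqrt D s, where w = sqrt (D tau); as c <= 1, the constant
    \<open>c ^ 4\<close> serves for every power up to 4.\<close>
  define c where "c = min 1 (sqrt (D / 2))"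
  define C2 where "C2 = 1 + 2 * K + 2 * C1 + 2 * sqrt D"
  have c: "0 < c" "c \<le> 1" "c \<le> sqrt (D / 2)" using D by (auto simp: c_def)
  have C2: "C2 \<ge> 1" using K_nonneg C1(1) D by (simp add: C2_def)
  define C where "C = C0 * C2 ^ 4 / c ^ 4"
  have "1 \<le> C0 * C2 ^ 4" using C0(1) C2 mult_mono[of 1 C0 1 "C2 ^ 4"] by simp
  moreover have "c ^ 4 \<le> 1" using c by (simp add: power_le_one)
  ultimately have "c ^ 4 \<le> C0 * C2 ^ 4" by linarith
  then have "C \<ge> 1" using c by (simp add: C_def le_divide_eq)
  show ?thesis
  proof (intro exI[of _ C] conjI[OF \<open>C \<ge> 1\<close>] conjI allI impI)
    fix N :: nat and y n :: int and i :: 'm and s \<xi> \<tau> :: real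
    assume N: "1 \<le> N" and y: "\<bar>real_of_int y\<bar> \<le> \<kappa> * real N" and s: "sg N \<le> s" and xi: "\<bar>\<xi> - mm n i\<bar> \<le> K"
      and tau: "s\<^sup>2 / 2 \<le> \<tau>" "\<tau> \<le> s\<^sup>2"
    have s1: "s \<ge> 1" using s sg_ge_1[OF N] by linarith
    define w where "w = sqrt (D * \<tau>)"
    define \<rho> where "\<rho> = 1 + \<bar>real_of_int (n - y)\<bar> / s"
    have \<rho>: "\<rho> \<ge> 1" using s1 by (simp add: \<rho>_def)
    have wl: "c * s \<le> w"
    proof -
      have "sqrt (D / 2) * s = sqrt (D * (s\<^sup>2 / 2))" using s1 by (simp add: real_sqrt_mult real_sqrt_divide)
      also have "\<dots> \<le> w" unfolding w_def using tau D by (intro real_sqrt_le_mono mult_left_mono) auto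
      finally show ?thesis using mult_right_mono[OF c(3), of s] s1 by linarith
    qed
    have wu: "w \<le> sqrt D * s"
    proof -
      have "w \<le> sqrt (D * s\<^sup>2)" unfolding w_def using tau D by (intro real_sqrt_le_mono mult_left_mono) auto
      then show ?thesis using s1 by (simp add: real_sqrt_mult)
    qed
    have w: "w > 0" using wl c(1) s1 mult_pos_pos[of c s] by linarith
    define Y where "Y = mm y i1"
    have \<rho>le: "\<rho> \<le> C2 * (1 + \<bar>Y - \<xi>\<bar> / w)"
    proof -
      have h1: "\<bar>mm n i - Y - real_of_int (n - y)\<bar> \<le> \<bar>real_of_int (n - y)\<bar> / 2 + C1 * sg N"
        unfolding Y_def using C1(2) N y by blast
      have h2: "C1 * sg N \<le> C1 * s" using s C1(1) by (intro mult_left_mono) auto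
      have h3: "K \<le> K * s" using mult_left_mono[OF s1 K_nonneg] by simp
      have "\<bar>real_of_int (n - y)\<bar> \<le> 2 * \<bar>Y - \<xi>\<bar> + (2 * K + 2 * C1) * s"
      proof -
        define d where "d = real_of_int (n - y)"
        have "\<bar>mm n i - Y - d\<bar> \<le> \<bar>d\<bar> / 2 + C1 * s" unfolding d_def using h1 h2 by linarith
        moreover have "\<bar>d\<bar> \<le> \<bar>Y - \<xi>\<bar> + \<bar>\<xi> - mm n i\<bar> + \<bar>mm n i - Y - d\<bar>" by linarith
        moreover have "\<bar>\<xi> - mm n i\<bar> \<le> K * s" using xi h3 by (rule order_trans)
        ultimately have "\<bar>d\<bar> \<le> \<bar>Y - \<xi>\<bar> + K * s + (\<bar>d\<bar> / 2 + C1 * s)"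
          by (meson add_mono order_refl order_trans)
        then show ?thesis by (simp add: d_def algebra_simps)
      qed
      then have "\<bar>real_of_int (n - y)\<bar> / s \<le> (2 * \<bar>Y - \<xi>\<bar> + (2 * K + 2 * C1) * s) / s"
        using s1 by (intro divide_right_mono) auto
      also have "\<dots> = 2 * (\<bar>Y - \<xi>\<bar> / s) + (2 * K + 2 * C1)" using s1 by (simp add: field_simps)
      also have "\<bar>Y - \<xi>\<bar> / s \<le> sqrt D * (\<bar>Y - \<xi>\<bar> / w)"
        using mult_right_mono[OF wu, of "\<bar>Y - \<xi>\<bar>"] w s1 by (simp add: field_simps)
      finally have "\<rho> \<le> 1 + (2 * (sqrt D * (\<bar>Y - \<xi>\<bar> / w)) + (2 * K + 2 * C1))" by (simp add: \<rho>_def)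
      also have "\<dots> \<le> C2 * (1 + \<bar>Y - \<xi>\<bar> / w)"
      proof -
        have "0 \<le> (1 + 2 * K + 2 * C1) * (\<bar>Y - \<xi>\<bar> / w)"
          using w K_nonneg C1(1) by (intro mult_nonneg_nonneg) auto
        then show ?thesis using D by (simp add: C2_def algebra_simps)
      qed
      finally show ?thesis .
    qed
    have gen: "C0 / (w ^ k * (1 + \<bar>Y - \<xi>\<bar> / w) ^ 4) \<le> C / (s ^ k * \<rho> ^ 4)" if k: "k \<le> 4" for k
    proof -
      have "c ^ 4 * s ^ k \<le> c ^ k * s ^ k" using c k s1 by (intro mult_right_mono power_decreasing) auto
      also have "\<dots> \<le> w ^ k" using power_mono[OF wl, of k] c s1 by (simp add: power_mult_distrib)
      finally have 1: "c ^ 4 * s ^ k \<le> w ^ k" .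
      have 2: "\<rho> ^ 4 \<le> C2 ^ 4 * (1 + \<bar>Y - \<xi>\<bar> / w) ^ 4"
        using power_mono[OF \<rho>le, of 4] \<rho> by (simp add: power_mult_distrib)
      have "(c ^ 4 * s ^ k) * \<rho> ^ 4 \<le> w ^ k * (C2 ^ 4 * (1 + \<bar>Y - \<xi>\<bar> / w) ^ 4)"
        using 1 2 w \<rho> by (intro mult_mono) auto
      then have "C0 * ((c ^ 4 * s ^ k) * \<rho> ^ 4) \<le> C0 * (w ^ k * (C2 ^ 4 * (1 + \<bar>Y - \<xi>\<bar> / w) ^ 4))"
        using C0 by (intro mult_left_mono) auto
      then show ?thesis using c s1 \<rho> w by (simp add: C_def divide_simps add_pos_nonneg) (simp add: mult_ac)
    qed
    have "\<bar>heat2 Y w \<xi>\<bar> \<le> C0 / (w\<^sup>2 * (1 + \<bar>Y - \<xi>\<bar> / w) ^ 4)"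
      "\<bar>heat3 Y w \<xi>\<bar> \<le> C0 / (w ^ 3 * (1 + \<bar>Y - \<xi>\<bar> / w) ^ 4)"
      "\<bar>heat4 Y w \<xi>\<bar> \<le> C0 / (w ^ 4 * (1 + \<bar>Y - \<xi>\<bar> / w) ^ 4)"
      using C0(2) w by blast+
    then show "\<bar>heat2 (mm y i1) (sqrt (D * \<tau>)) \<xi>\<bar> \<le> C / (s\<^sup>2 * (1 + \<bar>real_of_int (n - y)\<bar> / s) ^ 4)"
      "\<bar>heat3 (mm y i1) (sqrt (D * \<tau>)) \<xi>\<bar> \<le> C / (s ^ 3 * (1 + \<bar>real_of_int (n - y)\<bar> / s) ^ 4)"
      "\<bar>heat4 (mm y i1) (sqrt (D * \<tau>)) \<xi>\<bar> \<le> C / (s ^ 4 * (1 + \<bar>real_of_int (n - y)\<bar> / s) ^ 4)"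
      using gen[of 2] gen[of 3] gen[of 4] unfolding Y_def w_def \<rho>_def by (auto intro: order_trans)
  qed
qed

text \<open>Both terms linear in the increment of \<open>mm\<close> average to 0 because
  \<open>mm\<close> is harmonic; the quadratic term produces \<open>q\<close>. Nothing is assumed of
  \<open>G\<close> here.\<close>

lemma T_quadratic:
  "T (\<lambda>n' j. a0 + a1 * (mm n' j - mm n i) + a2 * (mm n' j - mm n i)\<^sup>2 / 2 - a2 * G n' j / 2
       - a3 * (mm n' j - mm n i) * g / 2) n i = a0 + a2 * q n i / 2 - a2 * T G n i / 2"
proof -
  let ?d = "\<lambda>n' j. mm n' j - mm n i"
  have d: "T ?d n i = 0" using T_diff[of mm "\<lambda>n' j. mm n i" n i] by (simp add: mm_harmonic T_const)
  have "T (\<lambda>n' j. a0 + a1 * ?d n' j + a2 * (?d n' j)\<^sup>2 / 2 - a2 * G n' j / 2 - a3 * ?d n' j * g / 2) n i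
    = T (\<lambda>n' j. a0) n i + (a1 - a3 * g / 2) * T ?d n i + a2 / 2 * T (\<lambda>n' j. (?d n' j)\<^sup>2) n i - a2 / 2 * T G n i"
    unfolding T_def sum_distrib_left sum.distrib[symmetric] sum_subtractf[symmetric]
    by (intro sum.cong refl) (simp add: algebra_simps add_divide_distrib diff_divide_distrib)
  then show ?thesis by (simp add: d T_const q_eq)
qed


text \<open>The extra variance D * (sg N)^2 keeps the profile smooth at scale \<open>sg N\<close>
  even at the final time, where it becomes a mollified indicator of n <= y.\<close>

definition profile :: "int \<Rightarrow> nat \<Rightarrow> nat \<Rightarrow> int \<Rightarrow> 'm \<Rightarrow> real" where
  "profile y N t n i = heat0 (mm y i1) (sqrt (D * (real N - real t + (sg N)\<^sup>2))) (mm n i)"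

definition corrected :: "(int \<Rightarrow> 'm \<Rightarrow> real) \<Rightarrow> int \<Rightarrow> nat \<Rightarrow> nat \<Rightarrow> int \<Rightarrow> 'm \<Rightarrow> real" where
  "corrected G y N t n i = profile y N t n i
     - heat2 (mm y i1) (sqrt (D * (real N - real t + (sg N)\<^sup>2))) (mm n i) * G n i / 2"

definition good_corrector :: "real \<Rightarrow> nat \<Rightarrow> int \<Rightarrow> (int \<Rightarrow> 'm \<Rightarrow> real) \<Rightarrow> bool" where
  "good_corrector C N y G \<longleftrightarrow> (\<forall>n i. \<bar>n\<bar> \<le> int N \<longrightarrow> T G n i = G n i + (q n i - D))
     \<and> (\<forall>n i. \<bar>n\<bar> \<le> int N \<longrightarrow> \<bar>G n i\<bar> \<le> C * (\<bar>real_of_int (n - y)\<bar> + sg N) powr (2 - \<beta>))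
     \<and> (\<forall>n n' i j. \<bar>n\<bar> \<le> int N \<longrightarrow> \<bar>n' - n\<bar> \<le> 1 \<longrightarrow>
          \<bar>G n' j - G n i\<bar> \<le> C * (\<bar>real_of_int (n - y)\<bar> + sg N) powr (1 - \<beta>))"

text \<open>For s >= \<open>sg N\<close>, the quantity d + \<open>sg N\<close> is at most s (1 + d /
  s). Raising the exponent of the second factor to 2 leaves two of the four powers of decay in
  \<open>heat_weight_bounds\<close>.\<close>

lemma weight_powr_le:
  fixes d s e :: real
  assumes "s \<ge> sg N" "N \<ge> 1" "d \<ge> 0" "0 \<le> e" "e \<le> 2"
  shows "(d + sg N) powr e \<le> s powr e * (1 + d / s)\<^sup>2"
proof -
  have s: "s \<ge> 1" "sg N \<ge> 1" using sg_ge_1[OF assms(2)] assms(1) by auto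
  have "(d + sg N) powr e \<le> (s * (1 + d / s)) powr e"
    using s assms by (intro powr_mono2) (auto simp: field_simps)
  also have "\<dots> = s powr e * (1 + d / s) powr e" using s assms by (simp add: powr_mult)
  also have "(1 + d / s) powr e \<le> (1 + d / s) powr 2" using s assms by (intro powr_mono) auto
  also have "(1 + d / s) powr 2 = (1 + d / s)\<^sup>2" using s assms by (subst powr_numeral) auto
  finally show ?thesis by (simp add: mult_left_mono)
qed

text \<open>Order count with s^2 the remaining variance up to D: the k-th derivative is s^-k, G is
  s^(2 - beta), its increments are s^(1 - beta). The mixed errors are exactly of order s^(-2 -
  beta), and the pure Taylor errors s^-3 and s^-4 are smaller because beta < 1.\<close>

lemma corrected_step:
  assumes "\<kappa> \<ge> 1" and Cg: "Cg \<ge> 1"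
  shows "\<exists>C\<ge>0. \<forall>N y G t n i. N \<ge> 1 \<longrightarrow> \<bar>real_of_int y\<bar> \<le> \<kappa> * real N \<longrightarrow> good_corrector Cg N y G \<longrightarrow> t < N \<longrightarrow> \<bar>n\<bar> \<le> int t \<longrightarrow>
    \<bar>T (corrected G y N (Suc t)) n i - corrected G y N t n i\<bar>
      \<le> C * sqrt (real N - real t + (sg N)\<^sup>2) powr (- 2 - \<beta>) / (1 + \<bar>real_of_int (n - y)\<bar> / sqrt (real N - real t + (sg N)\<^sup>2))\<^sup>2"
proof -
  obtain C where C: "C \<ge> 1" "\<forall>N y n i s \<xi> \<tau>. N \<ge> 1 \<longrightarrow> \<bar>real_of_int y\<bar> \<le> \<kappa> * real N \<longrightarrow> s \<ge> sg N \<longrightarrow> \<bar>\<xi> - mm n i\<bar> \<le> K \<longrightarrow>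
     s\<^sup>2 / 2 \<le> \<tau> \<longrightarrow> \<tau> \<le> s\<^sup>2 \<longrightarrow>
     \<bar>heat2 (mm y i1) (sqrt (D * \<tau>)) \<xi>\<bar> \<le> C / (s\<^sup>2 * (1 + \<bar>real_of_int (n - y)\<bar> / s) ^ 4) \<and>
     \<bar>heat3 (mm y i1) (sqrt (D * \<tau>)) \<xi>\<bar> \<le> C / (s ^ 3 * (1 + \<bar>real_of_int (n - y)\<bar> / s) ^ 4) \<and>
     \<bar>heat4 (mm y i1) (sqrt (D * \<tau>)) \<xi>\<bar> \<le> C / (s ^ 4 * (1 + \<bar>real_of_int (n - y)\<bar> / s) ^ 4)"
    using heat_weight_bounds[OF assms(1)] by blast
  define C' where "C' = K ^ 3 * C + K * C * Cg + K\<^sup>2 * C * Cg + D\<^sup>2 * C + D * C * Cg"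
  have C'0: "C' \<ge> 0" unfolding C'_def using K_nonneg C(1) Cg D by (intro add_nonneg_nonneg mult_nonneg_nonneg) auto
  show ?thesis
  proof (intro exI[of _ C'] conjI[OF C'0] allI impI)
    fix N :: nat and y :: int and G :: "int \<Rightarrow> 'm \<Rightarrow> real" and t :: nat and n :: int and i :: 'm
    assume N: "N \<ge> 1" and y: "\<bar>real_of_int y\<bar> \<le> \<kappa> * real N" and G: "good_corrector Cg N y G" and t: "t < N" and n: "\<bar>n\<bar> \<le> int t"
    define \<tau> where "\<tau> = real N - real t + (sg N)\<^sup>2"
    define s where "s = sqrt \<tau>"
    define d where "d = \<bar>real_of_int (n - y)\<bar>"
    define \<rho> where "\<rho> = 1 + d / s"
    define Y where "Y = mm y i1"
    define x where "x = mm n i"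
    define v w where "v = sqrt (D * \<tau>)" and "w = sqrt (D * (\<tau> - 1))"
    have sg1: "sg N \<ge> 1" by (rule sg_ge_1[OF N])
    then have sgsq: "(sg N)\<^sup>2 \<ge> 1" by (simp add: one_le_power)
    \<comment> \<open>One unit from t < N and one from \<open>sg N\<close>. Hence tau - 1 >= tau /
      2, and all variances met during the step fall into the window allowed by
      \<open>heat_weight_bounds\<close>.\<close>
    have tau2: "\<tau> \<ge> 2" using t sgsq by (auto simp: \<tau>_def)
    have ssq: "s\<^sup>2 = \<tau>" using tau2 by (simp add: s_def)
    have ss: "s \<ge> sg N" unfolding s_def using t sg1 by (intro real_le_rsqrt) (auto simp: \<tau>_def)
    have s1: "s \<ge> 1" using ss sg1 by linarith
    have \<rho>: "\<rho> \<ge> 1" using s1 by (simp add: \<rho>_def d_def)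
    have wpos: "w > 0" using D tau2 by (simp add: w_def)
    have nN: "\<bar>n\<bar> \<le> int N" using n t by linarith
    have B: "\<bar>heat2 Y (sqrt (D * u)) \<xi>\<bar> \<le> C / (s\<^sup>2 * \<rho> ^ 4)" "\<bar>heat3 Y (sqrt (D * u)) \<xi>\<bar> \<le> C / (s ^ 3 * \<rho> ^ 4)"
      "\<bar>heat4 Y (sqrt (D * u)) \<xi>\<bar> \<le> C / (s ^ 4 * \<rho> ^ 4)"
      if "\<bar>\<xi> - x\<bar> \<le> K" "\<tau> - 1 \<le> u" "u \<le> \<tau>" for \<xi> u
    proof -
      have "s\<^sup>2 / 2 \<le> u" "u \<le> s\<^sup>2" using that tau2 unfolding ssq by auto
      then show "\<bar>heat2 Y (sqrt (D * u)) \<xi>\<bar> \<le> C / (s\<^sup>2 * \<rho> ^ 4)" "\<bar>heat3 Y (sqrt (D * u)) \<xi>\<bar> \<le> C / (s ^ 3 * \<rho> ^ 4)"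
        "\<bar>heat4 Y (sqrt (D * u)) \<xi>\<bar> \<le> C / (s ^ 4 * \<rho> ^ 4)"
        using C(2) N y ss that(1) unfolding Y_def x_def \<rho>_def d_def by blast+
    qed
    define g0 g1 where "g0 = Cg * (s powr (2 - \<beta>) * \<rho>\<^sup>2)" and "g1 = Cg * (s powr (1 - \<beta>) * \<rho>\<^sup>2)"
    have d0: "d \<ge> 0" by (simp add: d_def)
    have G0: "\<bar>G n i\<bar> \<le> g0"
    proof -
      have "\<bar>G n i\<bar> \<le> Cg * (d + sg N) powr (2 - \<beta>)" using G nN unfolding good_corrector_def d_def by blast
      also have "\<dots> \<le> g0" unfolding g0_def \<rho>_def using Cg \<beta> by (intro mult_left_mono weight_powr_le[OF ss N d0]) auto
      finally show ?thesis .
    qed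
    have G1: "\<bar>G n' j - G n i\<bar> \<le> g1" if "\<bar>n' - n\<bar> \<le> 1" for n' j
    proof -
      have "\<bar>G n' j - G n i\<bar> \<le> Cg * (d + sg N) powr (1 - \<beta>)" using G nN that unfolding good_corrector_def d_def by blast
      also have "\<dots> \<le> g1" unfolding g1_def \<rho>_def using Cg \<beta> by (intro mult_left_mono weight_powr_le[OF ss N d0]) auto
      finally show ?thesis .
    qed
    define B3 B4 where "B3 = C / (s ^ 3 * \<rho> ^ 4)" and "B4 = C / (s ^ 4 * \<rho> ^ 4)"
    define E where "E = s powr (- 2 - \<beta>) / \<rho>\<^sup>2"
    have E0: "E \<ge> 0" by (simp add: E_def)
    have sp: "s powr (- 2 - \<beta>) * s ^ 2 = s powr - \<beta>" "s powr (- 2 - \<beta>) * s ^ 3 = s powr (1 - \<beta>)" "s powr (- 2 - \<beta>) * s ^ 4 = s powr (2 - \<beta>)"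
      using s1 by (simp_all add: powr_add[symmetric] flip: powr_numeral)
    have b3: "B3 \<le> C * E" and b4: "B4 \<le> C * E"
    proof -
      have k: "1 / (s ^ k * \<rho> ^ 4) \<le> E" if "s powr (- 2 - \<beta>) * s ^ k \<ge> 1" for k
      proof -
        have "1 * 1 \<le> (s powr (- 2 - \<beta>) * s ^ k) * \<rho>\<^sup>2" using that \<rho> by (intro mult_mono) (auto simp: one_le_power)
        then have "1 \<le> E * (s ^ k * \<rho> ^ 4)" using \<rho> by (simp add: E_def power2_eq_square power4_eq_xxxx field_simps)
        then show ?thesis using s1 \<rho> by (simp add: divide_le_eq)
      qed
      have "1 \<le> s powr (1 - \<beta>)" "1 \<le> s powr (2 - \<beta>)" using s1 \<beta> by (auto intro: ge_one_powr_ge_zero)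
      then show "B3 \<le> C * E" "B4 \<le> C * E"
        using mult_left_mono[OF k[of 3], of C] mult_left_mono[OF k[of 4], of C] C(1) unfolding B3_def B4_def sp by auto
    qed
    have e31: "B3 * g1 = C * Cg * E"
    proof -
      have "B3 * g1 = C * Cg * (s powr (1 - \<beta>) / s ^ 3) / \<rho>\<^sup>2"
        using \<rho> by (simp add: B3_def g1_def power2_eq_square power4_eq_xxxx)
      also have "s powr (1 - \<beta>) / s ^ 3 = s powr (- 2 - \<beta>)" using s1 by (simp add: sp(2)[symmetric])
      finally show ?thesis by (simp add: E_def)
    qed
    have e40: "B4 * g0 = C * Cg * E"
    proof -
      have "B4 * g0 = C * Cg * (s powr (2 - \<beta>) / s ^ 4) / \<rho>\<^sup>2"
        using \<rho> by (simp add: B4_def g0_def power2_eq_square power4_eq_xxxx)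
      also have "s powr (2 - \<beta>) / s ^ 4 = s powr (- 2 - \<beta>)" using s1 by (simp add: sp(3)[symmetric])
      finally show ?thesis by (simp add: E_def)
    qed
    \<comment> \<open>The comparison function of \<open>heat_space_step\<close>, viewed as a
      function of the new position; w is the standard deviation after the step.\<close>
    define A where "A = (\<lambda>n' j. heat0 Y w x + heat1 Y w x * (mm n' j - mm n i) + heat2 Y w x * (mm n' j - mm n i)\<^sup>2 / 2
        - heat2 Y w x * G n' j / 2 - heat3 Y w x * (mm n' j - mm n i) * G n i / 2)"
    have TA: "T A n i = heat0 Y w x + heat2 Y w x * D / 2 - heat2 Y w x * G n i / 2"
    proof -
      have TG: "T G n i = G n i + (q n i - D)" using G nN unfolding good_corrector_def by blast
      show ?thesis unfolding A_def T_quadratic TG by (simp add: field_simps)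
    qed
    have uS: "corrected G y N (Suc t) n' j = heat0 Y w (mm n' j) - heat2 Y w (mm n' j) * G n' j / 2" for n' j
      by (simp add: corrected_def profile_def Y_def w_def \<tau>_def algebra_simps)
    have ut: "corrected G y N t n i = heat0 Y v x - heat2 Y v x * G n i / 2"
      by (simp add: corrected_def profile_def Y_def v_def \<tau>_def x_def)
    have "\<bar>T (\<lambda>n' j. corrected G y N (Suc t) n' j - A n' j) n i\<bar> \<le> K ^ 3 * B3 + K * B3 * g1 + K\<^sup>2 * B4 * g0"
    proof (rule T_abs_le)
      fix n' j assume n': "\<bar>n' - n\<bar> \<le> 1"
      show "\<bar>corrected G y N (Suc t) n' j - A n' j\<bar> \<le> K ^ 3 * B3 + K * B3 * g1 + K\<^sup>2 * B4 * g0"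
        unfolding uS A_def x_def[symmetric]
      proof (rule heat_space_step[OF wpos])
        show "\<bar>mm n' j - x\<bar> \<le> K" unfolding x_def by (rule mm_lip[OF n'])
        show "\<bar>heat3 Y w \<xi>\<bar> \<le> B3" "\<bar>heat4 Y w \<xi>\<bar> \<le> B4" if "\<bar>\<xi> - x\<bar> \<le> K" for \<xi>
          unfolding w_def B3_def B4_def using B[OF that, of "\<tau> - 1"] by auto
      qed (use G0 G1[OF n'] in auto)
    qed
    then have 1: "\<bar>T (corrected G y N (Suc t)) n i - T A n i\<bar> \<le> K ^ 3 * B3 + K * (B3 * g1) + K\<^sup>2 * (B4 * g0)"
      by (simp only: T_diff mult.assoc)
    have h4: "\<bar>heat4 Y (sqrt (D * u)) x\<bar> \<le> B4" if "\<tau> - 1 \<le> u" "u \<le> \<tau>" for u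
      unfolding B4_def using B(3)[of x u] that K_nonneg by simp
    have 2: "\<bar>heat0 Y v x - heat0 Y w x - D / 2 * heat2 Y w x\<bar> \<le> D\<^sup>2 * B4"
      and 3: "\<bar>heat2 Y v x - heat2 Y w x\<bar> \<le> D * B4"
      unfolding v_def w_def using heat_time_step[OF D _ h4] tau2 by auto
    have B40: "B4 \<ge> 0" using C(1) s1 \<rho> by (simp add: B4_def)
    have 4: "\<bar>(heat2 Y v x - heat2 Y w x) * G n i\<bar> \<le> D * (B4 * g0)"
      unfolding abs_mult mult.assoc[symmetric] using 3 G0 D B40 by (intro mult_mono) auto
    have "\<bar>T (corrected G y N (Suc t)) n i - corrected G y N t n i\<bar>
      \<le> K ^ 3 * B3 + K * (B3 * g1) + K\<^sup>2 * (B4 * g0) + D\<^sup>2 * B4 + D * (B4 * g0)"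
    proof -
      \<comment> \<open>In \<open>TA\<close> the Poisson equation has already replaced q by D; the
        surviving D / 2 times \<open>heat2\<close> is what the heat equation removes in the second
        bracket.\<close>
      have "T (corrected G y N (Suc t)) n i - corrected G y N t n i = (T (corrected G y N (Suc t)) n i - T A n i)
          - (heat0 Y v x - heat0 Y w x - D / 2 * heat2 Y w x) + ((heat2 Y v x - heat2 Y w x) * G n i) / 2"
        unfolding TA ut by (simp add: field_simps)
      then show ?thesis using 1 2 4 by linarith
    qed
    also have "\<dots> \<le> K ^ 3 * (C * E) + K * (C * Cg * E) + K\<^sup>2 * (C * Cg * E) + D\<^sup>2 * (C * E) + D * (C * Cg * E)"
      unfolding e31 e40 using K_nonneg D b3 b4 C(1) Cg by (intro add_mono mult_left_mono) auto
    also have "\<dots> = C' * E" by (simp add: C'_def algebra_simps)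
    finally show "\<bar>T (corrected G y N (Suc t)) n i - corrected G y N t n i\<bar>
      \<le> C' * sqrt (real N - real t + (sg N)\<^sup>2) powr (- 2 - \<beta>) / (1 + \<bar>real_of_int (n - y)\<bar> / sqrt (real N - real t + (sg N)\<^sup>2))\<^sup>2"
      unfolding E_def \<rho>_def s_def \<tau>_def d_def by simp
  qed
qed


text \<open>Dynkin's formula is applied to the corrected profile, whose one-step defects are summed
  by \<open>error_sum_le\<close>. The correction then has to be removed at both ends: at time 0 it
  is small because s >= sqrt N, at time N only because the walk is seldom near y.\<close>

lemma smooth_comparison:
  assumes \<kappa>: "\<kappa> \<ge> 1" and ac: "anticonc Ca \<gamma>" "Ca \<ge> 0" and \<gamma>: "0 \<le> \<gamma>" "\<gamma> \<le> \<beta> / 2"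
  shows "\<exists>C\<ge>0. \<forall>N\<ge>1. \<forall>y. \<bar>real_of_int y\<bar> \<le> \<kappa> * real N \<longrightarrow>
    \<bar>Ex N (profile y N N) - profile y N 0 0 i0\<bar> \<le> C * (real N powr - (\<beta> / 2) + real N powr - (\<gamma> + \<beta> * (1 - \<beta>) / 4))"
proof -
  obtain Cg where Cg: "Cg \<ge> 1" "\<forall>N\<ge>1. \<forall>y. \<bar>real_of_int y\<bar> \<le> \<kappa> * real N \<longrightarrow> (\<exists>G. good_corrector Cg N y G)"
    using corrector[OF \<kappa>] unfolding good_corrector_def sg_def by blast
  obtain C1 where C1: "C1 \<ge> 0" "\<forall>N y G t n i. N \<ge> 1 \<longrightarrow> \<bar>real_of_int y\<bar> \<le> \<kappa> * real N \<longrightarrow> good_corrector Cg N y G \<longrightarrow> t < N \<longrightarrow> \<bar>n\<bar> \<le> int t \<longrightarrow>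
    \<bar>T (corrected G y N (Suc t)) n i - corrected G y N t n i\<bar>
      \<le> C1 * sqrt (real N - real t + (sg N)\<^sup>2) powr (- 2 - \<beta>) / (1 + \<bar>real_of_int (n - y)\<bar> / sqrt (real N - real t + (sg N)\<^sup>2))\<^sup>2"
    using corrected_step[OF \<kappa> Cg(1)] by blast
  obtain C2 where C2: "C2 \<ge> 1" "\<forall>N y n i s \<xi> \<tau>. N \<ge> 1 \<longrightarrow> \<bar>real_of_int y\<bar> \<le> \<kappa> * real N \<longrightarrow> s \<ge> sg N \<longrightarrow> \<bar>\<xi> - mm n i\<bar> \<le> K \<longrightarrow>
     s\<^sup>2 / 2 \<le> \<tau> \<longrightarrow> \<tau> \<le> s\<^sup>2 \<longrightarrow>
     \<bar>heat2 (mm y i1) (sqrt (D * \<tau>)) \<xi>\<bar> \<le> C2 / (s\<^sup>2 * (1 + \<bar>real_of_int (n - y)\<bar> / s) ^ 4)"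
    using heat_weight_bounds[OF \<kappa>] by meson
  obtain C3 where C3: "C3 \<ge> 0" "\<forall>N\<ge>1. (\<Sum>t\<in>{1..<N}. sqrt (real N - real t + (sg N)\<^sup>2) powr (- 2 - \<beta>)
      * (sqrt (real N - real t + (sg N)\<^sup>2) / sqrt (real t) + real t powr - \<gamma>))
    \<le> C3 * (real N powr - (\<beta> / 2) + real N powr - (\<gamma> + \<beta> * (1 - \<beta>) / 4))"
    using error_sum_le[OF \<beta> \<gamma>] unfolding sg_def by blast
  define C where "C = (C1 + C1 * (8 * Ca) * C3) + C2 * Cg * (8 * Ca) + C2 * Cg"
  have C0: "C \<ge> 0" unfolding C_def using C1 C2 C3 Cg ac by (intro add_nonneg_nonneg mult_nonneg_nonneg) auto
  show ?thesis
  proof (intro exI[of _ C] conjI[OF C0] allI impI)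
    fix N :: nat and y :: int assume N: "1 \<le> N" and y: "\<bar>real_of_int y\<bar> \<le> \<kappa> * real N"
    obtain G where G: "good_corrector Cg N y G" using Cg(2) N y by blast
    define s where "s = (\<lambda>t. sqrt (real N - real t + (sg N)\<^sup>2))"
    define W where "W = (\<lambda>t (n::int) (i::'m). 1 / (1 + \<bar>real_of_int (n - y)\<bar> / s t)\<^sup>2)"
    define X where "X = real N powr - (\<beta> / 2) + real N powr - (\<gamma> + \<beta> * (1 - \<beta>) / 4)"
    have sg1: "sg N \<ge> 1" by (rule sg_ge_1[OF N])
    have N1: "real N \<ge> 1" using N by simp
    have ss: "s t \<ge> sg N" if "t \<le> N" for t
      unfolding s_def using that sg1 by (intro real_le_rsqrt) auto
    have s1: "s t \<ge> 1" if "t \<le> N" for t using ss[OF that] sg1 by linarith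
    have s0: "s 0 \<ge> sqrt (real N)" by (simp add: s_def)
    have pw: "s 0 powr - e \<le> real N powr - (\<beta> / 2)" if "e \<ge> \<beta>" for e
    proof -
      have "s 0 powr - e \<le> s 0 powr - \<beta>" using that s1[of 0] by (intro powr_mono) auto
      also have "\<dots> \<le> sqrt (real N) powr - \<beta>" using s0 N1 \<beta> by (intro powr_mono2') auto
      also have "\<dots> = real N powr - (\<beta> / 2)" unfolding sqrt_powr[OF order_trans[OF zero_le_one N1]] by simp
      finally show ?thesis .
    qed
    have W: "Ex t (W t) \<le> 8 * Ca * (s t / sqrt (real t) + real t powr - \<gamma>)" if "1 \<le> t" "t \<le> N" for t
      unfolding W_def by (rule anticonc_weight[OF ac that(1)]) (use s1[OF that(2)] in linarith)
    have W1: "W t n i \<le> 1" if "t \<le> N" for t n i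
    proof -
      have "1 \<le> (1 + \<bar>real_of_int (n - y)\<bar> / s t)\<^sup>2" using s1[OF that] by (intro one_le_power) simp
      then have "1 / (1 + \<bar>real_of_int (n - y)\<bar> / s t)\<^sup>2 \<le> 1 / 1" by (intro frac_le) auto
      then show ?thesis by (simp add: W_def)
    qed
    have step: "\<bar>Ex t (\<lambda>n i. T (corrected G y N (Suc t)) n i - corrected G y N t n i)\<bar> \<le> C1 * s t powr (- 2 - \<beta>) * Ex t (W t)"
      if "t < N" for t
      unfolding Ex_cmult[symmetric]
    proof (rule Ex_abs_le)
      fix n i assume "\<bar>n\<bar> \<le> int t"
      then show "\<bar>T (corrected G y N (Suc t)) n i - corrected G y N t n i\<bar> \<le> C1 * s t powr (- 2 - \<beta>) * W t n i"
        using C1(2) N y G that unfolding s_def W_def times_divide_eq_right mult_1_right by blast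
    qed
    have first: "\<bar>Ex N (corrected G y N N) - corrected G y N 0 0 i0\<bar> \<le> (C1 + C1 * (8 * Ca) * C3) * X"
    proof -
      have "\<bar>Ex N (corrected G y N N) - corrected G y N 0 0 i0\<bar> \<le> (\<Sum>t<N. C1 * s t powr (- 2 - \<beta>) * Ex t (W t))"
        unfolding Ex_telescope by (rule order_trans[OF sum_abs sum_mono]) (use step in auto)
      \<comment> \<open>Time 0 is split off because \<open>anticonc\<close> speaks of t >= 1 only;
        there the bound s >= sqrt N alone suffices.\<close>
      also have "\<dots> = C1 * s 0 powr (- 2 - \<beta>) * Ex 0 (W 0) + (\<Sum>t\<in>{1..<N}. C1 * s t powr (- 2 - \<beta>) * Ex t (W t))"
      proof -
        have "{..<N} = insert 0 {1..<N}" using N by auto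
        then show ?thesis by simp
      qed
      also have "\<dots> \<le> C1 * X * 1 + (\<Sum>t\<in>{1..<N}. C1 * s t powr (- 2 - \<beta>) * (8 * Ca * (s t / sqrt (real t) + real t powr - \<gamma>)))"
      proof (intro add_mono mult_mono sum_mono order_refl)
        have "s 0 powr (- 2 - \<beta>) \<le> real N powr - (\<beta> / 2)" using pw[of "2 + \<beta>"] by simp
        then show "s 0 powr (- 2 - \<beta>) \<le> X" by (simp add: X_def add_increasing2)
        show "Ex 0 (W 0) \<le> 1" using W1[of 0] by (simp add: Ex_0)
        show "0 \<le> Ex 0 (W 0)" by (simp add: Ex_0 W_def)
        fix t assume "t \<in> {1..<N}"
        then show "Ex t (W t) \<le> 8 * Ca * (s t / sqrt (real t) + real t powr - \<gamma>)" using W[of t] by auto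
        show "0 \<le> Ex t (W t)" using Ex_mono[of t "\<lambda>n i. 0" "W t"] by (simp add: Ex_const W_def)
      qed (use C1 in \<open>auto simp: X_def\<close>)
      also have "\<dots> = C1 * X + C1 * (8 * Ca) * (\<Sum>t\<in>{1..<N}. s t powr (- 2 - \<beta>) * (s t / sqrt (real t) + real t powr - \<gamma>))"
        by (simp only: sum_distrib_left mult_1_right mult_ac)
      also have "\<dots> \<le> C1 * X + C1 * (8 * Ca) * (C3 * X)"
        using C3(2) N C1(1) ac(2) unfolding s_def X_def by (intro add_left_mono mult_left_mono) auto
      finally show ?thesis by (simp add: algebra_simps)
    qed
    \<comment> \<open>The correction has order s^-2 s^(2 - beta) = s^-beta, with two powers of decay
      left over as \<open>W\<close>.\<close>
    have h2: "\<bar>profile y N t n i - corrected G y N t n i\<bar> \<le> C2 * Cg * s t powr - \<beta> * W t n i"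
      if t: "t \<le> N" and n: "\<bar>n\<bar> \<le> int N" for t n i
    proof -
      define \<rho> where "\<rho> = 1 + \<bar>real_of_int (n - y)\<bar> / s t"
      have st: "s t \<ge> 1" by (rule s1[OF t])
      have \<rho>: "\<rho> \<ge> 1" using st by (simp add: \<rho>_def)
      have sq: "(s t)\<^sup>2 = real N - real t + (sg N)\<^sup>2" using t by (simp add: s_def)
      have a: "\<bar>heat2 (mm y i1) (sqrt (D * (real N - real t + (sg N)\<^sup>2))) (mm n i)\<bar> \<le> C2 / ((s t)\<^sup>2 * \<rho> ^ 4)"
        using C2(2)[rule_format, of N y "s t" "mm n i" n i "(s t)\<^sup>2"] N y ss[OF t] K_nonneg t
        unfolding \<rho>_def sq by (simp add: add_increasing)
      have b: "\<bar>G n i\<bar> \<le> Cg * (s t powr (2 - \<beta>) * \<rho>\<^sup>2)"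
      proof -
        have "\<bar>G n i\<bar> \<le> Cg * (\<bar>real_of_int (n - y)\<bar> + sg N) powr (2 - \<beta>)" using G n unfolding good_corrector_def by blast
        also have "\<dots> \<le> Cg * (s t powr (2 - \<beta>) * \<rho>\<^sup>2)" unfolding \<rho>_def
          using Cg \<beta> by (intro mult_left_mono weight_powr_le[OF ss[OF t] N]) auto
        finally show ?thesis .
      qed
      have "\<bar>profile y N t n i - corrected G y N t n i\<bar>
          = \<bar>heat2 (mm y i1) (sqrt (D * (real N - real t + (sg N)\<^sup>2))) (mm n i)\<bar> * \<bar>G n i\<bar> / 2"
        by (simp add: corrected_def abs_mult)
      also have "\<dots> \<le> \<bar>heat2 (mm y i1) (sqrt (D * (real N - real t + (sg N)\<^sup>2))) (mm n i)\<bar> * \<bar>G n i\<bar>" by simp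
      also have "\<dots> \<le> (C2 / ((s t)\<^sup>2 * \<rho> ^ 4)) * (Cg * (s t powr (2 - \<beta>) * \<rho>\<^sup>2))"
        using a b C2(1) by (intro mult_mono) auto
      also have "\<dots> = C2 * Cg * (s t powr (2 - \<beta>) / (s t)\<^sup>2) / \<rho>\<^sup>2"
        using \<rho> by (simp add: power2_eq_square power4_eq_xxxx)
      also have "s t powr (2 - \<beta>) / (s t)\<^sup>2 = s t powr - \<beta>"
        using st powr_add[of "s t" "- \<beta>" 2] by simp
      finally show ?thesis by (simp add: W_def \<rho>_def)
    qed
    have second: "\<bar>Ex N (profile y N N) - Ex N (corrected G y N N)\<bar> \<le> C2 * Cg * (8 * Ca) * X"
    proof -
      have "\<bar>Ex N (profile y N N) - Ex N (corrected G y N N)\<bar> \<le> Ex N (\<lambda>n i. C2 * Cg * s N powr - \<beta> * W N n i)"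
        unfolding Ex_diff[symmetric] by (rule Ex_abs_le) (use h2 in auto)
      also have "\<dots> = C2 * Cg * s N powr - \<beta> * Ex N (W N)" by (rule Ex_cmult)
      also have "\<dots> \<le> C2 * Cg * s N powr - \<beta> * (8 * Ca * (s N / sqrt (real N) + real N powr - \<gamma>))"
        using W[of N] N C2 Cg by (intro mult_left_mono) auto
      also have "\<dots> = C2 * Cg * (8 * Ca) * (s N powr - \<beta> * (s N / sqrt (real N)) + s N powr - \<beta> * real N powr - \<gamma>)"
        by (simp add: algebra_simps)
      also have "\<dots> \<le> C2 * Cg * (8 * Ca) * X"
        unfolding X_def
      proof (intro mult_left_mono add_mono)
        have sN: "s N = sg N" using sg1 by (simp add: s_def)
        have sNp: "s N / sqrt (real N) = real N powr - (\<beta> / 2)"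
        proof -
          have "s N / sqrt (real N) = real N powr ((1 - \<beta>) / 2 - 1 / 2)"
            using N1 by (simp add: sN sg_def powr_diff powr_half_sqrt)
          also have "(1 - \<beta>) / 2 - 1 / 2 = - (\<beta> / 2)" by (simp add: field_simps)
          finally show ?thesis .
        qed
        have "s N powr - \<beta> \<le> s N powr 0" using s1[of N] \<beta> by (intro powr_mono) auto
        then have le1: "s N powr - \<beta> \<le> 1" using s1[of N] by simp
        then show "s N powr - \<beta> * (s N / sqrt (real N)) \<le> real N powr - (\<beta> / 2)"
          unfolding sNp by (simp add: mult_left_le_one_le)
        have "s N powr - \<beta> * real N powr - \<gamma> = real N powr ((1 - \<beta>) / 2 * - \<beta> + - \<gamma>)"
          unfolding sN sg_def powr_powr powr_add ..
        also have "\<dots> \<le> real N powr - (\<gamma> + \<beta> * (1 - \<beta>) / 4)"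
        proof (intro powr_mono)
          have "0 \<le> \<beta> * (1 - \<beta>)" using \<beta> by auto
          moreover have "(1 - \<beta>) / 2 * - \<beta> = - (\<beta> * (1 - \<beta>)) / 2" by simp
          ultimately show "(1 - \<beta>) / 2 * - \<beta> + - \<gamma> \<le> - (\<gamma> + \<beta> * (1 - \<beta>) / 4)" by linarith
        qed (use N1 in auto)
        finally show "s N powr - \<beta> * real N powr - \<gamma> \<le> real N powr - (\<gamma> + \<beta> * (1 - \<beta>) / 4)" .
      qed (use C2 Cg ac in auto)
      finally show ?thesis .
    qed
    have third: "\<bar>profile y N 0 0 i0 - corrected G y N 0 0 i0\<bar> \<le> C2 * Cg * X"
    proof -
      have "\<bar>profile y N 0 0 i0 - corrected G y N 0 0 i0\<bar> \<le> C2 * Cg * s 0 powr - \<beta> * W 0 0 i0"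
        by (rule h2) auto
      also have "\<dots> \<le> C2 * Cg * X * 1"
      proof (intro mult_mono order_refl)
        show "s 0 powr - \<beta> \<le> X" using pw[of \<beta>] by (simp add: X_def add_increasing2)
        show "W 0 0 i0 \<le> 1" by (rule W1) simp
      qed (use C2 Cg in \<open>auto simp: X_def W_def\<close>)
      finally show ?thesis by simp
    qed
    have "\<bar>Ex N (profile y N N) - profile y N 0 0 i0\<bar> \<le> (C1 + C1 * (8 * Ca) * C3) * X + C2 * Cg * (8 * Ca) * X + C2 * Cg * X"
      using first second third by linarith
    also have "\<dots> = C * X" by (simp add: C_def algebra_simps)
    finally show "\<bar>Ex N (profile y N N) - profile y N 0 0 i0\<bar> \<le> C * (real N powr - (\<beta> / 2) + real N powr - (\<gamma> + \<beta> * (1 - \<beta>) / 4))"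
      unfolding X_def .
  qed
qed

end

section \<open>Anticoncentration and the rate\<close>

lemma Phi_pos_mass: "Phi 1 - Phi (- 1) > 0"
proof -
  have "Phi (- 1) < Phi 1"
    by (rule DERIV_pos_imp_increasing)
       (use has_real_derivative_Phi normal_density_pos[of 1 0] in \<open>auto intro!: exI\<close>)
  then show ?thesis by simp
qed

context strip_clt
begin

lemma profile_final: "profile y N N n i = Phi ((mm y i1 - mm n i) / (sqrt D * sg N))"
  using D by (simp add: profile_def heat0_def real_sqrt_mult sg_def)

lemma profile_initial: "profile y N 0 n i = Phi ((mm y i1 - mm n i) / sqrt (D * (real N + (sg N)\<^sup>2)))"
  by (simp add: profile_def heat0_def)

lemma sg_div_sqrt:
  assumes "N \<ge> 1"
  shows "sg N / sqrt (real N) = real N powr - (\<beta> / 2)"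
proof -
  have "sg N / sqrt (real N) = real N powr ((1 - \<beta>) / 2 - 1 / 2)"
    using assms by (simp add: sg_def powr_diff powr_half_sqrt)
  also have "(1 - \<beta>) / 2 - 1 / 2 = - (\<beta> / 2)" by (simp add: field_simps)
  finally show ?thesis .
qed

lemma sg_le: "N \<ge> 1 \<Longrightarrow> sg N \<le> real N"
  using powr_mono[of "(1 - \<beta>) / 2" 1 "real N"] \<beta> by (simp add: sg_def)

text \<open>A ball around k is dominated, up to the factor \<open>p0\<close>, by the difference of
  the profiles with thresholds k + M and k - M, where M is a multiple of the radius.
  \<open>smooth_comparison\<close> moves both profiles to time 0, and there the Lipschitz bound for
  \<open>Phi\<close> yields M / sqrt N.\<close>

lemma anticonc_improve:
  assumes ac: "anticonc Ca \<gamma>" "Ca \<ge> 0" and \<gamma>: "0 \<le> \<gamma>" "\<gamma> \<le> \<beta> / 2"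
  shows "\<exists>C\<ge>0. anticonc C (min (\<gamma> + \<beta> * (1 - \<beta>) / 4) (\<beta> / 2))"
proof -
  define \<gamma>' where "\<gamma>' = min (\<gamma> + \<beta> * (1 - \<beta>) / 4) (\<beta> / 2)"
  obtain C1 where C1: "C1 \<ge> 1" "\<forall>N\<ge>1. \<forall>u v i. \<bar>real_of_int v\<bar> \<le> 2 * real N \<longrightarrow>
    \<bar>mm u i - mm v i1 - real_of_int (u - v)\<bar> \<le> \<bar>real_of_int (u - v)\<bar> / 2 + C1 * sg N"
    using coarse[of 2] by auto
  \<comment> \<open>Chosen so that for every site of the ball both thresholds are at least one
    standard deviation sqrt D * sigma away in martingale value, on opposite sides; the mass of the
    interval from -1 to 1 is then a lower bound. The terms are paid for by the radius, by the error
    in \<open>coarse\<close> and by that standard deviation.\<close>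
  define c where "c = 3 + 4 * C1 + 2 * sqrt D"
  have c: "c \<ge> 1" using C1(1) D by (simp add: c_def)
  obtain C2 where C2: "C2 \<ge> 0" "\<forall>N\<ge>1. \<forall>y. \<bar>real_of_int y\<bar> \<le> (c + 3) * real N \<longrightarrow>
    \<bar>Ex N (profile y N N) - profile y N 0 0 i0\<bar> \<le> C2 * (real N powr - (\<beta> / 2) + real N powr - (\<gamma> + \<beta> * (1 - \<beta>) / 4))"
    using smooth_comparison[of "c + 3", OF _ ac \<gamma>] c by auto
  define p0 where "p0 = Phi 1 - Phi (- 1)"
  have p0: "p0 > 0" unfolding p0_def by (rule Phi_pos_mass)
  define C3 where "C3 = (3 * (c + 1) + 2 * C1) / sqrt D"
  have C30: "C3 \<ge> 0" using c C1(1) D by (simp add: C3_def)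
  define C where "C = 1 + (C3 + 4 * C2) / p0"
  have C0: "C \<ge> 1" "(C3 + 4 * C2) / p0 \<le> C" using C30 C2(1) p0 by (simp_all add: C_def)
  have "anticonc C \<gamma>'"
    unfolding anticonc_def
  proof (intro allI impI)
    fix N :: nat and k :: int and r :: real assume N: "1 \<le> N" and r: "0 \<le> r"
    have N1: "real N \<ge> 1" using N by simp
    let ?E = "Ex N (\<lambda>n i. of_bool (\<bar>real_of_int (n - k)\<bar> \<le> r))"
    define X where "X = real N powr - \<gamma>'"
    have X0: "X \<ge> 0" by (simp add: X_def)
    have pos: "r / sqrt (real N) + X \<ge> 0" using r X0 by simp
    \<comment> \<open>For r >= N the claim exceeds 1; for r < N and |k| > 2 N the ball misses the
      range of the walk. Only the last case keeps the thresholds within the factor c + 3 of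
      N.\<close>
    consider "r \<ge> real N" | "r < real N" "\<bar>k\<bar> > 2 * int N" | "r < real N" "\<bar>k\<bar> \<le> 2 * int N" by linarith
    then have "?E \<le> C * (r / sqrt (real N) + X)"
    proof cases
      case 1
      have "?E \<le> Ex N (\<lambda>n i. 1)" by (rule Ex_mono) simp
      also have "\<dots> \<le> r / sqrt (real N)"
      proof -
        have "sqrt (real N) * 1 \<le> sqrt (real N) * sqrt (real N)" using N1 by (intro mult_left_mono) auto
        then have "sqrt (real N) \<le> r" using 1 N1 by simp
        then show ?thesis using N1 by (simp add: Ex_const le_divide_eq)
      qed
      also have "\<dots> \<le> 1 * (r / sqrt (real N) + X)" using X0 by simp
      also have "\<dots> \<le> C * (r / sqrt (real N) + X)" using C0(1) pos by (rule mult_right_mono)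
      finally show ?thesis .
    next
      case 2
      have "?E \<le> Ex N (\<lambda>n i. 0)" by (rule Ex_mono) (use 2 in auto)
      also have "\<dots> \<le> C * (r / sqrt (real N) + X)" using C0(1) pos by (simp add: Ex_const)
      finally show ?thesis .
    next
      case 3
      define \<sigma> where "\<sigma> = sg N"
      have \<sigma>: "\<sigma> \<ge> 1" "\<sigma> \<le> real N" using sg_ge_1[OF N] sg_le[OF N] by (auto simp: \<sigma>_def)
      \<comment> \<open>The mollified profiles resolve nothing below sigma. Enlarging the ball to
        that radius costs sigma / sqrt N = N^(-beta/2), which the error term can afford.\<close>
      define r' where "r' = max r \<sigma>"
      have r': "r' \<ge> r" "r' \<ge> \<sigma>" "r' \<le> r + \<sigma>" "r' \<le> real N" using r \<sigma> 3 by (auto simp: r'_def)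
      define M where "M = \<lceil>c * r'\<rceil>"
      have M: "real_of_int M \<ge> c * r'" "real_of_int M \<le> (c + 1) * r'"
      proof -
        show "real_of_int M \<ge> c * r'" by (simp add: M_def)
        have "real_of_int M \<le> c * r' + 1" unfolding M_def by linarith
        then show "real_of_int M \<le> (c + 1) * r'" using r' \<sigma> by (simp add: algebra_simps)
      qed
      have M0: "real_of_int M \<ge> 0" using M(1) c r' \<sigma> mult_nonneg_nonneg[of c r'] by linarith
      define y1 y2 where "y1 = k - M" and "y2 = k + M"
      have kb: "\<bar>real_of_int k\<bar> \<le> 2 * real N" using 3 by linarith
      have Mb: "real_of_int M \<le> (c + 1) * real N" using M(2) r'(4) c by (meson order_trans mult_left_mono add_increasing2 zero_le_one order_trans[OF zero_le_one c])
      have yb: "\<bar>real_of_int y1\<bar> \<le> (c + 3) * real N" "\<bar>real_of_int y2\<bar> \<le> (c + 3) * real N"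
      proof -
        have "2 * real N + (c + 1) * real N = (c + 3) * real N" by (simp add: algebra_simps)
        then show "\<bar>real_of_int y1\<bar> \<le> (c + 3) * real N" "\<bar>real_of_int y2\<bar> \<le> (c + 3) * real N"
          using kb Mb M0 unfolding y1_def y2_def by auto
      qed
      have co: "\<bar>mm u i - mm k i1 - real_of_int (u - k)\<bar> \<le> \<bar>real_of_int (u - k)\<bar> / 2 + C1 * \<sigma>" for u i
        using C1(2) N kb unfolding \<sigma>_def by blast
      define Y1 Y2 Y where "Y1 = mm y1 i1" and "Y2 = mm y2 i1" and "Y = mm k i1"
      have "\<bar>Y1 - Y + real_of_int M\<bar> \<le> real_of_int M / 2 + C1 * \<sigma>" "\<bar>Y2 - Y - real_of_int M\<bar> \<le> real_of_int M / 2 + C1 * \<sigma>"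
        using co[of y1 i1] co[of y2 i1] M0 by (simp_all add: y1_def y2_def Y1_def Y2_def Y_def)
      then have Yb: "Y1 \<le> Y - real_of_int M / 2 + C1 * \<sigma>" "Y2 \<ge> Y + real_of_int M / 2 - C1 * \<sigma>"
          "Y2 - Y1 \<le> 3 * real_of_int M + 2 * (C1 * \<sigma>)" by linarith+
      have Ms: "real_of_int M / 2 \<ge> 3/2 * r + 2 * (C1 * \<sigma>) + sqrt D * \<sigma>"
      proof -
        have "3 * r \<le> 3 * r'" "C1 * \<sigma> \<le> C1 * r'" "sqrt D * \<sigma> \<le> sqrt D * r'"
          using r' C1(1) D by (auto intro!: mult_left_mono)
        moreover have "c * r' = 3 * r' + 4 * (C1 * r') + 2 * (sqrt D * r')" by (simp add: c_def algebra_simps)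
        ultimately show ?thesis using M(1) by linarith
      qed
      define w where "w = sqrt D * \<sigma>"
      have w: "w > 0" using D \<sigma> by (simp add: w_def)
      have C1s: "C1 * \<sigma> \<ge> 0" using C1(1) \<sigma> by simp
      have Y12: "Y1 \<le> Y2" using Yb Ms r C1s w unfolding w_def by linarith
      have pr: "p0 * of_bool (\<bar>real_of_int (n - k)\<bar> \<le> r) \<le> profile y2 N N n i - profile y1 N N n i" for n i
      proof (cases "\<bar>real_of_int (n - k)\<bar> \<le> r")
        case False
        have "profile y1 N N n i \<le> profile y2 N N n i"
          unfolding profile_final Y1_def[symmetric] Y2_def[symmetric] \<sigma>_def[symmetric] w_def[symmetric]
          using Y12 w by (intro Phi_mono divide_right_mono) auto
        then show ?thesis using False by simp
      next
        case True
        have "\<bar>mm n i - Y - real_of_int (n - k)\<bar> \<le> r / 2 + C1 * \<sigma>"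
          unfolding Y_def by (rule order_trans[OF co[of n i]]) (use True in simp)
        then have "\<bar>mm n i - Y\<bar> \<le> 3/2 * r + C1 * \<sigma>" using True by linarith
        then have "w \<le> Y2 - mm n i" "Y1 - mm n i \<le> - w"
          using Yb Ms unfolding w_def by linarith+
        then have "Phi 1 \<le> Phi ((Y2 - mm n i) / w)" "Phi ((Y1 - mm n i) / w) \<le> Phi (- 1)"
          using w by (auto intro!: Phi_mono simp: le_divide_eq divide_le_eq)
        then show ?thesis
          unfolding profile_final Y1_def[symmetric] Y2_def[symmetric] \<sigma>_def[symmetric] w_def[symmetric]
          using True by (simp add: p0_def)
      qed
      have Xb: "real N powr - (\<beta> / 2) + real N powr - (\<gamma> + \<beta> * (1 - \<beta>) / 4) \<le> 2 * X"
      proof -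
        have "real N powr - (\<beta> / 2) \<le> X" "real N powr - (\<gamma> + \<beta> * (1 - \<beta>) / 4) \<le> X"
          unfolding X_def \<gamma>'_def using N1 by (intro powr_mono le_imp_neg_le min.cobounded1 min.cobounded2; assumption)+
        then show ?thesis by simp
      qed
      have "p0 * ?E \<le> Ex N (profile y2 N N) - Ex N (profile y1 N N)"
        unfolding Ex_cmult[symmetric] Ex_diff[symmetric] by (rule Ex_mono) (rule pr)
      also have "\<dots> \<le> (profile y2 N 0 0 i0 - profile y1 N 0 0 i0) + 2 * (C2 * (2 * X))"
      proof -
        have "\<bar>Ex N (profile y2 N N) - profile y2 N 0 0 i0\<bar> \<le> C2 * (2 * X)"
          "\<bar>Ex N (profile y1 N N) - profile y1 N 0 0 i0\<bar> \<le> C2 * (2 * X)"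
          using C2(2) N yb order_trans[OF _ mult_left_mono[OF Xb C2(1)]] by blast+
        then show ?thesis by linarith
      qed
      also have "profile y2 N 0 0 i0 - profile y1 N 0 0 i0 \<le> C3 * (r / sqrt (real N) + X)"
      proof -
        let ?V = "sqrt (D * (real N + (sg N)\<^sup>2))"
        have V: "?V \<ge> sqrt D * sqrt (real N)" "sqrt D * sqrt (real N) > 0"
          using D N1 by (auto simp: real_sqrt_mult[symmetric] intro!: mult_left_mono)
        have "profile y2 N 0 0 i0 - profile y1 N 0 0 i0 \<le> \<bar>(Y2 - mm 0 i0) / ?V - (Y1 - mm 0 i0) / ?V\<bar>"
          unfolding profile_initial Y1_def Y2_def using Phi_Lipschitz abs_le_D1 by blast
        also have "\<dots> = \<bar>Y2 - Y1\<bar> / ?V"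
          unfolding diff_divide_distrib[symmetric] abs_divide using abs_of_pos[OF less_le_trans[OF V(2) V(1)]] by simp
        also have "\<bar>Y2 - Y1\<bar> = Y2 - Y1" using Y12 by simp
        also have "(Y2 - Y1) / ?V \<le> ((3 * (c + 1) + 2 * C1) * r') / (sqrt D * sqrt (real N))"
        proof (rule frac_le)
          have "C1 * \<sigma> \<le> C1 * r'" using r' C1(1) by (intro mult_left_mono) auto
          then show "Y2 - Y1 \<le> (3 * (c + 1) + 2 * C1) * r'"
            using Yb(3) M(2) by (simp add: algebra_simps)
          show "0 \<le> (3 * (c + 1) + 2 * C1) * r'" using c C1(1) r' \<sigma> by (intro mult_nonneg_nonneg) auto
        qed (use V in auto)
        also have "\<dots> = C3 * (r' / sqrt (real N))" by (simp add: C3_def)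
        also have "\<dots> \<le> C3 * (r / sqrt (real N) + X)"
        proof (rule mult_left_mono[OF _ C30])
          have "r' / sqrt (real N) \<le> (r + \<sigma>) / sqrt (real N)" using r'(3) by (intro divide_right_mono) auto
          also have "\<dots> = r / sqrt (real N) + real N powr - (\<beta> / 2)"
            using sg_div_sqrt[OF N] by (simp add: \<sigma>_def add_divide_distrib)
          also have "real N powr - (\<beta> / 2) \<le> X"
            unfolding X_def \<gamma>'_def using N1 by (intro powr_mono le_imp_neg_le min.cobounded2)
          finally show "r' / sqrt (real N) \<le> r / sqrt (real N) + X" by simp
        qed
        finally show ?thesis .
      qed
      finally have "p0 * ?E \<le> C3 * (r / sqrt (real N) + X) + 4 * C2 * X" by simp
      also have "\<dots> \<le> C3 * (r / sqrt (real N) + X) + 4 * C2 * (r / sqrt (real N) + X)"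
        using r C2(1) by (intro add_left_mono mult_left_mono) auto
      also have "\<dots> = (C3 + 4 * C2) * (r / sqrt (real N) + X)" by (simp add: algebra_simps)
      finally have "?E \<le> (C3 + 4 * C2) / p0 * (r / sqrt (real N) + X)"
        using p0 by (simp add: field_simps)
      also have "\<dots> \<le> C * (r / sqrt (real N) + X)" using C0(2) pos by (rule mult_right_mono)
      finally show ?thesis .
    qed
    then show "?E \<le> C * (r / sqrt (real N) + real N powr - \<gamma>')" by (simp add: X_def)
  qed
  then show ?thesis using C0(1) unfolding \<gamma>'_def by (intro exI[of _ C]) auto
qed

lemma anticonc_optimal: "\<exists>C\<ge>0. anticonc C (\<beta> / 2)"
proof -
  define \<kappa> where "\<kappa> = \<beta> * (1 - \<beta>) / 4"
  have \<kappa>0: "\<kappa> \<ge> 0" using \<beta> by (simp add: \<kappa>_def)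
  have it: "\<exists>C\<ge>0. anticonc C (min (real j * \<kappa>) (\<beta> / 2))" for j
  proof (induction j)
    case 0
    then show ?case using anticonc_0 \<beta> by (intro exI[of _ 1]) simp
  next
    case (Suc j)
    then obtain C where C: "C \<ge> 0" "anticonc C (min (real j * \<kappa>) (\<beta> / 2))" by blast
    have "\<exists>C'\<ge>0. anticonc C' (min (min (real j * \<kappa>) (\<beta> / 2) + \<kappa>) (\<beta> / 2))"
      unfolding \<kappa>_def by (rule anticonc_improve) (use C \<kappa>0 \<beta> in \<open>auto simp: \<kappa>_def\<close>)
    moreover have "min (min (real j * \<kappa>) (\<beta> / 2) + \<kappa>) (\<beta> / 2) = min (real (Suc j) * \<kappa>) (\<beta> / 2)"
      using \<kappa>0 by (simp add: min_def algebra_simps)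
    ultimately show ?case by simp
  qed
  \<comment> \<open>As beta <= 1/4, one round gains at least 3 beta / 16, and three gains, 9 beta /
    16, exceed the cap beta / 2.\<close>
  have "\<beta> * (3/4) \<le> \<beta> * (1 - \<beta>)" using \<beta> by (intro mult_left_mono) auto
  then have "min (real 3 * \<kappa>) (\<beta> / 2) = \<beta> / 2" using \<beta> by (simp add: \<kappa>_def min_def)
  then show ?thesis using it[of 3] by simp
qed

text \<open>The cost of smoothing is a weight concentrated within \<open>sg N\<close> of y: away
  from y the profile is in the Gaussian tail, close to y the right side is bounded below by a
  positive constant.\<close>

lemma indicator_profile:
  "\<exists>C\<ge>0. \<forall>N y n i. N \<ge> 1 \<longrightarrow> \<bar>real_of_int y\<bar> \<le> 2 * real N \<longrightarrow>
    \<bar>of_bool (n \<le> y) - profile y N N n i\<bar> \<le> C * (1 / (1 + \<bar>real_of_int (n - y)\<bar> / sg N)\<^sup>2)"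
proof -
  obtain C1 where C1: "C1 \<ge> 1" "\<forall>N\<ge>1. \<forall>u v i. \<bar>real_of_int v\<bar> \<le> 2 * real N \<longrightarrow>
    \<bar>mm u i - mm v i1 - real_of_int (u - v)\<bar> \<le> \<bar>real_of_int (u - v)\<bar> / 2 + C1 * sg N"
    using coarse[of 2] by auto
  obtain Ct where Ct: "Ct \<ge> 1" "\<forall>u\<ge>0. 1 - Phi u \<le> Ct / (1 + u)\<^sup>2" "\<forall>u\<le>0. Phi u \<le> Ct / (1 + \<bar>u\<bar>)\<^sup>2"
    using Phi_tail by blast
  define C2 where "C2 = 1 + 2 * C1 + 2 * sqrt D"
  have C2: "C2 \<ge> 1" using C1(1) D by (simp add: C2_def)
  show ?thesis
  proof (intro exI[of _ "Ct * C2\<^sup>2"] conjI allI impI)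
    fix N y n i assume N: "1 \<le> N" and y: "\<bar>real_of_int y\<bar> \<le> 2 * real N"
    define \<sigma> where "\<sigma> = sg N"
    have \<sigma>: "\<sigma> \<ge> 1" using sg_ge_1[OF N] by (simp add: \<sigma>_def)
    define w where "w = sqrt D * \<sigma>"
    have w: "w > 0" using D \<sigma> by (simp add: w_def)
    define z where "z = (mm y i1 - mm n i) / w"
    \<comment> \<open>The sign is chosen so that positive \<open>z'\<close> means the profile is on
      the same side as the indicator. Within O(sigma) of y the value can be negative, whence
      \<open>max z' 0\<close> below.\<close>
    define z' where "z' = (if n \<le> y then z else - z)"
    define e where "e = \<bar>real_of_int (n - y)\<bar>"
    have co: "\<bar>mm n i - mm y i1 - real_of_int (n - y)\<bar> \<le> e / 2 + C1 * \<sigma>"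
      using C1(2) N y unfolding \<sigma>_def e_def by blast
    have "e / 2 - C1 * \<sigma> \<le> w * z'"
    proof (cases "n \<le> y")
      case True
      then have e1: "real_of_int (n - y) = - e" by (simp add: e_def)
      have "w * z' = mm y i1 - mm n i" using w True by (simp add: z'_def z_def)
      then show ?thesis using abs_le_D1[OF co[unfolded e1]] by linarith
    next
      case False
      then have e1: "real_of_int (n - y) = e" by (simp add: e_def)
      have "w * z' = mm n i - mm y i1" using w False by (simp add: z'_def z_def)
      then show ?thesis using abs_le_D2[OF co[unfolded e1]] by linarith
    qed
    then have "e \<le> 2 * C1 * \<sigma> + 2 * sqrt D * z' * \<sigma>" by (simp add: w_def mult_ac)
    also have "\<dots> \<le> (2 * C1 + 2 * sqrt D * max z' 0) * \<sigma>"
      using \<sigma> D by (simp add: algebra_simps mult_left_mono)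
    finally have "e / \<sigma> \<le> 2 * C1 + 2 * sqrt D * max z' 0" using \<sigma> by (simp add: divide_le_eq)
    moreover have "0 \<le> (1 + 2 * C1) * max z' 0" using C1(1) by (intro mult_nonneg_nonneg) auto
    moreover have "C2 * (1 + max z' 0) = (1 + 2 * C1 + 2 * sqrt D * max z' 0) + (1 + 2 * C1) * max z' 0 + 2 * sqrt D"
      by (simp add: C2_def algebra_simps)
    moreover have "0 \<le> sqrt D" using D by simp
    ultimately have "1 + e / \<sigma> \<le> C2 * (1 + max z' 0)" by linarith
    moreover have e0: "0 \<le> e / \<sigma>" using \<sigma> by (simp add: e_def)
    ultimately have "(1 + e / \<sigma>)\<^sup>2 \<le> (C2 * (1 + max z' 0))\<^sup>2" by (intro power_mono) auto
    then have "Ct * (1 + e / \<sigma>)\<^sup>2 \<le> Ct * (C2\<^sup>2 * (1 + max z' 0)\<^sup>2)"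
      using Ct(1) by (intro mult_left_mono) (auto simp: power_mult_distrib)
    then have 1: "Ct / (1 + max z' 0)\<^sup>2 \<le> Ct * C2\<^sup>2 * (1 / (1 + e / \<sigma>)\<^sup>2)"
    proof -
      have gen: "Ct / m \<le> Ct * c * (1 / q)" if "0 < q" "0 < m" "Ct * q \<le> Ct * (c * m)" for q m c :: real
        using that by (simp add: field_simps)
      have "0 < (1 + e / \<sigma>)\<^sup>2" "0 < (1 + max z' 0)\<^sup>2" using e0 by (auto intro!: zero_less_power add_pos_nonneg)
      then show ?thesis using gen \<open>Ct * (1 + e / \<sigma>)\<^sup>2 \<le> _\<close> by blast
    qed
    have "\<bar>of_bool (n \<le> y) - Phi z\<bar> \<le> Ct / (1 + max z' 0)\<^sup>2"
    proof (cases "z' \<ge> 0")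
      case True
      show ?thesis
      proof (cases "n \<le> y")
        case le: True
        then show ?thesis using Ct(2) True Phi_le_1[of z] by (simp add: z'_def)
      next
        case gt: False
        then have "z \<le> 0" "z' = \<bar>z\<bar>" using True by (auto simp: z'_def)
        then show ?thesis using Ct(3) gt Phi_nonneg[of z] by simp
      qed
    next
      case False
      have "\<bar>of_bool (n \<le> y) - Phi z\<bar> \<le> 1" using Phi_nonneg[of z] Phi_le_1[of z] by (cases "n \<le> y") auto
      then show ?thesis using False Ct(1) by simp
    qed
    then show "\<bar>of_bool (n \<le> y) - profile y N N n i\<bar> \<le> Ct * C2\<^sup>2 * (1 / (1 + \<bar>real_of_int (n - y)\<bar> / sg N)\<^sup>2)"
      using 1 unfolding profile_final z_def w_def \<sigma>_def e_def by linarith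
  qed (use Ct(1) in simp)
qed

text \<open>Two relative errors of order N^(-beta/2): the martingale difference replaces y, and the
  variance carries the extra sigma^2. Both are proportional to 1 + |z|, so
  \<open>Phi_perturb\<close> makes the bound uniform in y.\<close>

lemma profile_initial_close:
  "\<exists>C\<ge>0. \<forall>N y. N \<ge> 1 \<longrightarrow> \<bar>profile y N 0 0 i0 - Phi (real_of_int y / sqrt (D * real N))\<bar> \<le> C * real N powr - (\<beta> / 2)"
proof -
  obtain C1 where C1: "C1 \<ge> 1" "\<forall>N\<ge>1. \<forall>u v. \<bar>real_of_int v\<bar> \<le> 1 * real N \<longrightarrow>
     \<bar>mm u i1 - mm v i1 - real_of_int (u - v)\<bar> \<le> C1 * (\<bar>real_of_int (u - v)\<bar> + real N powr ((1 - \<beta>) / 2)) powr (1 - \<beta>)"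
    using mm_linear[of 1] by blast
  obtain Cp where Cp: "Cp \<ge> 1" "\<forall>u z \<delta>. \<bar>u - z\<bar> \<le> \<delta> * (1 + \<bar>z\<bar>) \<longrightarrow> \<bar>Phi u - Phi z\<bar> \<le> Cp * \<delta>"
    using Phi_perturb by blast
  define C2 where "C2 = (C1 + K) * ((sqrt D + 1) / sqrt D) + 1"
  have C20: "C2 \<ge> 0" using C1(1) K_nonneg D by (simp add: C2_def)
  show ?thesis
  proof (intro exI[of _ "Cp * C2"] conjI allI impI)
    fix N :: nat and y :: int assume N: "1 \<le> N"
    have N1: "real N \<ge> 1" using N by simp
    define V V' where "V = sqrt (D * real N)" and "V' = sqrt (D * (real N + (sg N)\<^sup>2))"
    define p where "p = mm y i1 - mm 0 i0"
    define yr where "yr = real_of_int y"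
    define z where "z = yr / V"
    define X where "X = real N powr - (\<beta> / 2)"
    have V: "V > 0" "V \<le> V'" using D N1 by (auto simp: V_def V'_def)
    have yz: "\<bar>yr\<bar> = \<bar>z\<bar> * V" using V by (simp add: z_def)
    have X: "0 \<le> X" "X \<le> 1" using N1 \<beta> powr_mono[of "- (\<beta> / 2)" 0 "real N"] by (auto simp: X_def)
    \<comment> \<open>Used with v = 0 and N = 1, so the smoothing scale in \<open>mm_linear\<close>
      is just 1 and y is unrestricted.\<close>
    have "\<bar>mm y i1 - mm 0 i1 - yr\<bar> \<le> C1 * (\<bar>yr\<bar> + 1) powr (1 - \<beta>)"
      using C1(2)[rule_format, of 1 0 y] by (simp add: yr_def)
    then have "\<bar>p - yr\<bar> \<le> C1 * (\<bar>yr\<bar> + 1) powr (1 - \<beta>) + K"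
      using mm_lip[of 0 0 i1 i0] unfolding p_def by linarith
    also have "\<dots> \<le> C1 * (\<bar>yr\<bar> + 1) powr (1 - \<beta>) + K * (\<bar>yr\<bar> + 1) powr (1 - \<beta>)"
      using mult_left_mono[OF ge_one_powr_ge_zero[of "\<bar>yr\<bar> + 1" "1 - \<beta>"] K_nonneg] \<beta> by simp
    also have "\<dots> = (C1 + K) * (\<bar>yr\<bar> + 1) powr (1 - \<beta>)" by (simp add: algebra_simps)
    also have "\<dots> \<le> (C1 + K) * ((1 + \<bar>z\<bar>) * (V + 1) powr (1 - \<beta>))"
    proof (intro mult_left_mono)
      have "(\<bar>yr\<bar> + 1) powr (1 - \<beta>) \<le> ((1 + \<bar>z\<bar>) * (V + 1)) powr (1 - \<beta>)"
        using V \<beta> by (intro powr_mono2) (auto simp: yz algebra_simps)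
      also have "\<dots> = (1 + \<bar>z\<bar>) powr (1 - \<beta>) * (V + 1) powr (1 - \<beta>)" using V by (simp add: powr_mult)
      also have "\<dots> \<le> (1 + \<bar>z\<bar>) powr 1 * (V + 1) powr (1 - \<beta>)" using \<beta> by (intro mult_right_mono powr_mono) auto
      finally show "(\<bar>yr\<bar> + 1) powr (1 - \<beta>) \<le> (1 + \<bar>z\<bar>) * (V + 1) powr (1 - \<beta>)" by simp
    qed (use C1(1) K_nonneg in auto)
    finally have pd: "\<bar>p - yr\<bar> \<le> (C1 + K) * ((1 + \<bar>z\<bar>) * (V + 1) powr (1 - \<beta>))" .
    have VX: "(V + 1) powr (1 - \<beta>) / V \<le> (sqrt D + 1) / sqrt D * X"
    proof -
      have "V + 1 \<le> (sqrt D + 1) * sqrt (real N)"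
        using N1 D by (simp add: V_def real_sqrt_mult algebra_simps)
      then have "(V + 1) powr (1 - \<beta>) \<le> ((sqrt D + 1) * sqrt (real N)) powr (1 - \<beta>)"
        using V \<beta> by (intro powr_mono2) auto
      also have "\<dots> = (sqrt D + 1) powr (1 - \<beta>) * sg N"
        using D N1 by (simp add: powr_mult sqrt_powr sg_def)
      also have "\<dots> \<le> (sqrt D + 1) powr 1 * sg N"
        using D \<beta> sg_ge_1[OF N] by (intro mult_right_mono powr_mono) auto
      finally have "(V + 1) powr (1 - \<beta>) / V \<le> ((sqrt D + 1) * sg N) / V"
        using V D by (intro divide_right_mono) auto
      also have "\<dots> = (sqrt D + 1) / sqrt D * (sg N / sqrt (real N))" by (simp add: V_def real_sqrt_mult)
      finally show ?thesis unfolding sg_div_sqrt[OF N] X_def .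
    qed
    have t1: "\<bar>p - yr\<bar> / V' \<le> (C1 + K) * ((sqrt D + 1) / sqrt D) * X * (1 + \<bar>z\<bar>)"
    proof -
      have "\<bar>p - yr\<bar> / V' \<le> ((C1 + K) * ((1 + \<bar>z\<bar>) * (V + 1) powr (1 - \<beta>))) / V"
        using V pd by (intro frac_le) (auto intro: order_trans[OF abs_ge_zero])
      also have "\<dots> = (C1 + K) * (1 + \<bar>z\<bar>) * ((V + 1) powr (1 - \<beta>) / V)" by simp
      also have "\<dots> \<le> (C1 + K) * (1 + \<bar>z\<bar>) * ((sqrt D + 1) / sqrt D * X)"
        using C1(1) K_nonneg by (intro mult_left_mono VX mult_nonneg_nonneg) auto
      finally show ?thesis by (simp only: mult_ac)
    qed
    have t2: "\<bar>yr / V' - z\<bar> \<le> \<bar>z\<bar> * X"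
    proof -
      \<comment> \<open>Since sigma^2 = N X^2, the factor is sqrt (1 + X^2), which is at most 1 +
        X.\<close>
      have "V' \<le> V * (1 + X)"
      proof -
        have "(sg N)\<^sup>2 = real N * X\<^sup>2"
          using sg_div_sqrt[OF N] N1 by (simp add: X_def[symmetric] field_simps power_mult_distrib)
        then have "D * (real N + (sg N)\<^sup>2) = V\<^sup>2 * (1 + X\<^sup>2)" using D N1 by (simp add: V_def algebra_simps)
        also have "\<dots> \<le> V\<^sup>2 * (1 + X)\<^sup>2" using X by (intro mult_left_mono) (auto simp: power2_eq_square algebra_simps)
        finally have "V' \<le> sqrt ((V * (1 + X))\<^sup>2)" unfolding V'_def by (simp add: power_mult_distrib)
        then show ?thesis using V X by simp
      qed
      then have "V' - V \<le> V' * X" using V X mult_right_mono[of V V' X] by (simp add: algebra_simps)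
      then have "(V' - V) / V' \<le> X" using V by (simp add: divide_le_eq mult.commute)
      moreover have "\<bar>yr / V' - z\<bar> = \<bar>z\<bar> * ((V' - V) / V')"
      proof -
        have "yr / V' - z = - (z * ((V' - V) / V'))" using V by (simp add: z_def field_simps)
        then show ?thesis using V by (simp add: abs_mult)
      qed
      ultimately show ?thesis by (metis mult_left_mono abs_ge_zero)
    qed
    have "\<bar>p / V' - z\<bar> \<le> \<bar>p - yr\<bar> / V' + \<bar>yr / V' - z\<bar>"
    proof -
      have "p / V' - z = (p - yr) / V' + (yr / V' - z)" by (simp add: diff_divide_distrib)
      then show ?thesis using V abs_triangle_ineq[of "(p - yr) / V'" "yr / V' - z"] by simp
    qed
    also have "\<dots> \<le> (C1 + K) * ((sqrt D + 1) / sqrt D) * X * (1 + \<bar>z\<bar>) + X * (1 + \<bar>z\<bar>)"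
      using t1 t2 X by (intro add_mono) (auto simp: algebra_simps)
    also have "\<dots> = (C2 * X) * (1 + \<bar>z\<bar>)" by (simp add: C2_def algebra_simps)
    finally have "\<bar>Phi (p / V') - Phi z\<bar> \<le> Cp * (C2 * X)" using Cp(2) by blast
    then show "\<bar>profile y N 0 0 i0 - Phi (real_of_int y / sqrt (D * real N))\<bar> \<le> Cp * C2 * real N powr - (\<beta> / 2)"
      by (simp add: profile_initial p_def V'_def z_def yr_def V_def X_def)
  qed (use Cp(1) C20 in simp)
qed

text \<open>For integer thresholds within 2 N, three comparisons are chained: indicator with final
  profile, final with initial profile, initial profile with \<open>Phi\<close>. The optimal
  anticoncentration makes each of them O(N^(-beta/2)).\<close>

lemma walk_cdf_rate:
  "\<exists>C\<ge>0. \<forall>N\<ge>1. \<forall>x. \<bar>walk_cdf P Q R i0 N (x * sqrt (D * real N)) - Phi x\<bar> \<le> C * real N powr - (\<beta> / 2)"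
proof -
  obtain Ca where Ca: "Ca \<ge> 0" "anticonc Ca (\<beta> / 2)" using anticonc_optimal by blast
  obtain C1 where C1: "C1 \<ge> 0" "\<forall>N\<ge>1. \<forall>y. \<bar>real_of_int y\<bar> \<le> 2 * real N \<longrightarrow>
    \<bar>Ex N (profile y N N) - profile y N 0 0 i0\<bar> \<le> C1 * (real N powr - (\<beta> / 2) + real N powr - (\<beta> / 2 + \<beta> * (1 - \<beta>) / 4))"
    using smooth_comparison[of 2, OF _ Ca(2,1)] \<beta> by auto
  obtain C2 where C2: "C2 \<ge> 0" "\<forall>N y n i. N \<ge> 1 \<longrightarrow> \<bar>real_of_int y\<bar> \<le> 2 * real N \<longrightarrow>
    \<bar>of_bool (n \<le> y) - profile y N N n i\<bar> \<le> C2 * (1 / (1 + \<bar>real_of_int (n - y)\<bar> / sg N)\<^sup>2)"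
    using indicator_profile by blast
  obtain C3 where C3: "C3 \<ge> 0" "\<forall>N y. N \<ge> 1 \<longrightarrow> \<bar>profile y N 0 0 i0 - Phi (real_of_int y / sqrt (D * real N))\<bar> \<le> C3 * real N powr - (\<beta> / 2)"
    using profile_initial_close by blast
  define C where "C = 2 * C1 + C2 * (16 * Ca) + C3 + 1 / sqrt D"
  have C0: "C \<ge> 0" using C1(1) C2(1) C3(1) Ca(1) D by (simp add: C_def)
  show ?thesis
  proof (intro exI[of _ C] conjI[OF C0] allI impI)
    fix N :: nat and x :: real assume N: "1 \<le> N"
    have N1: "real N \<ge> 1" using N by simp
    define X where "X = real N powr - (\<beta> / 2)"
    define V where "V = sqrt (D * real N)"
    define F where "F = (\<lambda>y::int. Ex N (\<lambda>n i. of_bool (n \<le> y)))"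
    have V: "V > 0" using D N1 by (simp add: V_def)
    have X0: "X \<ge> 0" by (simp add: X_def)
    have main: "\<bar>F y - Phi (real_of_int y / V)\<bar> \<le> (2 * C1 + C2 * (16 * Ca) + C3) * X" if y: "\<bar>real_of_int y\<bar> \<le> 2 * real N" for y
    proof -
      have "\<bar>F y - Ex N (profile y N N)\<bar> \<le> C2 * (16 * Ca) * X"
      proof -
        have "\<bar>F y - Ex N (profile y N N)\<bar> \<le> Ex N (\<lambda>n i. C2 * (1 / (1 + \<bar>real_of_int (n - y)\<bar> / sg N)\<^sup>2))"
          unfolding F_def Ex_diff[symmetric] by (rule Ex_abs_le) (use C2(2) N y in blast)
        also have "\<dots> \<le> C2 * (8 * Ca * (sg N / sqrt (real N) + real N powr - (\<beta> / 2)))"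
          unfolding Ex_cmult using anticonc_weight[OF Ca(2,1) N] sg_ge_1[OF N] C2(1) by (intro mult_left_mono) auto
        also have "\<dots> = C2 * (16 * Ca) * X" unfolding sg_div_sqrt[OF N] X_def by simp
        finally show ?thesis .
      qed
      moreover have "\<bar>Ex N (profile y N N) - profile y N 0 0 i0\<bar> \<le> 2 * C1 * X"
      proof -
        have "0 \<le> \<beta> * (1 - \<beta>)" using \<beta> by simp
        then have "real N powr - (\<beta> / 2 + \<beta> * (1 - \<beta>) / 4) \<le> X" unfolding X_def using N1 by (intro powr_mono) auto
        then have "C1 * (real N powr - (\<beta> / 2) + real N powr - (\<beta> / 2 + \<beta> * (1 - \<beta>) / 4)) \<le> C1 * (X + X)"
          using C1(1) by (intro mult_left_mono) (auto simp: X_def)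
        then show ?thesis using order_trans[OF C1(2)[rule_format, OF N y]] by simp
      qed
      moreover have "\<bar>profile y N 0 0 i0 - Phi (real_of_int y / V)\<bar> \<le> C3 * X"
        using C3(2) N unfolding X_def V_def by blast
      ultimately have "\<bar>F y - Phi (real_of_int y / V)\<bar> \<le> C2 * (16 * Ca) * X + 2 * C1 * X + C3 * X" by linarith
      then show ?thesis by (simp add: algebra_simps)
    qed
    have CX: "(2 * C1 + C2 * (16 * Ca) + C3) * X \<le> C * X"
      using X0 D by (intro mult_right_mono) (auto simp: C_def)
    \<comment> \<open>The walk is integer valued, so rounding the threshold leaves its distribution
      function unchanged and moves the argument of \<open>Phi\<close> by at most 1 / V.\<close>
    define y where "y = \<lfloor>x * V\<rfloor>"
    have yx: "real_of_int y \<le> x * V" "x * V < real_of_int y + 1" unfolding y_def by linarith+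
    have Fy: "walk_cdf P Q R i0 N (x * sqrt (D * real N)) = F y"
      unfolding walk_cdf_eq F_def y_def V_def[symmetric] le_floor_iff ..
    have Fone: "F u = 1" if "u \<ge> int N" for u
    proof -
      have "F u = Ex N (\<lambda>n i. 1)" unfolding F_def
        by (intro antisym Ex_mono) (use that in auto)
      then show ?thesis by (simp add: Ex_const)
    qed
    have Fzero: "F u = 0" if "u < - int N" for u
    proof -
      have "F u = Ex N (\<lambda>n i. 0)" unfolding F_def
        by (intro antisym Ex_mono) (use that in auto)
      then show ?thesis by (simp add: Ex_const)
    qed
    \<comment> \<open>Beyond the range of the walk its distribution function is 0 or 1, and
      \<open>Phi x\<close> is squeezed by monotonicity using \<open>main\<close> at N or at -N - 1.
      In the remaining case |y| <= N + 1 <= 2 N.\<close>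
    consider "y > int N" | "y < - int N - 1" | "\<bar>y\<bar> \<le> int N + 1" by linarith
    then have "\<bar>F y - Phi x\<bar> \<le> C * X"
    proof cases
      case 1
      have "real N \<le> x * V" using 1 yx by linarith
      then have "Phi (real N / V) \<le> Phi x" using V by (intro Phi_mono) (simp add: divide_le_eq)
      moreover have "1 - Phi (real N / V) \<le> (2 * C1 + C2 * (16 * Ca) + C3) * X"
        using main[of "int N"] Fone[of "int N"] by simp
      ultimately show ?thesis using Fone[of y] 1 Phi_le_1[of x] CX by simp
    next
      case 2
      have "x * V \<le> - real N - 1" using 2 yx by linarith
      then have "Phi x \<le> Phi ((- real N - 1) / V)" using V by (intro Phi_mono) (simp add: le_divide_eq)
      moreover have "Phi ((- real N - 1) / V) \<le> (2 * C1 + C2 * (16 * Ca) + C3) * X"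
        using main[of "- int N - 1"] Fzero[of "- int N - 1"] N1 by simp
      ultimately show ?thesis using Fzero[of y] 2 Phi_nonneg[of x] CX by simp
    next
      case 3
      have "\<bar>Phi (real_of_int y / V) - Phi x\<bar> \<le> \<bar>real_of_int y / V - x\<bar>" by (rule Phi_Lipschitz)
      also have "\<dots> = \<bar>real_of_int y - x * V\<bar> / V" using V by (simp add: field_simps)
      also have "\<dots> \<le> 1 / V" using yx V by (intro divide_right_mono) auto
      also have "\<dots> = 1 / sqrt D * (real N powr - (1/2))"
        using N1 by (simp add: V_def real_sqrt_mult powr_minus_divide powr_half_sqrt)
      also have "\<dots> \<le> 1 / sqrt D * X"
        unfolding X_def using D N1 \<beta> by (intro mult_left_mono powr_mono) auto
      finally have "\<bar>Phi (real_of_int y / V) - Phi x\<bar> \<le> 1 / sqrt D * X" .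
      moreover have "\<bar>F y - Phi (real_of_int y / V)\<bar> \<le> (2 * C1 + C2 * (16 * Ca) + C3) * X"
        by (rule main) (use 3 N1 in linarith)
      ultimately have "\<bar>F y - Phi x\<bar> \<le> (2 * C1 + C2 * (16 * Ca) + C3) * X + 1 / sqrt D * X" by linarith
      then show ?thesis by (simp add: C_def algebra_simps)
    qed
    then show "\<bar>walk_cdf P Q R i0 N (x * sqrt (D * real N)) - Phi x\<bar> \<le> C * real N powr - (\<beta> / 2)"
      unfolding Fy X_def .
  qed
qed

end

section \<open>Matrices of an elliptic strip\<close>

lemma matrix_vector_nth: "(A *v x) $ i = (\<Sum>j\<in>UNIV. A $ i $ j * x $ j)"
  by (simp add: matrix_vector_mult_def)

lemma vector_matrix_nth:
  fixes x :: "real^'m" and A :: "real^'n^'m"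
  shows "(x v* A) $ j = (\<Sum>i\<in>UNIV. A $ i $ j * x $ i)"
  by (simp add: vector_matrix_mult_def mult.commute)

definition ones :: "real^'m" where "ones = (\<chi> i. 1)"

lemma ones_nth [simp]: "ones $ i = 1" by (simp add: ones_def)

lemma nonneg_matrix_mono:
  fixes A :: "real^'m^'m"
  assumes "\<And>i j. 0 \<le> A $ i $ j" "\<And>j. x $ j \<le> y $ j"
  shows "(A *v x) $ i \<le> (A *v y) $ i"
  unfolding matrix_vector_nth by (intro sum_mono mult_left_mono assms)

lemma nonneg_matrix_abs_le:
  fixes A :: "real^'m^'m"
  assumes "\<And>i j. 0 \<le> A $ i $ j" "\<And>j. \<bar>x $ j\<bar> \<le> B"
  shows "\<bar>(A *v x) $ i\<bar> \<le> (A *v ones) $ i * B"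
  unfolding matrix_vector_nth sum_distrib_right ones_nth mult_1_right
  by (rule order_trans[OF sum_abs]) (use assms in \<open>auto intro!: sum_mono mult_left_mono simp: abs_mult\<close>)

text \<open>The next two lemmas replace the Neumann series for \<open>(I - B)\<^sup>-\<^sup>1\<close>.\<close>

lemma contraction_bound:
  fixes B :: "real^'m^'m"
  assumes B: "\<And>i j. 0 \<le> B $ i $ j" "\<And>i. (B *v ones) $ i \<le> 1 - \<theta>" and \<theta>: "\<theta> > 0"
    and x: "x = B *v x + y" and y: "\<And>i. \<bar>y $ i\<bar> \<le> b"
  shows "\<bar>x $ i\<bar> \<le> b / \<theta>"
proof -
  define \<mu> where "\<mu> = Max (range (\<lambda>i. \<bar>x $ i\<bar>))"
  have le: "\<bar>x $ i\<bar> \<le> \<mu>" for i unfolding \<mu>_def by (rule Max_ge) auto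
  have "\<mu> \<in> range (\<lambda>i. \<bar>x $ i\<bar>)" unfolding \<mu>_def by (rule Max_in) auto
  then obtain k where k: "\<mu> = \<bar>x $ k\<bar>" by blast
  have mu0: "0 \<le> \<mu>" using k by simp
  have "\<bar>(B *v x) $ k\<bar> \<le> (B *v ones) $ k * \<mu>" by (rule nonneg_matrix_abs_le[OF B(1) le])
  also have "\<dots> \<le> (1 - \<theta>) * \<mu>" by (rule mult_right_mono[OF B(2) mu0])
  finally have "\<bar>(B *v x) $ k\<bar> \<le> (1 - \<theta>) * \<mu>" .
  moreover have "x $ k = (B *v x) $ k + y $ k" using arg_cong[OF x, of "\<lambda>v. v $ k"] by simp
  ultimately have "\<mu> \<le> (1 - \<theta>) * \<mu> + b" using k y[of k] by linarith
  then have "\<mu> \<le> b / \<theta>" using \<theta> by (simp add: field_simps)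
  then show ?thesis using le[of i] by linarith
qed

lemma contraction_nonneg:
  fixes B :: "real^'m^'m"
  assumes B: "\<And>i j. 0 \<le> B $ i $ j" "\<And>i. (B *v ones) $ i \<le> 1 - \<theta>" and \<theta>: "\<theta> > 0"
    and x: "x = B *v x + y" and y: "\<And>i. 0 \<le> y $ i"
  shows "0 \<le> x $ i"
proof -
  define \<mu> where "\<mu> = Min (range (\<lambda>i. x $ i))"
  have le: "\<mu> \<le> x $ i" for i unfolding \<mu>_def by (rule Min_le) auto
  have "\<mu> \<in> range (\<lambda>i. x $ i)" unfolding \<mu>_def by (rule Min_in) auto
  then obtain k where k: "\<mu> = x $ k" by blast
  have "\<mu> \<ge> 0"
  proof (rule ccontr)
    assume neg: "\<not> \<mu> \<ge> 0"
    have "(B *v (\<mu> *s ones)) $ k \<le> (B *v x) $ k"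
      by (rule nonneg_matrix_mono[OF B(1)]) (use le in simp)
    moreover have "(B *v (\<mu> *s ones)) $ k = \<mu> * (B *v ones) $ k"
      by (simp add: matrix_vector_nth sum_distrib_left mult.commute)
    moreover have "\<mu> * (1 - \<theta>) \<le> \<mu> * (B *v ones) $ k" using neg B(2)[of k] by (intro mult_left_mono_neg) auto
    moreover have "x $ k = (B *v x) $ k + y $ k" using arg_cong[OF x, of "\<lambda>v. v $ k"] by simp
    ultimately have "\<mu> * (1 - \<theta>) \<le> \<mu>" using k y[of k] by linarith
    then have "0 \<le> \<mu> * \<theta>" by (simp add: algebra_simps)
    then show False using neg \<theta> by (simp add: zero_le_mult_iff)
  qed
  then show ?thesis using le[of i] by linarith
qed

lemma invertible_if_kernel_trivial:
  fixes A :: "real^'m^'m"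
  assumes "\<And>x. A *v x = 0 \<Longrightarrow> x = 0"
  shows "invertible A"
  using assms matrix_left_invertible_ker[of A] unfolding invertible_left_inverse by blast

lemma
  fixes A :: "real^'m^'m"
  assumes "invertible A"
  shows matrix_inv_right: "A ** matrix_inv A = mat 1" and matrix_inv_left: "matrix_inv A ** A = mat 1"
  using someI_ex[OF assms[unfolded invertible_def]] by (simp_all add: matrix_inv_def)

lemma inverse_solves:
  fixes A :: "real^'m^'m"
  assumes "invertible A"
  shows "A *v (matrix_inv A *v y) = y" "matrix_inv A *v (A *v x) = x"
  using matrix_inv_right[OF assms] matrix_inv_left[OF assms] by (simp_all add: matrix_vector_mul_assoc)

text \<open>The only consequence of the operator norm that is used: it dominates row sums. The
  supremum is an upper bound only once the set is known to be bounded, which the sum of all absolute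
  entries shows.\<close>

lemma mnorm_ones:
  fixes A :: "real^'m^'m"
  shows "(A *v ones) $ i \<le> mnorm A"
proof -
  define S where "S = {vnorm (A *v x) | x. vnorm x \<le> 1}"
  have vn: "\<bar>x $ i\<bar> \<le> vnorm x" for x :: "real^'m" and i unfolding vnorm_def by (rule Max_ge) auto
  have vle: "vnorm x \<le> b" if "\<And>i. \<bar>x $ i\<bar> \<le> b" for x :: "real^'m" and b
    unfolding vnorm_def using that by (subst Max_le_iff) auto
  have "bdd_above S"
    unfolding bdd_above_def S_def
  proof (intro exI ballI)
    fix z assume "z \<in> {vnorm (A *v x) |x. vnorm x \<le> 1}"
    then obtain x where x: "z = vnorm (A *v x)" "vnorm x \<le> 1" by blast
    show "z \<le> (\<Sum>i\<in>UNIV. \<Sum>j\<in>UNIV. \<bar>A $ i $ j\<bar>)"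
      unfolding x(1)
    proof (rule vle)
      fix i
      have "\<bar>(A *v x) $ i\<bar> \<le> (\<Sum>j\<in>UNIV. \<bar>A $ i $ j\<bar>)"
        unfolding matrix_vector_nth
      proof (rule order_trans[OF sum_abs sum_mono])
        fix j show "\<bar>A $ i $ j * x $ j\<bar> \<le> \<bar>A $ i $ j\<bar>"
          using order_trans[OF vn x(2)] by (simp add: abs_mult mult_left_le)
      qed
      also have "\<dots> \<le> (\<Sum>i\<in>UNIV. \<Sum>j\<in>UNIV. \<bar>A $ i $ j\<bar>)"
        by (rule member_le_sum[of i UNIV "\<lambda>i. \<Sum>j\<in>UNIV. \<bar>A $ i $ j\<bar>"]) (auto intro: sum_nonneg)
      finally show "\<bar>(A *v x) $ i\<bar> \<le> (\<Sum>i\<in>UNIV. \<Sum>j\<in>UNIV. \<bar>A $ i $ j\<bar>)" .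
    qed
  qed
  moreover have "vnorm (A *v ones) \<in> S" unfolding S_def using vle[of ones 1] by auto
  ultimately have "vnorm (A *v ones) \<le> mnorm A" unfolding mnorm_def S_def[symmetric] by (intro cSup_upper)
  then show ?thesis using vn[of "A *v ones" i] by linarith
qed

section \<open>Resolvents of a layer and the limit \<open>zeta\<close>\<close>

locale elliptic_strip = strip_walk P Q R i0 for P Q R :: "int \<Rightarrow> real^'m^'m" and i0 :: 'm +
  fixes eps :: real and k0 :: nat
  assumes eps: "eps > 0"
    and R_pow: "\<And>n. mnorm (matpow (R n) k0) \<le> 1 - eps"
    and NP_ge: "\<And>n i j. (matrix_inv (mat 1 - R n) ** P n) $ i $ j \<ge> eps"
    and NQ_ge: "\<And>n i j. (matrix_inv (mat 1 - R n) ** Q n) $ i $ j \<ge> eps"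
begin

lemma rowsum_ones: "P n *v ones + Q n *v ones + R n *v ones = ones"
  by (simp add: vec_eq_iff matrix_vector_nth sum.distrib[symmetric] rowsum)

lemma R_ones_le: "(R n *v ones) $ i \<le> 1"
proof -
  have "(P n *v ones) $ i + (Q n *v ones) $ i + (R n *v ones) $ i = 1"
    using arg_cong[OF rowsum_ones[of n], of "\<lambda>v. v $ i"] by simp
  moreover have "0 \<le> (P n *v ones) $ i" "0 \<le> (Q n *v ones) $ i"
    by (auto simp: matrix_vector_nth intro!: sum_nonneg P_nonneg Q_nonneg)
  ultimately show ?thesis by linarith
qed

lemma matpow_R_nonneg: "0 \<le> matpow (R n) k $ i $ j"
  by (induction k arbitrary: i j) (auto simp: mat_def matrix_matrix_mult_def intro!: sum_nonneg mult_nonneg_nonneg R_nonneg)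

text \<open>Unrolling the equation k times, since ellipticity makes only the power \<open>k0\<close>
  of R a contraction. The remainder s is the sum of R^j y over j < k, which explains both its size
  and its sign.\<close>

lemma R_iterate:
  assumes x: "x = R n *v x + y" and y: "\<And>i. \<bar>y $ i\<bar> \<le> b"
  shows "\<exists>s. x = matpow (R n) k *v x + s \<and> (\<forall>i. \<bar>s $ i\<bar> \<le> real k * b) \<and> ((\<forall>i. 0 \<le> y $ i) \<longrightarrow> (\<forall>i. 0 \<le> s $ i))"
proof (induction k)
  case 0
  show ?case by (intro exI[of _ 0]) simp
next
  case (Suc k)
  then obtain s where s: "x = matpow (R n) k *v x + s" "\<forall>i. \<bar>s $ i\<bar> \<le> real k * b" "(\<forall>i. 0 \<le> y $ i) \<longrightarrow> (\<forall>i. 0 \<le> s $ i)" by blast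
  have b0: "0 \<le> b" using y[of undefined] by linarith
  have "x = R n *v (matpow (R n) k *v x + s) + y" using x s(1) by simp
  also have "\<dots> = matpow (R n) (Suc k) *v x + (R n *v s + y)"
    by (simp add: matrix_vector_right_distrib matrix_vector_mul_assoc add.assoc)
  finally have "x = matpow (R n) (Suc k) *v x + (R n *v s + y)" .
  moreover have "\<bar>(R n *v s + y) $ i\<bar> \<le> real (Suc k) * b" for i
  proof -
    have "\<bar>(R n *v s) $ i\<bar> \<le> (R n *v ones) $ i * (real k * b)"
      by (rule nonneg_matrix_abs_le[OF R_nonneg]) (use s in blast)
    also have "\<dots> \<le> 1 * (real k * b)" using b0 by (intro mult_right_mono R_ones_le) auto
    finally have "\<bar>(R n *v s) $ i\<bar> \<le> real k * b" by simp
    then show ?thesis using y[of i] by (simp add: algebra_simps)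
  qed
  moreover have "0 \<le> (R n *v s + y) $ i" if "\<forall>i. 0 \<le> y $ i" for i
    using s(3) that by (auto simp: matrix_vector_nth intro!: add_nonneg_nonneg sum_nonneg mult_nonneg_nonneg R_nonneg)
  ultimately show ?case by blast
qed

lemma R_resolvent_bound:
  assumes x: "x = R n *v x + y" and y: "\<And>i. \<bar>y $ i\<bar> \<le> b"
  shows "\<bar>x $ i\<bar> \<le> real k0 * b / eps"
proof -
  obtain s where s: "x = matpow (R n) k0 *v x + s" "\<And>i. \<bar>s $ i\<bar> \<le> real k0 * b" using R_iterate[OF x y, where k = k0] by blast
  show ?thesis
    by (rule contraction_bound[OF matpow_R_nonneg _ eps s]) (use mnorm_ones R_pow order_trans in blast)
qed

lemma R_resolvent_nonneg:
  assumes x: "x = R n *v x + y" and y: "\<And>i. 0 \<le> y $ i"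
  shows "0 \<le> x $ i"
proof -
  have "\<bar>y $ i\<bar> \<le> (\<Sum>j\<in>UNIV. \<bar>y $ j\<bar>)" for i by (rule member_le_sum) auto
  then obtain s where s: "x = matpow (R n) k0 *v x + s" "\<And>i. 0 \<le> s $ i" using R_iterate[OF x, where k = k0] y by blast
  show ?thesis
    by (rule contraction_nonneg[OF matpow_R_nonneg _ eps s]) (use mnorm_ones R_pow order_trans in blast)
qed

lemma invertible_R: "invertible (mat 1 - R n)"
proof (rule invertible_if_kernel_trivial)
  fix x assume "(mat 1 - R n) *v x = 0"
  then have x: "x = R n *v x + 0" by (simp add: matrix_vector_mult_diff_rdistrib)
  have "\<bar>x $ i\<bar> \<le> real k0 * 0 / eps" for i by (rule R_resolvent_bound[OF x]) simp
  then show "x = 0" by (simp add: vec_eq_iff)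
qed

definition NR :: "int \<Rightarrow> real^'m^'m" where "NR n = matrix_inv (mat 1 - R n)"

lemma NR_eq: "NR n *v y = R n *v (NR n *v y) + y"
  using inverse_solves(1)[OF invertible_R, of n y] unfolding NR_def
  by (simp add: matrix_vector_mult_diff_rdistrib algebra_simps)

lemma NR_nonneg: "(\<And>i. 0 \<le> y $ i) \<Longrightarrow> 0 \<le> (NR n *v y) $ i"
  by (rule R_resolvent_nonneg[OF NR_eq])

lemma NR_bound: "(\<And>i. \<bar>y $ i\<bar> \<le> b) \<Longrightarrow> \<bar>(NR n *v y) $ i\<bar> \<le> real k0 * b / eps"
  by (rule R_resolvent_bound[OF NR_eq])

text \<open>Conservation of probability: the row sums of \<open>NR n ** P n\<close> and
  \<open>NR n ** Q n\<close> add up to 1, and the former is at least eps.\<close>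

lemma NQ_ones_le: "((NR n ** Q n) *v ones) $ i \<le> 1 - eps"
proof -
  have "(mat 1 - R n) *v ones = P n *v ones + Q n *v ones"
    using rowsum_ones[of n] by (simp add: matrix_vector_mult_diff_rdistrib algebra_simps)
  then have "NR n *v (P n *v ones + Q n *v ones) = ones"
    using inverse_solves(2)[OF invertible_R, of n ones] unfolding NR_def by simp
  then have "(NR n ** P n) *v ones + (NR n ** Q n) *v ones = ones"
    by (simp add: matrix_vector_right_distrib matrix_vector_mul_assoc)
  then have "((NR n ** P n) *v ones) $ i + ((NR n ** Q n) *v ones) $ i = 1"
    by (metis ones_nth vector_add_component)
  moreover have "eps \<le> ((NR n ** P n) *v ones) $ i"
  proof -
    have "(NR n ** P n) $ i $ i \<le> (\<Sum>j\<in>UNIV. (NR n ** P n) $ i $ j)"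
      by (rule member_le_sum) (use NP_ge eps in \<open>auto simp: NR_def intro: order_trans[OF less_imp_le[OF eps]]\<close>)
    then show ?thesis using NP_ge[of n i i] by (simp add: matrix_vector_nth NR_def)
  qed
  ultimately show ?thesis by linarith
qed

text \<open>With returns from layer n - 1 distributed by \<open>\<psi>\<close>, the inverse of this
  matrix is the Green function of layer n for the walk stopped on reaching layer n + 1.\<close>

definition IS :: "int \<Rightarrow> real^'m^'m \<Rightarrow> real^'m^'m" where "IS n \<psi> = mat 1 - R n - Q n ** \<psi>"

lemma IS_apply: "IS n \<psi> *v x = x - R n *v x - Q n *v (\<psi> *v x)"
  by (simp add: IS_def matrix_vector_mult_diff_rdistrib matrix_vector_mul_assoc)

lemma stochastic_ones: "stochastic \<psi> \<Longrightarrow> \<psi> *v ones = ones"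
  by (simp add: stochastic_def vec_eq_iff matrix_vector_nth)

lemma NQpsi:
  assumes "stochastic \<psi>"
  shows "0 \<le> (NR n ** Q n ** \<psi>) $ i $ j" "((NR n ** Q n ** \<psi>) *v ones) $ i \<le> 1 - eps"
proof -
  have q: "0 \<le> (NR n ** Q n) $ i $ j" for i j using NQ_ge[of n i j] eps by (simp add: NR_def)
  then show "0 \<le> (NR n ** Q n ** \<psi>) $ i $ j"
    using assms unfolding stochastic_def matrix_matrix_mult_def[of _ \<psi>] by (simp add: sum_nonneg)
  show "((NR n ** Q n ** \<psi>) *v ones) $ i \<le> 1 - eps"
    unfolding matrix_vector_mul_assoc[symmetric] stochastic_ones[OF assms]
    using NQ_ones_le by (simp add: matrix_vector_mul_assoc)
qed

text \<open>Preconditioning by \<open>NR n\<close> turns the equation into a fixed point problem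
  whose matrix has row sums at most 1 - eps, in one step rather than \<open>k0\<close>.
  Invertibility, positivity and bounds then follow from the two contraction lemmas.\<close>

lemma IS_fixpoint:
  assumes "IS n \<psi> *v x = y"
  shows "x = (NR n ** Q n ** \<psi>) *v x + NR n *v y"
proof -
  have "(mat 1 - R n) *v x = Q n *v (\<psi> *v x) + y"
    using assms unfolding IS_apply by (simp add: matrix_vector_mult_diff_rdistrib algebra_simps)
  then have "x = NR n *v (Q n *v (\<psi> *v x) + y)"
    using inverse_solves(2)[OF invertible_R, of n x] unfolding NR_def by simp
  then show ?thesis by (simp add: matrix_vector_right_distrib matrix_vector_mul_assoc matrix_mul_assoc)
qed

lemma invertible_IS:
  assumes "stochastic \<psi>"
  shows "invertible (IS n \<psi>)"
proof (rule invertible_if_kernel_trivial)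
  fix x assume "IS n \<psi> *v x = 0"
  from IS_fixpoint[OF this] have x: "x = (NR n ** Q n ** \<psi>) *v x + 0" by simp
  have "\<bar>x $ i\<bar> \<le> 0 / eps" for i by (rule contraction_bound[OF NQpsi[OF assms] eps x]) simp
  then show "x = 0" by (simp add: vec_eq_iff)
qed

lemma IS_inv_eq:
  assumes "stochastic \<psi>"
  shows "matrix_inv (IS n \<psi>) *v y = (NR n ** Q n ** \<psi>) *v (matrix_inv (IS n \<psi>) *v y) + NR n *v y"
  by (rule IS_fixpoint) (rule inverse_solves(1)[OF invertible_IS[OF assms]])

text \<open>On nonnegative vectors the inverse dominates \<open>NR n\<close>, as the fixed point
  equation only adds a nonnegative term. Lower bounds assumed for \<open>NR n\<close> times P and Q
  are inherited this way.\<close>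

lemma IS_inv_ge:
  assumes "stochastic \<psi>" "\<And>i. 0 \<le> y $ i"
  shows "(NR n *v y) $ i \<le> (matrix_inv (IS n \<psi>) *v y) $ i" "0 \<le> (matrix_inv (IS n \<psi>) *v y) $ i"
proof -
  let ?x = "matrix_inv (IS n \<psi>) *v y"
  have nn: "0 \<le> ?x $ i" for i
    by (rule contraction_nonneg[OF NQpsi[OF assms(1)] eps IS_inv_eq[OF assms(1)]]) (rule NR_nonneg[OF assms(2)])
  then show "0 \<le> ?x $ i" .
  have "0 \<le> ((NR n ** Q n ** \<psi>) *v ?x) $ i"
    unfolding matrix_vector_nth[of "NR n ** Q n ** \<psi>"] by (intro sum_nonneg mult_nonneg_nonneg NQpsi[OF assms(1)] nn)
  then show "(NR n *v y) $ i \<le> ?x $ i"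
    using arg_cong[OF IS_inv_eq[OF assms(1), of n y], of "\<lambda>v. v $ i"] by simp
qed

lemma IS_inv_bound:
  assumes "stochastic \<psi>" "\<And>i. \<bar>y $ i\<bar> \<le> b"
  shows "\<bar>(matrix_inv (IS n \<psi>) *v y) $ i\<bar> \<le> real k0 / eps\<^sup>2 * b"
proof -
  have "\<bar>(matrix_inv (IS n \<psi>) *v y) $ i\<bar> \<le> (real k0 * b / eps) / eps"
    by (rule contraction_bound[OF NQpsi[OF assms(1)] eps IS_inv_eq[OF assms(1)]]) (rule NR_bound[OF assms(2)])
  then show ?thesis by (simp add: power2_eq_square)
qed

lemma matrix_mult_axis: "(A ** B) $ i $ j = (A *v (\<chi> k. B $ k $ j)) $ i"
  by (simp add: matrix_matrix_mult_def matrix_vector_nth)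

lemma IS_inv_mult_ge:
  assumes "stochastic \<psi>"
  shows "eps \<le> (matrix_inv (IS n \<psi>) ** P n) $ i $ j" "eps \<le> (matrix_inv (IS n \<psi>) ** Q n) $ i $ j"
proof -
  show "eps \<le> (matrix_inv (IS n \<psi>) ** P n) $ i $ j"
    using IS_inv_ge(1)[OF assms, of "\<chi> k. P n $ k $ j" n i] NP_ge[of n i j]
    unfolding matrix_mult_axis NR_def[symmetric] by (simp add: P_nonneg)
  show "eps \<le> (matrix_inv (IS n \<psi>) ** Q n) $ i $ j"
    using IS_inv_ge(1)[OF assms, of "\<chi> k. Q n $ k $ j" n i] NQ_ge[of n i j]
    unfolding matrix_mult_axis NR_def[symmetric] by (simp add: Q_nonneg)
qed

lemma IS_inv_stochastic:
  assumes "stochastic \<psi>"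
  shows "stochastic (matrix_inv (IS n \<psi>) ** P n)"
proof -
  have "IS n \<psi> *v ones = P n *v ones"
    using rowsum_ones[of n] by (simp add: IS_apply stochastic_ones[OF assms] algebra_simps)
  then have "(matrix_inv (IS n \<psi>) ** P n) *v ones = ones"
    using inverse_solves(2)[OF invertible_IS[OF assms], of n ones] by (simp add: matrix_vector_mul_assoc[symmetric])
  then have "(\<Sum>j\<in>UNIV. (matrix_inv (IS n \<psi>) ** P n) $ i $ j) = 1" for i
    using arg_cong[of _ _ "\<lambda>v. v $ i"] by (metis (no_types, lifting) matrix_vector_nth mult.right_neutral ones_nth sum.cong)
  moreover have "0 \<le> (matrix_inv (IS n \<psi>) ** P n) $ i $ j" for i j
    using IS_inv_mult_ge(1)[OF assms, of n i j] eps by linarith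
  ultimately show ?thesis by (simp add: stochastic_def)
qed

lemma psi_stochastic:
  assumes "\<And>c. stochastic (S c)"
  shows "stochastic (psi P Q R S a k)"
  by (induction k) (use assms IS_inv_stochastic in \<open>auto simp: IS_def\<close>)

text \<open>Stochasticity passes to the limit entrywise. For the recursion the inverse is first
  multiplied out: the resulting identity is polynomial in the entries, hence stable under limits,
  and is solved again because the limit is stochastic.\<close>

lemma zeta_props:
  assumes lim: "\<And>S n. (\<forall>c. stochastic (S c)) \<Longrightarrow> ((\<lambda>c. psi P Q R S c (nat (n - c))) \<longlongrightarrow> zeta n) at_bot"
  shows "stochastic (zeta n)" "zeta n = matrix_inv (IS n (zeta (n - 1))) ** P n" "eps \<le> zeta n $ i $ j"
proof -
  define S :: "int \<Rightarrow> real^'m^'m" where "S = (\<lambda>c. mat 1)"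
  have S: "stochastic (S c)" for c
    by (auto simp: S_def stochastic_def mat_def)
  define \<Psi> where "\<Psi> = (\<lambda>n c. psi P Q R S c (nat (n - c)))"
  have st: "stochastic (\<Psi> n c)" for n c unfolding \<Psi>_def by (rule psi_stochastic[OF S])
  have tend: "((\<lambda>c. \<Psi> n c $ i $ j) \<longlongrightarrow> zeta n $ i $ j) at_bot" for n i j
    unfolding \<Psi>_def by (intro tendsto_vec_nth lim) (use S in blast)
  have zst: "stochastic (zeta n)" for n
    unfolding stochastic_def
  proof (intro conjI allI)
    fix i j show "0 \<le> zeta n $ i $ j"
      by (rule tendsto_lowerbound[OF tend]) (use st in \<open>auto simp: stochastic_def\<close>)
  next
    fix i
    have "((\<lambda>c. \<Sum>j\<in>UNIV. \<Psi> n c $ i $ j) \<longlongrightarrow> (\<Sum>j\<in>UNIV. zeta n $ i $ j)) at_bot" by (intro tendsto_sum tend)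
    moreover have "(\<lambda>c. \<Sum>j\<in>UNIV. \<Psi> n c $ i $ j) = (\<lambda>c. 1)" using st by (simp add: stochastic_def)
    ultimately show "(\<Sum>j\<in>UNIV. zeta n $ i $ j) = 1"
      using tendsto_unique[OF trivial_limit_at_bot_linorder _ tendsto_const] by metis
  qed
  show "stochastic (zeta n)" by (rule zst)
  have eq: "IS n (\<Psi> (n - 1) c) ** \<Psi> n c = P n" if "c \<le> n - 1" for c
  proof -
    have "nat (n - c) = Suc (nat (n - 1 - c))" "c + int (nat (n - 1 - c)) + 1 = n" using that by auto
    then have "\<Psi> n c = matrix_inv (IS n (\<Psi> (n - 1) c)) ** P n"
      unfolding \<Psi>_def IS_def by simp
    then show ?thesis using matrix_inv_right[OF invertible_IS[OF st]] by (simp add: matrix_mul_assoc)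
  qed
  have "IS n (zeta (n - 1)) ** zeta n = P n"
  proof (simp only: vec_eq_iff, intro allI)
    fix i j
    have "((\<lambda>c. (IS n (\<Psi> (n - 1) c) ** \<Psi> n c) $ i $ j) \<longlongrightarrow> (IS n (zeta (n - 1)) ** zeta n) $ i $ j) at_bot"
      unfolding IS_def matrix_matrix_mult_def by (simp, intro tendsto_intros tend)
    moreover have "\<forall>\<^sub>F c in at_bot. (IS n (\<Psi> (n - 1) c) ** \<Psi> n c) $ i $ j = P n $ i $ j"
      using eventually_le_at_bot[of "n - 1"] by eventually_elim (simp add: eq)
    ultimately have "((\<lambda>c::int. P n $ i $ j) \<longlongrightarrow> (IS n (zeta (n - 1)) ** zeta n) $ i $ j) at_bot"
      by (rule Lim_transform_eventually)
    then show "(IS n (zeta (n - 1)) ** zeta n) $ i $ j = P n $ i $ j"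
      using tendsto_unique[OF trivial_limit_at_bot_linorder _ tendsto_const] by metis
  qed
  then show zeq: "zeta n = matrix_inv (IS n (zeta (n - 1))) ** P n"
    using matrix_inv_left[OF invertible_IS[OF zst]] by (metis matrix_mul_assoc matrix_mul_lid)
  show "eps \<le> zeta n $ i $ j" by (subst zeq) (rule IS_inv_mult_ge(1)[OF zst])
qed

end

section \<open>The corrector\<close>

text \<open>Supplies sequences on the integers from a recursion on one side of p; the values on the
  other side are immaterial.\<close>

lemma recursive_family_up:
  fixes f :: "int \<Rightarrow> 'a \<Rightarrow> 'a"
  shows "\<exists>c. c p = x0 \<and> (\<forall>n>p. c n = f n (c (n - 1)))"
proof -
  define c where "c = (\<lambda>n. rec_nat x0 (\<lambda>k. f (p + int k + 1)) (nat (n - p)))"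
  have "c n = f n (c (n - 1))" if "n > p" for n
  proof -
    have "nat (n - p) = Suc (nat (n - 1 - p))" "p + int (nat (n - 1 - p)) + 1 = n" using that by auto
    then show ?thesis by (simp add: c_def)
  qed
  then show ?thesis by (intro exI[of _ c]) (simp add: c_def)
qed

lemma recursive_family_down:
  fixes f :: "int \<Rightarrow> 'a \<Rightarrow> 'a"
  shows "\<exists>c. c p = x0 \<and> (\<forall>n<p. c n = f n (c (n + 1)))"
proof -
  obtain c where c: "c (- p) = x0" "\<forall>n>-p. c n = f (- n) (c (n - 1))"
    using recursive_family_up[of "- p" x0 "\<lambda>n. f (- n)"] by blast
  have "c (- n) = f n (c (- (n + 1)))" if "n < p" for n
    using c(2)[rule_format, of "- n"] that by simp
  then show ?thesis using c(1) by (intro exI[of _ "\<lambda>n. c (- n)"]) simp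
qed

text \<open>Doeblin's argument: every row gives weight at least e to the coordinate where x is
  smallest, so all averages stay below the maximum by e times the oscillation.\<close>

lemma stochastic_osc_contraction:
  fixes Z :: "real^'m^'m"
  assumes Z: "stochastic Z" "\<And>i j. e \<le> Z $ i $ j" and e: "0 \<le> e"
    and osc: "\<And>i j. \<bar>x $ i - x $ j\<bar> \<le> b"
  shows "\<bar>(Z *v x) $ i - (Z *v x) $ j\<bar> \<le> (1 - e) * b" "\<bar>(Z *v x) $ i - x $ k\<bar> \<le> b"
proof -
  have sum1: "(\<Sum>k\<in>UNIV. Z $ i $ k) = 1" and nn: "0 \<le> Z $ i $ k" for i k
    using Z(1) by (auto simp: stochastic_def)
  have e1: "e \<le> 1"
    using Z(2)[of i i] member_le_sum[of i UNIV "\<lambda>k. Z $ i $ k"] sum1[of i] nn by force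
  have b0: "0 \<le> b" using osc[of i i] by simp
  define \<mu> where "\<mu> = Min (range (\<lambda>i. x $ i))"
  have "\<mu> \<in> range (\<lambda>i. x $ i)" unfolding \<mu>_def by (rule Min_in) auto
  then obtain l where l: "\<mu> = x $ l" by blast
  define M where "M = Max (range (\<lambda>i. x $ i))"
  have "M \<in> range (\<lambda>i. x $ i)" unfolding M_def by (rule Max_in) auto
  then obtain h where h: "M = x $ h" by blast
  have rng: "\<mu> \<le> x $ i" "x $ i \<le> M" for i by (simp_all add: \<mu>_def M_def)
  have Mm: "M - \<mu> \<le> b" "\<mu> \<le> M" using osc[of h l] rng[of l] unfolding l h by (simp_all add: abs_le_iff)
  have lo: "\<mu> \<le> (Z *v x) $ i" for i
  proof -
    have "\<mu> = (\<Sum>k\<in>UNIV. Z $ i $ k * \<mu>)" by (simp add: sum1 flip: sum_distrib_right)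
    also have "\<dots> \<le> (Z *v x) $ i" unfolding matrix_vector_nth by (intro sum_mono mult_left_mono rng nn)
    finally show ?thesis .
  qed
  have hi: "(Z *v x) $ i \<le> M - e * (M - \<mu>)" for i
  proof -
    have "M - (Z *v x) $ i = (\<Sum>k\<in>UNIV. Z $ i $ k * (M - x $ k))"
      by (simp add: matrix_vector_nth right_diff_distrib sum_subtractf sum1 flip: sum_distrib_right)
    also have "\<dots> \<ge> Z $ i $ l * (M - x $ l)"
      by (rule member_le_sum[of l UNIV "\<lambda>k. Z $ i $ k * (M - x $ k)"]) (use nn rng in auto)
    finally have "Z $ i $ l * (M - \<mu>) \<le> M - (Z *v x) $ i" by (simp add: l)
    moreover have "e * (M - \<mu>) \<le> Z $ i $ l * (M - \<mu>)" using Z(2) Mm by (intro mult_right_mono) auto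
    ultimately show ?thesis by linarith
  qed
  have "(1 - e) * (M - \<mu>) \<le> (1 - e) * b" using e1 Mm by (intro mult_left_mono) auto
  then show "\<bar>(Z *v x) $ i - (Z *v x) $ j\<bar> \<le> (1 - e) * b"
    using lo[of i] lo[of j] hi[of i] hi[of j] by (simp add: abs_le_iff algebra_simps)
  have "0 \<le> e * (M - \<mu>)" using e Mm by simp
  then show "\<bar>(Z *v x) $ i - x $ k\<bar> \<le> b"
    using lo[of i] hi[of i] rng[of k] Mm by (simp add: abs_le_iff)
qed

section \<open>The flux weights and the solution of the Poisson equation\<close>

locale potential_strip = elliptic_strip P Q R i0 eps k0 for P Q R :: "int \<Rightarrow> real^'m^'m" and i0 :: 'm and eps k0 +
  fixes zeta :: "int \<Rightarrow> real^'m^'m" and rho :: "int \<Rightarrow> real^'m" and B lam :: real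
  assumes zeta_stoch: "\<And>n. stochastic (zeta n)"
    and zeta_eq: "\<And>n. zeta n = matrix_inv (IS n (zeta (n - 1))) ** P n"
    and zeta_ge: "\<And>n i j. eps \<le> zeta n $ i $ j"
    and rho_nonneg: "\<And>n i. 0 \<le> rho n $ i" and rho_le: "\<And>n i. rho n $ i \<le> B"
    and rho_alpha: "\<And>n. rho n = (rho (n + 1) v* Q (n + 1)) v* matrix_inv (IS n (zeta (n - 1)))"
    and lam: "lam > 0" "\<And>n. lam \<le> (\<Sum>i\<in>UNIV. rho n $ i)"
begin

text \<open>The flux of the invariant measure from layer n + 1 down to layer n. The point of this
  vector is \<open>ell_prev\<close>: multiplication by \<open>J n ** Q n\<close> from the right
  carries it to the layer below.\<close>

definition ell :: "int \<Rightarrow> real^'m" where "ell n = rho (n + 1) v* Q (n + 1)"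

definition J :: "int \<Rightarrow> real^'m^'m" where "J n = matrix_inv (IS n (zeta (n - 1)))"

lemma B_pos: "B > 0"
proof -
  have "(\<Sum>i\<in>UNIV. rho 0 $ i) \<le> (\<Sum>i\<in>(UNIV::'m set). B)" by (intro sum_mono rho_le)
  then have "0 < real CARD('m) * B" using lam(1) lam(2)[of 0] by simp
  then show ?thesis by (simp add: zero_less_mult_iff)
qed

lemma Q_le_1: "Q n $ i $ j \<le> 1"
proof -
  have "Q n $ i $ j \<le> P n $ i $ j + Q n $ i $ j + R n $ i $ j" using P_nonneg R_nonneg by (simp add: add_nonneg_nonneg)
  also have "\<dots> \<le> (\<Sum>j\<in>UNIV. P n $ i $ j + Q n $ i $ j + R n $ i $ j)"
    by (rule member_le_sum[of j UNIV "\<lambda>j. P n $ i $ j + Q n $ i $ j + R n $ i $ j"])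
       (auto intro!: add_nonneg_nonneg P_nonneg Q_nonneg R_nonneg)
  finally show ?thesis by (simp add: rowsum)
qed

lemma ell_nonneg: "0 \<le> ell n $ i"
  unfolding ell_def vector_matrix_nth by (intro sum_nonneg mult_nonneg_nonneg Q_nonneg rho_nonneg)

lemma ell_le: "ell n $ i \<le> real CARD('m) * B"
proof -
  have "ell n $ i \<le> (\<Sum>i\<in>(UNIV::'m set). 1 * B)"
    unfolding ell_def vector_matrix_nth by (intro sum_mono mult_mono Q_le_1 rho_le rho_nonneg) auto
  then show ?thesis by simp
qed

lemma rho_ell: "rho n = ell n v* J n"
  unfolding ell_def J_def by (rule rho_alpha)

lemma ell_prev: "ell (n - 1) = ell n v* (J n ** Q n)"
  unfolding vector_matrix_mul_assoc[symmetric] rho_ell[symmetric] by (simp add: ell_def)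

lemma J_bound: "(\<And>i. \<bar>y $ i\<bar> \<le> b) \<Longrightarrow> \<bar>(J n *v y) $ i\<bar> \<le> real k0 / eps\<^sup>2 * b"
  unfolding J_def by (rule IS_inv_bound[OF zeta_stoch])

lemma JQ_ge: "eps \<le> (J n ** Q n) $ i $ j"
  unfolding J_def by (rule IS_inv_mult_ge(2)[OF zeta_stoch])

definition CJ :: real where "CJ = real k0 / eps\<^sup>2"

text \<open>As \<open>rho n\<close> is \<open>ell n\<close> times a matrix with row sums at most
  \<open>CJ\<close>, the lower bound \<open>lam\<close> on the mass of rho passes to
  \<open>ell\<close>.\<close>

lemma CJ_pos: "CJ > 0" and ell_sum_ge: "lam / CJ \<le> (\<Sum>i\<in>UNIV. ell n $ i)"
proof -
  have ge: "lam \<le> CJ * (\<Sum>i\<in>UNIV. ell n $ i)" for n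
  proof -
    have "(\<Sum>i\<in>UNIV. rho n $ i) = rho n \<bullet> ones" by (simp add: inner_vec_def)
    also have "\<dots> = ell n \<bullet> (J n *v ones)" by (subst rho_ell) (rule dot_lmul_matrix)
    also have "\<dots> = (\<Sum>i\<in>UNIV. ell n $ i * (J n *v ones) $ i)" by (simp add: inner_vec_def)
    also have "\<dots> \<le> (\<Sum>i\<in>UNIV. ell n $ i * CJ)"
    proof (intro sum_mono mult_left_mono ell_nonneg)
      fix i show "(J n *v ones) $ i \<le> CJ" using J_bound[of ones 1 n i] by (simp add: CJ_def)
    qed
    also have "\<dots> = CJ * (\<Sum>i\<in>UNIV. ell n $ i)" by (simp add: sum_distrib_left mult.commute)
    finally show ?thesis using lam(2)[of n] by linarith
  qed
  have "0 \<le> CJ" by (simp add: CJ_def)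
  moreover have "CJ \<noteq> 0" using ge[of 0] lam(1) by auto
  ultimately show c: "CJ > 0" by simp
  show "lam / CJ \<le> (\<Sum>i\<in>UNIV. ell n $ i)" using ge[of n] c by (simp add: divide_le_eq mult.commute)
qed

text \<open>One application of \<open>ell_prev\<close> spreads the total mass over all coordinates,
  since the entries of \<open>J n ** Q n\<close> are at least eps.\<close>

lemma ell_ge: "eps * (lam / CJ) \<le> ell n $ i"
proof -
  have "eps * (lam / CJ) \<le> (\<Sum>k\<in>UNIV. eps * ell (n + 1) $ k)"
    unfolding sum_distrib_left[symmetric] using eps by (intro mult_left_mono ell_sum_ge) auto
  also have "\<dots> \<le> (\<Sum>k\<in>UNIV. (J (n + 1) ** Q (n + 1)) $ k $ i * ell (n + 1) $ k)"
    by (intro sum_mono mult_right_mono JQ_ge ell_nonneg)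
  also have "\<dots> = ell n $ i" using ell_prev[of "n + 1"] by (simp add: vector_matrix_nth)
  finally show ?thesis .
qed

text \<open>The matrices \<open>J n ** Q n\<close> need not be stochastic; this weighted norm is the
  natural one because they preserve the weights exactly.\<close>

definition mass :: "int \<Rightarrow> real^'m \<Rightarrow> real" where "mass n x = (\<Sum>i\<in>UNIV. ell n $ i * \<bar>x $ i\<bar>)"

lemma mass_triangle: "mass n (x - y) \<le> mass n x + mass n y"
  unfolding mass_def sum.distrib[symmetric] distrib_left[symmetric]
  by (intro sum_mono mult_left_mono ell_nonneg) (simp add: abs_triangle_ineq4)

text \<open>A dual Doeblin argument: the matrix dominates e times the rank one matrix with every row
  equal to \<open>ell (n - 1)\<close>. Subtracting that part removes a fixed proportion of the mass
  and changes the image only through the pairing with \<open>ell (n - 1)\<close>, the one direction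
  that is not damped.\<close>

lemma mass_contraction:
  "\<exists>\<eta>>0. \<eta> \<le> 1 \<and> (\<forall>n x. mass n ((J n ** Q n) *v x) \<le> (1 - \<eta>) * mass (n - 1) x + \<bar>ell (n - 1) \<bullet> x\<bar>)"
proof -
  define m where "m = real CARD('m)"
  have m: "m > 0" by (simp add: m_def)
  define e where "e = eps / (m * B)"
  have e: "e > 0" using eps m B_pos by (simp add: e_def)
  define \<eta> where "\<eta> = min 1 (e * (lam / CJ))"
  have \<eta>: "\<eta> > 0" "\<eta> \<le> 1" "\<eta> \<le> e * (lam / CJ)" using e lam(1) CJ_pos by (auto simp: \<eta>_def)
  show ?thesis
  proof (intro exI[of _ \<eta>] conjI allI \<eta>(1,2))
    fix n and x :: "real^'m"
    define A where "A = J n ** Q n"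
    define L where "L = (\<Sum>i\<in>UNIV. ell n $ i)"
    have L: "lam / CJ \<le> L" unfolding L_def by (rule ell_sum_ge)
    \<comment> \<open>This is why e is eps divided by the upper bound m B for the entries of
      \<open>ell\<close>.\<close>
    have Age: "e * ell (n - 1) $ j \<le> A $ i $ j" for i j
    proof -
      have "e * ell (n - 1) $ j \<le> e * (m * B)" using ell_le e unfolding m_def by (intro mult_left_mono) auto
      also have "\<dots> = eps" using m B_pos by (simp add: e_def)
      finally show ?thesis using JQ_ge[of n i j] unfolding A_def by linarith
    qed
    have pt: "\<bar>(A *v x) $ i\<bar> \<le> (\<Sum>j\<in>UNIV. A $ i $ j * \<bar>x $ j\<bar>) - e * mass (n - 1) x + e * \<bar>ell (n - 1) \<bullet> x\<bar>" for i
    proof -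
      have "(A *v x) $ i = (\<Sum>j\<in>UNIV. (A $ i $ j - e * ell (n - 1) $ j) * x $ j) + e * (ell (n - 1) \<bullet> x)"
        by (simp add: matrix_vector_nth inner_vec_def left_diff_distrib sum_subtractf sum_distrib_left mult.assoc)
      also have "\<bar>\<dots>\<bar> \<le> \<bar>\<Sum>j\<in>UNIV. (A $ i $ j - e * ell (n - 1) $ j) * x $ j\<bar> + e * \<bar>ell (n - 1) \<bullet> x\<bar>"
        using e abs_triangle_ineq[of _ "e * (ell (n - 1) \<bullet> x)"] by (simp add: abs_mult)
      also have "\<bar>\<Sum>j\<in>UNIV. (A $ i $ j - e * ell (n - 1) $ j) * x $ j\<bar> \<le> (\<Sum>j\<in>UNIV. (A $ i $ j - e * ell (n - 1) $ j) * \<bar>x $ j\<bar>)"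
        by (rule order_trans[OF sum_abs]) (use Age in \<open>auto intro!: sum_mono simp: abs_mult\<close>)
      also have "(\<Sum>j\<in>UNIV. (A $ i $ j - e * ell (n - 1) $ j) * \<bar>x $ j\<bar>) = (\<Sum>j\<in>UNIV. A $ i $ j * \<bar>x $ j\<bar>) - e * mass (n - 1) x"
        by (simp add: mass_def left_diff_distrib sum_subtractf sum_distrib_left mult.assoc)
      finally show ?thesis by simp
    qed
    have "mass n (A *v x) \<le> (\<Sum>i\<in>UNIV. ell n $ i * ((\<Sum>j\<in>UNIV. A $ i $ j * \<bar>x $ j\<bar>) - e * mass (n - 1) x + e * \<bar>ell (n - 1) \<bullet> x\<bar>))"
      unfolding mass_def[of n] by (intro sum_mono mult_left_mono pt ell_nonneg)
    also have "\<dots> = (\<Sum>i\<in>UNIV. ell n $ i * (\<Sum>j\<in>UNIV. A $ i $ j * \<bar>x $ j\<bar>)) - L * (e * (mass (n - 1) x - \<bar>ell (n - 1) \<bullet> x\<bar>))"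
      by (simp add: L_def distrib_left right_diff_distrib sum.distrib sum_subtractf sum_distrib_right)
    also have "(\<Sum>i\<in>UNIV. ell n $ i * (\<Sum>j\<in>UNIV. A $ i $ j * \<bar>x $ j\<bar>)) = mass (n - 1) x"
    proof -
      have "(\<Sum>i\<in>UNIV. ell n $ i * (\<Sum>j\<in>UNIV. A $ i $ j * \<bar>x $ j\<bar>)) = (\<Sum>j\<in>UNIV. (ell n v* A) $ j * \<bar>x $ j\<bar>)"
        unfolding vector_matrix_nth sum_distrib_left sum_distrib_right by (subst sum.swap) (simp add: mult_ac)
      then show ?thesis unfolding A_def ell_prev[symmetric] mass_def .
    qed
    also have "mass (n - 1) x - L * (e * (mass (n - 1) x - \<bar>ell (n - 1) \<bullet> x\<bar>)) \<le> (1 - \<eta>) * mass (n - 1) x + \<bar>ell (n - 1) \<bullet> x\<bar>"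
    proof -
      have "\<bar>ell (n - 1) \<bullet> x\<bar> \<le> mass (n - 1) x"
        unfolding inner_vec_def mass_def by (rule order_trans[OF sum_abs]) (simp add: abs_mult ell_nonneg)
      moreover have "\<eta> \<le> L * e" using \<eta>(3) mult_right_mono[OF L, of e] e by (simp add: mult.commute)
      ultimately have "\<eta> * (mass (n - 1) x - \<bar>ell (n - 1) \<bullet> x\<bar>) \<le> (L * e) * (mass (n - 1) x - \<bar>ell (n - 1) \<bullet> x\<bar>)"
        by (intro mult_right_mono) auto
      moreover have "\<eta> * \<bar>ell (n - 1) \<bullet> x\<bar> \<le> 1 * \<bar>ell (n - 1) \<bullet> x\<bar>" using \<eta> by (intro mult_right_mono) auto
      ultimately show ?thesis by (simp add: algebra_simps)
    qed
    finally show "mass n ((J n ** Q n) *v x) \<le> (1 - \<eta>) * mass (n - 1) x + \<bar>ell (n - 1) \<bullet> x\<bar>" unfolding A_def .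
  qed
qed

lemma T_eq_matrix: "T (\<lambda>n i. G n $ i) n i = (P n *v G (n + 1)) $ i + (Q n *v G (n - 1)) $ i + (R n *v G n) $ i"
  by (simp add: T_def matrix_vector_nth sum.distrib)

text \<open>Block LU factorisation of the tridiagonal operator \<open>T\<close> minus identity:
  \<open>c\<close> is the upward sweep, \<open>G\<close> the downward one, and the recursion for
  \<open>zeta\<close> is precisely the factorisation of the blocks.\<close>

lemma poisson_solution:
  assumes c: "c n = J n *v (Q n *v c (n - 1) - phi n)"
    and G: "G n = zeta n *v G (n + 1) + c n" "G (n - 1) = zeta (n - 1) *v G n + c (n - 1)"
  shows "T (\<lambda>n i. G n $ i) n i = G n $ i + phi n $ i"
proof -
  note inv = invertible_IS[OF zeta_stoch[of "n - 1"], of n]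
  have "IS n (zeta (n - 1)) ** zeta n = P n"
    by (subst zeta_eq[of n]) (simp add: matrix_mul_assoc matrix_inv_right[OF inv])
  then have "IS n (zeta (n - 1)) *v G n = P n *v G (n + 1) + (Q n *v c (n - 1) - phi n)"
    unfolding G(1) c J_def by (simp add: matrix_vector_right_distrib matrix_vector_mul_assoc matrix_inv_right[OF inv])
  moreover have "IS n (zeta (n - 1)) *v G n = G n - R n *v G n - Q n *v (G (n - 1) - c (n - 1))"
    unfolding IS_apply G(2) by simp
  ultimately have "P n *v G (n + 1) + Q n *v G (n - 1) + R n *v G n = G n + phi n"
    by (simp add: matrix_vector_mult_diff_distrib algebra_simps)
  then have "(P n *v G (n + 1) + Q n *v G (n - 1) + R n *v G n) $ i = (G n + phi n) $ i" by simp
  then show ?thesis unfolding T_eq_matrix by simp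
qed

text \<open>Two contractions in opposite directions: \<open>mass\<close> going up controls c,
  oscillation going down controls G. In both, a source of size \<open>g\<close> is added in each
  step, and the solution stays of size \<open>g\<close> because \<open>g\<close> varies more slowly
  than the contraction acts. Summing the gradient outward from y gives the extra power in the size
  of G.\<close>

lemma corrector_exists:
  fixes phi :: "int \<Rightarrow> real^'m" and h :: "int \<Rightarrow> real" and \<beta> F Ch :: real
  assumes \<beta>: "0 < \<beta>" "\<beta> \<le> 1/4" and F: "\<And>n i. \<bar>phi n $ i\<bar> \<le> F"
    and h: "\<And>n. h n = h (n - 1) + rho n \<bullet> phi n" and Ch: "Ch \<ge> 1"
  shows "\<exists>C\<ge>1. \<forall>\<sigma>\<ge>1. \<forall>y (N::nat). (\<forall>u. \<bar>h u - h y\<bar> \<le> Ch * (\<bar>real_of_int (u - y)\<bar> + \<sigma>) powr (1 - \<beta>)) \<longrightarrow>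
    (\<exists>G. (\<forall>n i. \<bar>n\<bar> \<le> int N \<longrightarrow> T G n i = G n i + phi n $ i)
       \<and> (\<forall>n i. \<bar>n\<bar> \<le> int N \<longrightarrow> \<bar>G n i\<bar> \<le> C * (\<bar>real_of_int (n - y)\<bar> + \<sigma>) powr (2 - \<beta>))
       \<and> (\<forall>n n' i j. \<bar>n\<bar> \<le> int N \<longrightarrow> \<bar>n' - n\<bar> \<le> 1 \<longrightarrow>
            \<bar>G n' j - G n i\<bar> \<le> C * (\<bar>real_of_int (n - y)\<bar> + \<sigma>) powr (1 - \<beta>)))"
proof -
  obtain \<eta> where \<eta>: "\<eta> > 0" "\<eta> \<le> 1"
    "\<And>n x. mass n ((J n ** Q n) *v x) \<le> (1 - \<eta>) * mass (n - 1) x + \<bar>ell (n - 1) \<bullet> x\<bar>"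
    using mass_contraction by blast
  define e where "e = min \<eta> eps"
  have e: "0 < e" "e \<le> \<eta>" "e \<le> eps" "e \<le> 1" using \<eta> eps by (auto simp: e_def)
  have eps1: "eps \<le> 1"
    using zeta_ge[of 0 i0 i0] member_le_sum[of i0 UNIV "\<lambda>k. zeta 0 $ i0 $ k"] zeta_stoch[of 0]
    by (force simp: stochastic_def)
  \<comment> \<open>Inflating sigma by this factor makes \<open>g\<close> change by at most the
    factor 1 + e / 2 per site, and (1 - e)(1 + e / 2) <= 1 - e / 2.\<close>
  define H where "H = 2 / e"
  have H: "H \<ge> 1" "1 \<le> e / 2 * H" using e by (simp_all add: H_def field_simps)
  have F0: "F \<ge> 0" using F[of 0 i0] by linarith
  define m where "m = real CARD('m)"
  define F1 where "F1 = m * (m * B * (CJ * F))"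
  have F10: "F1 \<ge> 0" using B_pos CJ_pos F0 by (simp add: F1_def m_def)
  \<comment> \<open>Solves M (1 - e / 2) + (Ch + F1) * 3/2 = M, so the bound reproduces itself along
    the recursion; 3/2 bounds the growth of \<open>g\<close> per site. \<open>M2\<close> arises in
    the same way from the sources 2 \<open>M1\<close>.\<close>
  define M where "M = 3 * (Ch + F1) / e"
  have M: "M \<ge> Ch" "M \<ge> 0" "(Ch + F1) * (3/2) = e / 2 * M"
  proof -
    show "(Ch + F1) * (3/2) = e / 2 * M" using e by (simp add: M_def)
    have "Ch * e \<le> (3 * (Ch + F1)) * 1" using e Ch F10 by (intro mult_mono) auto
    then show "M \<ge> Ch" using e by (simp add: M_def le_divide_eq)
    then show "M \<ge> 0" using Ch by linarith
  qed
  define M1 where "M1 = M / (eps * (lam / CJ))"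
  have el: "eps * (lam / CJ) > 0" using eps lam CJ_pos by simp
  have M10: "M1 \<ge> 0" unfolding M1_def by (rule divide_nonneg_pos[OF M(2) el])
  define M2 where "M2 = 4 * M1 / e"
  have M2: "M2 \<ge> 0" "2 * M1 = e / 2 * M2" using M10 e by (simp_all add: M2_def)
  define M3 where "M3 = 2 * M2 + 2 * M1"
  have M30: "M3 \<ge> 0" using M2 M10 by (simp add: M3_def)
  have damp: "(1 - e) * (1 + e / 2) \<le> 1 - e / 2" using e by (simp add: algebra_simps)
  define C where "C = 1 + M3 * H\<^sup>2"
  have C: "C \<ge> 1" "M3 * H\<^sup>2 \<le> C" using M30 by (simp_all add: C_def)
  show ?thesis
  proof (intro exI[of _ C] conjI[OF C(1)] allI impI)
    fix \<sigma> :: real and y :: int and N :: nat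
    assume \<sigma>: "1 \<le> \<sigma>" and hy: "\<forall>u. \<bar>h u - h y\<bar> \<le> Ch * (\<bar>real_of_int (u - y)\<bar> + \<sigma>) powr (1 - \<beta>)"
    define r where "r = (\<lambda>n::int. \<bar>real_of_int (n - y)\<bar> + H * \<sigma>)"
    define g where "g = (\<lambda>n. r n powr (1 - \<beta>))"
    have Hs: "H * \<sigma> \<ge> \<sigma>" "H * \<sigma> \<ge> H" using H \<sigma> by (auto simp: mult_le_cancel_right1 mult_le_cancel_left1)
    have r1: "r n \<ge> 1" for n
      unfolding r_def using order_trans[OF \<sigma> Hs(1)] abs_ge_zero[of "real_of_int (n - y)"] by linarith
    have g1: "g n \<ge> 1" for n unfolding g_def using r1 \<beta> by (intro ge_one_powr_ge_zero) auto
    have gmono: "g n \<le> g n'" if "\<bar>n - y\<bar> \<le> \<bar>n' - y\<bar>" for n n'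
    proof -
      have "r n \<le> r n'" using that unfolding r_def by linarith
      then show ?thesis unfolding g_def using r1[of n] \<beta> by (intro powr_mono2) auto
    qed
    have gstep: "g n' \<le> (1 + e / 2) * g n" if "\<bar>n' - n\<bar> \<le> 1" for n n'
    proof -
      have "r n' \<le> r n + 1" using that unfolding r_def by linarith
      also have "1 \<le> e / 2 * r n"
      proof -
        have "e / 2 * H \<le> e / 2 * r n" using e Hs by (intro mult_left_mono) (auto simp: r_def)
        then show ?thesis using H by linarith
      qed
      finally have "r n' \<le> (1 + e / 2) * r n" by (simp add: algebra_simps)
      then have "g n' \<le> ((1 + e / 2) * r n) powr (1 - \<beta>)" unfolding g_def using r1[of n'] \<beta> by (intro powr_mono2) auto
      also have "\<dots> = (1 + e / 2) powr (1 - \<beta>) * g n" using e r1[of n] by (simp add: g_def powr_mult)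
      also have "\<dots> \<le> (1 + e / 2) powr 1 * g n" using e \<beta> g1[of n] by (intro mult_right_mono powr_mono) auto
      finally show ?thesis using e by simp
    qed
    have gstep': "g n' \<le> 3/2 * g n" if "\<bar>n' - n\<bar> \<le> 1" for n n'
    proof -
      have "(1 + e / 2) * g n \<le> 3/2 * g n" using e g1[of n] by (intro mult_right_mono) auto
      then show ?thesis using gstep[OF that] by linarith
    qed
    have hg: "\<bar>h u - h y\<bar> \<le> Ch * g u" for u
    proof -
      have "\<bar>h u - h y\<bar> \<le> Ch * (\<bar>real_of_int (u - y)\<bar> + \<sigma>) powr (1 - \<beta>)" using hy by blast
      also have "\<dots> \<le> Ch * g u" unfolding g_def r_def using Ch \<sigma> \<beta> Hs by (intro mult_left_mono powr_mono2) auto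
      finally show ?thesis .
    qed
    \<comment> \<open>The sweeps start beyond both the range -N..N and y, with room for the
      neighbours of a site; N and y affect no constant.\<close>
    define p b where "p = - int N - \<bar>y\<bar> - 2" and "b = int N + \<bar>y\<bar> + 2"
    define L where "L = (\<Sum>i\<in>UNIV. ell p $ i)"
    have L: "L > 0" using ell_sum_ge[of p] lam CJ_pos divide_pos_pos[of lam CJ] unfolding L_def by linarith
    \<comment> \<open>The initial flux h y - h p makes the flux at n equal to h y - h n, which
      vanishes at y: here the centring at y enters. Taking \<open>c p\<close> constant makes its
      mass equal to the modulus of its flux.\<close>
    obtain c where c0: "c p = ((h y - h p) / L) *s ones" and c: "\<forall>n>p. c n = J n *v (Q n *v c (n - 1) - phi n)"
      using recursive_family_up[of p "((h y - h p) / L) *s ones" "\<lambda>n x. J n *v (Q n *v x - phi n)"] by blast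
    have w: "ell n \<bullet> c n = h y - h n" if "n \<ge> p" for n
      using that
    proof (induction n rule: int_ge_induct)
      case base
      have "ell p \<bullet> c p = (h y - h p) / L * L"
      proof -
        have "ell p \<bullet> (s *s ones) = s * L" for s by (simp add: inner_vec_def L_def sum_distrib_left mult.commute)
        then show ?thesis unfolding c0 .
      qed
      then show ?case using L by simp
    next
      case (step n)
      have "ell (n + 1) \<bullet> c (n + 1) = ell (n + 1) \<bullet> ((J (n + 1) ** Q (n + 1)) *v c n) - ell (n + 1) \<bullet> (J (n + 1) *v phi (n + 1))"
        using c[rule_format, of "n + 1"] step.hyps by (simp add: matrix_vector_mult_diff_distrib inner_diff_right matrix_vector_mul_assoc)
      also have "\<dots> = ell n \<bullet> c n - rho (n + 1) \<bullet> phi (n + 1)"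
        unfolding dot_lmul_matrix[symmetric] rho_ell[symmetric] ell_prev[of "n + 1", symmetric] by simp
      finally show ?case using step.IH h[of "n + 1"] by simp
    qed
    have massJ: "mass n (J n *v phi n) \<le> F1" for n
    proof -
      have "mass n (J n *v phi n) \<le> (\<Sum>i\<in>(UNIV::'m set). m * B * (CJ * F))"
        unfolding mass_def
      proof (intro sum_mono mult_mono)
        fix i show "ell n $ i \<le> m * B" unfolding m_def by (rule ell_le)
        show "\<bar>(J n *v phi n) $ i\<bar> \<le> CJ * F" unfolding CJ_def by (rule J_bound[OF F])
      qed (use B_pos in \<open>auto simp: m_def\<close>)
      then show ?thesis by (simp add: F1_def m_def)
    qed
    have cm: "mass n (c n) \<le> M * g n" if "n \<ge> p" for n
      using that
    proof (induction n rule: int_ge_induct)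
      case base
      have "mass p (c p) = \<bar>(h y - h p) / L\<bar> * L"
      proof -
        have "mass p (s *s ones) = \<bar>s\<bar> * L" for s by (simp add: mass_def L_def sum_distrib_left mult.commute)
        then show ?thesis unfolding c0 .
      qed
      then have "mass p (c p) = \<bar>h p - h y\<bar>" using L by (simp add: abs_minus_commute)
      also have "\<dots> \<le> Ch * g p" by (rule hg)
      also have "\<dots> \<le> M * g p" using M g1[of p] by (intro mult_right_mono) auto
      finally show ?case .
    next
      case (step n)
      have "c (n + 1) = (J (n + 1) ** Q (n + 1)) *v c n - J (n + 1) *v phi (n + 1)"
        using c[rule_format, of "n + 1"] step.hyps by (simp add: matrix_vector_mult_diff_distrib matrix_vector_mul_assoc)
      then have "mass (n + 1) (c (n + 1)) \<le> mass (n + 1) ((J (n + 1) ** Q (n + 1)) *v c n) + mass (n + 1) (J (n + 1) *v phi (n + 1))"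
        using mass_triangle by metis
      also have "\<dots> \<le> ((1 - \<eta>) * mass n (c n) + \<bar>ell n \<bullet> c n\<bar>) + F1"
        using \<eta>(3)[of "n + 1" "c n"] massJ[of "n + 1"] by simp
      also have "\<dots> \<le> ((1 - e) * (M * g n) + Ch * g n) + F1 * g n"
      proof (intro add_mono)
        have "(1 - \<eta>) * mass n (c n) \<le> (1 - \<eta>) * (M * g n)" using \<eta> step.IH by (intro mult_left_mono) auto
        also have "\<dots> \<le> (1 - e) * (M * g n)" using e M g1[of n] by (intro mult_right_mono) auto
        finally show "(1 - \<eta>) * mass n (c n) \<le> (1 - e) * (M * g n)" .
        show "\<bar>ell n \<bullet> c n\<bar> \<le> Ch * g n" using w[OF step.hyps] hg[of n] by (simp add: abs_minus_commute)
        show "F1 \<le> F1 * g n" using F10 g1[of n] by (simp add: mult_le_cancel_left1)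
      qed
      also have "\<dots> = ((1 - e) * M) * g n + (Ch + F1) * g n" by (simp add: algebra_simps)
      also have "\<dots> \<le> ((1 - e) * M) * ((1 + e / 2) * g (n + 1)) + (Ch + F1) * (3/2 * g (n + 1))"
        using e M Ch F10 by (intro add_mono mult_left_mono gstep gstep') auto
      also have "\<dots> = (M * ((1 - e) * (1 + e / 2))) * g (n + 1) + (e / 2 * M) * g (n + 1)"
        unfolding M(3)[symmetric] by (simp add: algebra_simps)
      also have "\<dots> \<le> (M * (1 - e / 2)) * g (n + 1) + (e / 2 * M) * g (n + 1)"
        using M g1[of "n + 1"] damp by (intro add_right_mono mult_right_mono mult_left_mono) auto
      also have "\<dots> = M * g (n + 1)" by (simp add: algebra_simps)
      finally show ?case .
    qed
    have cb: "\<bar>c n $ i\<bar> \<le> M1 * g n" if "n \<ge> p" for n i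
    proof -
      have "eps * (lam / CJ) * \<bar>c n $ i\<bar> \<le> ell n $ i * \<bar>c n $ i\<bar>" by (intro mult_right_mono ell_ge) auto
      also have "\<dots> \<le> mass n (c n)" unfolding mass_def
        by (rule member_le_sum[of i UNIV "\<lambda>i. ell n $ i * \<bar>c n $ i\<bar>"]) (auto simp: ell_nonneg)
      also have "\<dots> \<le> M * g n" by (rule cm[OF that])
      finally have "eps * (lam / CJ) * \<bar>c n $ i\<bar> \<le> M * g n" .
      moreover have "X \<le> M / z * g n" if "z > 0" "z * X \<le> M * g n" for z X
        using that by (simp add: field_simps)
      ultimately show ?thesis using el unfolding M1_def by blast
    qed
    \<comment> \<open>The end value 0 only has to have no oscillation. The level of G is adjusted
      afterwards by subtracting \<open>a\<close>, its value at y, which the Poisson equation does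
      not notice.\<close>
    obtain G where Gb: "G b = 0" and G: "\<forall>n<b. G n = zeta n *v G (n + 1) + c n"
      using recursive_family_down[of b 0 "\<lambda>n x. zeta n *v x + c n"] by blast
    have osc: "\<forall>i j. \<bar>G n $ i - G n $ j\<bar> \<le> M2 * g n" if "n \<le> b" "n \<ge> p" for n
      using that
    proof (induction n rule: int_le_induct)
      case base
      then show ?case using Gb M2 g1[of b] by simp
    next
      case (step n)
      show ?case
      proof (intro allI)
        fix i j
        have "\<forall>i j. \<bar>G n $ i - G n $ j\<bar> \<le> M2 * g n" using step by simp
        then have "\<bar>(zeta (n - 1) *v G n) $ i - (zeta (n - 1) *v G n) $ j\<bar> \<le> (1 - eps) * (M2 * g n)"
          using eps by (intro stochastic_osc_contraction(1) zeta_stoch zeta_ge) auto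
        also have "\<dots> \<le> (1 - e) * (M2 * ((1 + e / 2) * g (n - 1)))"
          using e eps1 M2 g1[of n] gstep[of n "n - 1"] by (intro mult_mono mult_left_mono) auto
        also have "\<dots> = (M2 * ((1 - e) * (1 + e / 2))) * g (n - 1)" by (simp add: algebra_simps)
        also have "\<dots> \<le> (M2 * (1 - e / 2)) * g (n - 1)"
          using M2 g1[of "n - 1"] damp by (intro mult_right_mono mult_left_mono) auto
        finally have 1: "\<bar>(zeta (n - 1) *v G n) $ i - (zeta (n - 1) *v G n) $ j\<bar> \<le> (M2 * (1 - e / 2)) * g (n - 1)" .
        have cc: "\<bar>c (n - 1) $ i\<bar> \<le> M1 * g (n - 1)" "\<bar>c (n - 1) $ j\<bar> \<le> M1 * g (n - 1)" using cb step.prems by auto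
        have "G (n - 1) = zeta (n - 1) *v G n + c (n - 1)" using G[rule_format, of "n - 1"] step.hyps by simp
        then have "\<bar>G (n - 1) $ i - G (n - 1) $ j\<bar> \<le> (M2 * (1 - e / 2)) * g (n - 1) + 2 * (M1 * g (n - 1))"
          using 1 cc by (simp add: abs_le_iff)
        also have "\<dots> = (M2 * (1 - e / 2)) * g (n - 1) + (2 * M1) * g (n - 1)" by simp
        also have "\<dots> = M2 * g (n - 1)" unfolding M2(2) by (simp add: algebra_simps)
        finally show "\<bar>G (n - 1) $ i - G (n - 1) $ j\<bar> \<le> M2 * g (n - 1)" .
      qed
    qed
    have up: "\<bar>G n $ i - G (n + 1) $ j\<bar> \<le> M2 * g (n + 1) + M1 * g n" if "p \<le> n" "n < b" for n i j
    proof -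
      have "\<forall>i j. \<bar>G (n + 1) $ i - G (n + 1) $ j\<bar> \<le> M2 * g (n + 1)" using osc[of "n + 1"] that by simp
      then have "\<bar>(zeta n *v G (n + 1)) $ i - G (n + 1) $ j\<bar> \<le> M2 * g (n + 1)"
        using eps by (intro stochastic_osc_contraction(2)[OF zeta_stoch zeta_ge]) auto
      moreover have "G n = zeta n *v G (n + 1) + c n" using G that by blast
      ultimately show ?thesis using cb[OF that(1), of i] by (simp add: abs_le_iff)
    qed
    have grad: "\<bar>G n' $ j - G n $ i\<bar> \<le> M3 * g n" if n: "p < n" "n < b" and n': "\<bar>n' - n\<bar> \<le> 1" for n n' i j
    proof -
      consider "n' = n" | "n' = n + 1" | "n' = n - 1" using n' by linarith
      then show ?thesis
      proof cases
        case 1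
        have "\<bar>G n' $ j - G n $ i\<bar> \<le> M2 * g n" using osc[of n] n 1 by simp
        also have "\<dots> \<le> M3 * g n" using M2(1) M10 g1[of n] unfolding M3_def by (intro mult_right_mono) linarith+
        finally show ?thesis .
      next
        case 2
        have "\<bar>G n' $ j - G n $ i\<bar> \<le> M2 * g (n + 1) + M1 * g n" using up[of n i j] n 2 by (simp add: abs_minus_commute)
        also have "\<dots> \<le> M2 * (3/2 * g n) + M1 * g n" using M2(1) M10 by (intro add_mono mult_left_mono gstep') auto
        also have "\<dots> = (3/2 * M2 + M1) * g n" by (simp add: algebra_simps)
        also have "\<dots> \<le> M3 * g n" using M2(1) M10 g1[of n] unfolding M3_def by (intro mult_right_mono) linarith+
        finally show ?thesis .
      next
        case 3
        have "\<bar>G n' $ j - G n $ i\<bar> \<le> M2 * g n + M1 * g (n - 1)" using up[of "n - 1" j i] n 3 by simp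
        also have "\<dots> \<le> M2 * g n + M1 * (3/2 * g n)" using M2(1) M10 by (intro add_mono mult_left_mono gstep') auto
        also have "\<dots> = (M2 + 3/2 * M1) * g n" by (simp add: algebra_simps)
        also have "\<dots> \<le> M3 * g n" using M2(1) M10 g1[of n] unfolding M3_def by (intro mult_right_mono) linarith+
        finally show ?thesis .
      qed
    qed
    have pyb: "p < y" "y < b" by (auto simp: p_def b_def)
    define a where "a = G y $ i0"
    have start: "\<bar>G y $ i - a\<bar> \<le> M3 * (1 * g y)" for i
      using grad[OF pyb, of y i i0] by (simp add: a_def)
    have path_up: "n < b \<longrightarrow> (\<forall>i. \<bar>G n $ i - a\<bar> \<le> M3 * ((real_of_int (n - y) + 1) * g n))" if "n \<ge> y" for n
      using that
    proof (induction n rule: int_ge_induct)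
      case base
      show ?case using start by simp
    next
      case (step n)
      show ?case
      proof (intro impI allI)
        fix i assume nb: "n + 1 < b"
        have "\<bar>G n $ i - a\<bar> \<le> M3 * ((real_of_int (n - y) + 1) * g n)" using step.IH nb by simp
        moreover have "\<bar>G (n + 1) $ i - G n $ i\<bar> \<le> M3 * g n" using step.hyps pyb nb by (intro grad) auto
        ultimately have "\<bar>G (n + 1) $ i - a\<bar> \<le> M3 * ((real_of_int (n - y) + 1) * g n) + M3 * g n" by linarith
        also have "\<dots> = M3 * ((real_of_int (n + 1 - y) + 1) * g n)" by (simp add: algebra_simps)
        also have "\<dots> \<le> M3 * ((real_of_int (n + 1 - y) + 1) * g (n + 1))"
          using M30 step.hyps by (intro mult_left_mono gmono) auto
        finally show "\<bar>G (n + 1) $ i - a\<bar> \<le> M3 * ((real_of_int (n + 1 - y) + 1) * g (n + 1))" .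
      qed
    qed
    have path_down: "p < n \<longrightarrow> (\<forall>i. \<bar>G n $ i - a\<bar> \<le> M3 * ((real_of_int (y - n) + 1) * g n))" if "n \<le> y" for n
      using that
    proof (induction n rule: int_le_induct)
      case base
      show ?case using start by simp
    next
      case (step n)
      show ?case
      proof (intro impI allI)
        fix i assume nb: "p < n - 1"
        have "\<bar>G n $ i - a\<bar> \<le> M3 * ((real_of_int (y - n) + 1) * g n)" using step.IH nb by simp
        moreover have "\<bar>G (n - 1) $ i - G n $ i\<bar> \<le> M3 * g n" using step.hyps pyb nb by (intro grad) auto
        ultimately have "\<bar>G (n - 1) $ i - a\<bar> \<le> M3 * ((real_of_int (y - n) + 1) * g n) + M3 * g n" by linarith
        also have "\<dots> = M3 * ((real_of_int (y - (n - 1)) + 1) * g n)" by (simp add: algebra_simps)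
        also have "\<dots> \<le> M3 * ((real_of_int (y - (n - 1)) + 1) * g (n - 1))"
          using M30 step.hyps by (intro mult_left_mono gmono) auto
        finally show "\<bar>G (n - 1) $ i - a\<bar> \<le> M3 * ((real_of_int (y - (n - 1)) + 1) * g (n - 1))" .
      qed
    qed
    have size: "\<bar>G n $ i - a\<bar> \<le> M3 * r n powr (2 - \<beta>)" if n: "p < n" "n < b" for n i
    proof -
      have "\<bar>G n $ i - a\<bar> \<le> M3 * ((\<bar>real_of_int (n - y)\<bar> + 1) * g n)"
        using path_up[of n] path_down[of n] n by (cases "n \<ge> y") auto
      also have "\<dots> \<le> M3 * (r n * g n)"
        using M30 g1[of n] order_trans[OF \<sigma> Hs(1)] unfolding r_def by (intro mult_left_mono mult_right_mono) auto
      also have "r n * g n = r n powr (2 - \<beta>)" unfolding g_def using r1[of n] powr_add[of "r n" 1 "1 - \<beta>"] by simp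
      finally show ?thesis .
    qed
    have rH: "r n powr q \<le> H\<^sup>2 * (\<bar>real_of_int (n - y)\<bar> + \<sigma>) powr q" if q: "0 \<le> q" "q \<le> 2" for n q
    proof -
      have "r n \<le> H * (\<bar>real_of_int (n - y)\<bar> + \<sigma>)"
        using H mult_right_mono[of 1 H "\<bar>real_of_int (n - y)\<bar>"] by (simp add: r_def distrib_left)
      then have "r n powr q \<le> (H * (\<bar>real_of_int (n - y)\<bar> + \<sigma>)) powr q" using r1[of n] q by (intro powr_mono2) auto
      also have "\<dots> = H powr q * (\<bar>real_of_int (n - y)\<bar> + \<sigma>) powr q" using H \<sigma> by (simp add: powr_mult)
      also have "\<dots> \<le> H powr 2 * (\<bar>real_of_int (n - y)\<bar> + \<sigma>) powr q" using H q by (intro mult_right_mono powr_mono) auto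
      also have "H powr 2 = H\<^sup>2" using H by (subst powr_numeral) auto
      finally show ?thesis .
    qed
    have fin: "M3 * r n powr q \<le> C * (\<bar>real_of_int (n - y)\<bar> + \<sigma>) powr q" if q: "0 \<le> q" "q \<le> 2" for n q
    proof -
      have "M3 * r n powr q \<le> M3 * (H\<^sup>2 * (\<bar>real_of_int (n - y)\<bar> + \<sigma>) powr q)" using M30 q by (intro mult_left_mono rH) auto
      also have "\<dots> = (M3 * H\<^sup>2) * (\<bar>real_of_int (n - y)\<bar> + \<sigma>) powr q" by simp
      also have "\<dots> \<le> C * (\<bar>real_of_int (n - y)\<bar> + \<sigma>) powr q" using C(2) by (intro mult_right_mono) auto
      finally show ?thesis .
    qed
    have range: "p < n" "n < b" if "\<bar>n\<bar> \<le> int N" for n using that by (auto simp: p_def b_def)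
    show "\<exists>G. (\<forall>n i. \<bar>n\<bar> \<le> int N \<longrightarrow> T G n i = G n i + phi n $ i)
       \<and> (\<forall>n i. \<bar>n\<bar> \<le> int N \<longrightarrow> \<bar>G n i\<bar> \<le> C * (\<bar>real_of_int (n - y)\<bar> + \<sigma>) powr (2 - \<beta>))
       \<and> (\<forall>n n' i j. \<bar>n\<bar> \<le> int N \<longrightarrow> \<bar>n' - n\<bar> \<le> 1 \<longrightarrow>
            \<bar>G n' j - G n i\<bar> \<le> C * (\<bar>real_of_int (n - y)\<bar> + \<sigma>) powr (1 - \<beta>))"
    proof (intro exI[of _ "\<lambda>n i. G n $ i - a"] conjI allI impI)
      fix n i assume n: "\<bar>n\<bar> \<le> int N"
      note rn = range[OF n]
      have Gn1: "G (n - 1) = zeta (n - 1) *v G n + c (n - 1)" using G[rule_format, of "n - 1"] rn by simp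
      have "T (\<lambda>n i. G n $ i) n i = G n $ i + phi n $ i"
        by (rule poisson_solution[where c = c]) (use c G Gn1 rn in auto)
      then show "T (\<lambda>n i. G n $ i - a) n i = (G n $ i - a) + phi n $ i" by (simp add: T_diff T_const)
      show "\<bar>G n $ i - a\<bar> \<le> C * (\<bar>real_of_int (n - y)\<bar> + \<sigma>) powr (2 - \<beta>)"
        using size[OF rn, of i] fin[of "2 - \<beta>" n] \<beta> by linarith
    next
      fix n n' i j assume n: "\<bar>n\<bar> \<le> int N" and n': "\<bar>n' - n\<bar> \<le> 1"
      have "\<bar>G n' $ j - G n $ i\<bar> \<le> M3 * r n powr (1 - \<beta>)" using grad[OF range[OF n] n', of j i] by (simp add: g_def)
      then show "\<bar>(G n' $ j - a) - (G n $ i - a)\<bar> \<le> C * (\<bar>real_of_int (n - y)\<bar> + \<sigma>) powr (1 - \<beta>)"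
        using fin[of "1 - \<beta>" n] \<beta> by simp
    qed
  qed
qed

end

section \<open>The central limit theorem\<close>

theorem theorem6p8:
  fixes P Q R :: "int \<Rightarrow> real^'m^'m"
    and i0 i1 :: 'm
    and zeta zetam :: "int \<Rightarrow> real^'m^'m"
    and mm rho :: "int \<Rightarrow> real^'m"
    and C beta1 a b :: real
  assumes nonneg: "\<And>n i j. P n $ i $ j \<ge> 0 \<and> Q n $ i $ j \<ge> 0 \<and> R n $ i $ j \<ge> 0"
    and rowsum: "\<And>n i. (\<Sum>j\<in>UNIV. P n $ i $ j + Q n $ i $ j + R n $ i $ j) = 1"
    and ellipticity: "\<exists>eps>0. \<exists>k0::nat. \<forall>n.
        mnorm (matpow (R n) k0) \<le> 1 - eps
      \<and> (\<forall>i j. (matrix_inv (mat 1 - R n) ** P n) $ i $ j \<ge> eps)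
      \<and> (\<forall>i j. (matrix_inv (mat 1 - R n) ** Q n) $ i $ j \<ge> eps)"
    and zeta_lim: "\<And>S n. (\<forall>c. stochastic (S c)) \<Longrightarrow>
        ((\<lambda>c. psi P Q R S c (nat (n - c))) \<longlongrightarrow> zeta n) at_bot"
    and bounded_potential: "\<exists>CP. let A = (\<lambda>n. matrix_inv (mat 1 - R n - Q n ** zeta (n - 1)) ** Q n) in
        (\<forall>n\<ge>1. \<bar>ln (mnorm (mprod_down A n (nat n)))\<bar> \<le> CP)
      \<and> (\<forall>n\<le>-1. \<bar>ln (mnorm (mprod_down A 0 (nat (- n))))\<bar> \<le> CP)"
    and mm_harmonic: "\<And>n. mm n = P n *v mm (n + 1) + R n *v mm n + Q n *v mm (n - 1)"
    and mm_lip: "\<exists>K. \<forall>n' n'' i' i''. \<bar>n' - n''\<bar> \<le> 1 \<longrightarrow> \<bar>mm n' $ i' - mm n'' $ i''\<bar> \<le> K"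
    and mm_top: "((\<lambda>n::int. (\<Sum>j\<in>UNIV. mm n $ j) / real_of_int n) \<longlongrightarrow> real CARD('m)) at_top"
    and mm_bot: "((\<lambda>n::int. (\<Sum>j\<in>UNIV. mm n $ j) / real_of_int n) \<longlongrightarrow> real CARD('m)) at_bot"
    and zetam_stoch: "\<And>n. stochastic (zetam n)"
    and zetam_eq: "\<And>n. zetam n = matrix_inv (mat 1 - R n - P n ** zetam (n + 1)) ** Q n"
    and zetam_unique: "\<And>z. (\<forall>n. stochastic (z n)) \<Longrightarrow>
        (\<forall>n. z n = matrix_inv (mat 1 - R n - P n ** z (n + 1)) ** Q n) \<Longrightarrow> z = zetam"
    and rho_pos: "\<And>n i. rho n $ i > 0"
    and rho_bdd: "\<exists>B. \<forall>n i. rho n $ i \<le> B"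
    and rho_inv: "\<And>n. rho n = rho (n - 1) v* P (n - 1) + rho n v* R n + rho (n + 1) v* Q (n + 1)"
    and rho_alpha: "\<And>n. rho n = rho (n + 1) v* (Q (n + 1) ** matrix_inv (mat 1 - R n - Q n ** zeta (n - 1)))"
    and rho_norm: "\<And>n. (rho n v* P n) \<bullet> (mm (n + 1) - zetam (n + 1) *v mm n) = 1 / (2 * real CARD('m))"
    and C_pos: "C > 0"
    and beta1: "0 < beta1" "beta1 < 1"
    and ab: "a > 0" "b > 0"
    and H1: "\<And>(N::nat) (L::int) (k::int). N \<ge> 1 \<Longrightarrow> real_of_int L \<ge> real N powr 0.01 \<Longrightarrow> \<bar>k\<bar> \<le> int N \<Longrightarrow>
        \<bar>mm (k + L) $ i1 - mm (k - L) $ i1 - 2 * real_of_int L\<bar> \<le> C * real_of_int L powr (1 - beta1)"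
    and H2: "\<And>(N::nat) (L::int) (k::int). N \<ge> 1 \<Longrightarrow> real_of_int L \<ge> real N powr 0.01 \<Longrightarrow> \<bar>k\<bar> \<le> int N \<Longrightarrow>
        \<bar>(\<Sum>j\<in>{k - L..k + L}. \<Sum>i\<in>UNIV. rho j $ i) - 2 * real_of_int L * a\<bar> \<le> C * real_of_int L powr (1 - beta1)"
    and H3: "\<And>(N::nat) (L::int) (k::int). N \<ge> 1 \<Longrightarrow> real_of_int L \<ge> real N powr 0.01 \<Longrightarrow> \<bar>k\<bar> \<le> int N \<Longrightarrow>
        \<bar>(\<Sum>j\<in>{k - L..k + L}. rho j \<bullet> qvec P Q R mm j) - 2 * real_of_int L * b\<bar> \<le> C * real_of_int L powr (1 - beta1)"
  shows "\<forall>\<epsilon>>0. \<exists>C\<epsilon>. \<forall>N::nat. N \<ge> 1 \<longrightarrow> (\<forall>x::real.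
           \<bar>walk_cdf P Q R i0 N (x * sqrt (b / a * real N)) - Phi x\<bar>
             \<le> C\<epsilon> * real N powr (- ((1/2) * min (1/4) beta1 - \<epsilon>)))"
proof -
  define \<beta> where "\<beta> = min (1/4) beta1"
  have \<beta>: "0 < \<beta>" "\<beta> \<le> 1/4" "\<beta> \<le> beta1" using beta1 by (auto simp: \<beta>_def)
  define D where "D = b / a"
  have D: "D > 0" using ab by (simp add: D_def)
  obtain eps k0 where eps: "eps > 0"
    "\<And>n. mnorm (matpow (R n) k0) \<le> 1 - eps"
    "\<And>n i j. (matrix_inv (mat 1 - R n) ** P n) $ i $ j \<ge> eps"
    "\<And>n i j. (matrix_inv (mat 1 - R n) ** Q n) $ i $ j \<ge> eps"
    using ellipticity by blast
  interpret el: elliptic_strip P Q R i0 eps k0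
    by unfold_locales (use nonneg rowsum eps in auto)
  obtain K where K: "\<And>n' n'' i' i''. \<bar>n' - n''\<bar> \<le> 1 \<Longrightarrow> \<bar>mm n' $ i' - mm n'' $ i''\<bar> \<le> K"
    using mm_lip by blast
  have K0: "K \<ge> 0" using K[of 0 0 i0 i0] by simp
  obtain B where B: "\<And>n i. rho n $ i \<le> B" using rho_bdd by blast
  have B0: "B \<ge> 0" using B[of 0 i0] rho_pos[of 0 i0] by linarith
  define m where "m = real CARD('m)"
  have m: "m > 0" by (simp add: m_def)
  \<comment> \<open>By the Lipschitz bound each component of the vector in \<open>rho_norm\<close>
    is at most K, so rho P cannot have mass below 1 / (2 m K), and P does not increase mass. K + 1
    avoids a division by zero.\<close>
  define lam where "lam = 1 / (2 * m * (K + 1))"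
  have lam: "lam > 0" using m K0 by (simp add: lam_def)
  have rho_sum: "lam \<le> (\<Sum>i\<in>UNIV. rho n $ i)" for n
  proof -
    define v where "v = rho n v* P n"
    have v0: "0 \<le> v $ i" for i
      unfolding v_def vector_matrix_nth by (intro sum_nonneg mult_nonneg_nonneg el.P_nonneg less_imp_le[OF rho_pos])
    have zb: "(mm (n + 1) - zetam (n + 1) *v mm n) $ i \<le> K + 1" for i
    proof -
      have z: "0 \<le> zetam (n + 1) $ i $ j" "(\<Sum>j\<in>UNIV. zetam (n + 1) $ i $ j) = 1" for j
        using zetam_stoch[of "n + 1"] by (auto simp: stochastic_def)
      have "mm (n + 1) $ i - (zetam (n + 1) *v mm n) $ i = (\<Sum>j\<in>UNIV. zetam (n + 1) $ i $ j * (mm (n + 1) $ i - mm n $ j))"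
        by (simp add: matrix_vector_nth right_diff_distrib sum_subtractf z(2) flip: sum_distrib_right)
      also have "\<dots> \<le> (\<Sum>j\<in>UNIV. zetam (n + 1) $ i $ j * K)"
        using K[of "n + 1" n i] by (intro sum_mono mult_left_mono z(1)) (auto simp: abs_le_iff)
      also have "\<dots> = K" by (simp add: z(2) flip: sum_distrib_right)
      finally show ?thesis by simp
    qed
    have "1 / (2 * m) = (\<Sum>i\<in>UNIV. v $ i * (mm (n + 1) - zetam (n + 1) *v mm n) $ i)"
      using rho_norm[of n] by (simp add: v_def inner_vec_def m_def)
    also have "\<dots> \<le> (\<Sum>i\<in>UNIV. v $ i * (K + 1))" by (intro sum_mono mult_left_mono zb v0)
    also have "\<dots> = (\<Sum>i\<in>UNIV. v $ i) * (K + 1)" by (simp add: sum_distrib_right)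
    also have "(\<Sum>i\<in>UNIV. v $ i) \<le> (\<Sum>i\<in>UNIV. rho n $ i)"
    proof -
      have "(\<Sum>i\<in>UNIV. v $ i) = v \<bullet> ones" by (simp add: inner_vec_def)
      also have "\<dots> = rho n \<bullet> (P n *v ones)" unfolding v_def by (rule dot_lmul_matrix)
      also have "\<dots> \<le> (\<Sum>i\<in>UNIV. rho n $ i * 1)"
        unfolding inner_vec_def inner_real_def
      proof (intro sum_mono mult_left_mono less_imp_le[OF rho_pos])
        fix i
        have "(P n *v ones) $ i + (Q n *v ones) $ i + (R n *v ones) $ i = 1"
          using arg_cong[OF el.rowsum_ones[of n], of "\<lambda>v. v $ i"] by simp
        moreover have "0 \<le> (R n *v ones) $ i" "0 \<le> (Q n *v ones) $ i"
          by (auto simp: matrix_vector_nth intro!: sum_nonneg el.Q_nonneg el.R_nonneg)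
        ultimately show "(P n *v ones) $ i \<le> 1" by linarith
      qed
      finally show ?thesis by simp
    qed
    finally have "1 / (2 * m) \<le> (\<Sum>i\<in>UNIV. rho n $ i) * (K + 1)" using K0 by (simp add: mult_right_mono)
    then have "1 / (2 * m) / (K + 1) \<le> (\<Sum>i\<in>UNIV. rho n $ i)" using K0 by (subst pos_divide_le_eq) auto
    then show ?thesis by (simp add: lam_def)
  qed
  have zp: "stochastic (zeta n)" "zeta n = matrix_inv (el.IS n (zeta (n - 1))) ** P n" "eps \<le> zeta n $ i $ j" for n i j
    using el.zeta_props[OF zeta_lim] by blast+
  interpret po: potential_strip P Q R i0 eps k0 zeta rho B lam
  proof unfold_locales
    show "rho n = (rho (n + 1) v* Q (n + 1)) v* matrix_inv (el.IS n (zeta (n - 1)))" for n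
      using rho_alpha[of n] by (simp add: vector_matrix_mul_assoc el.IS_def)
    show "0 \<le> rho n $ i" for n i by (rule less_imp_le[OF rho_pos])
  qed (rule zp B lam rho_sum)+
  define mf where "mf = (\<lambda>n i. mm n $ i)"
  define phi where "phi = (\<lambda>n. qvec P Q R mm n - D *s ones)"
  define F where "F = K\<^sup>2 + D"
  have mf_harm: "el.T mf n i = mf n i" for n i
    using arg_cong[OF mm_harmonic[of n], of "\<lambda>v. v $ i"] unfolding mf_def po.T_eq_matrix by simp
  have q_eq: "el.T (\<lambda>n' j. (mf n' j - mf n i)\<^sup>2) n i = qvec P Q R mm n $ i" for n i
    by (simp add: el.T_def qvec_def mf_def add_ac)
  have phiF: "\<bar>phi n $ i\<bar> \<le> F" for n i
  proof -
    have "\<bar>qvec P Q R mm n $ i\<bar> \<le> K\<^sup>2"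
      unfolding q_eq[symmetric]
    proof (rule el.T_abs_le)
      fix n' j assume "\<bar>n' - n\<bar> \<le> 1"
      then show "\<bar>(mf n' j - mf n i)\<^sup>2\<bar> \<le> K\<^sup>2" using K[of n' n j i] K0 unfolding mf_def by (simp add: abs_le_square_iff[symmetric])
    qed
    then show ?thesis using D unfolding phi_def F_def by (simp add: abs_le_iff)
  qed
  have avg: "\<bar>mm (k + L) $ i1 - mm (k - L) $ i1 - 2 * real_of_int L\<bar> \<le> C * real_of_int L powr (1 - \<beta>)"
      "\<bar>\<Sum>j\<in>{k - L..k + L}. rho j \<bullet> phi j\<bar> \<le> (C + D * C) * real_of_int L powr (1 - \<beta>)"
    if L: "real_of_int L \<ge> max 1 \<bar>real_of_int k\<bar> powr 0.01" for k L
  proof -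
    \<comment> \<open>The smallest admissible N for the centre k. The condition on L then depends on
      the centre alone, and not on the time of the final estimate.\<close>
    define N where "N = nat (max 1 \<bar>k\<bar>)"
    have N: "N \<ge> 1" "\<bar>k\<bar> \<le> int N" "real N = max 1 \<bar>real_of_int k\<bar>" by (auto simp: N_def max_def)
    have LN: "real_of_int L \<ge> real N powr 0.01" using L N(3) by simp
    have "1 \<le> max 1 \<bar>real_of_int k\<bar> powr 0.01" by (intro ge_one_powr_ge_zero) auto
    then have L1: "1 \<le> real_of_int L" using L by linarith
    have weak: "C * real_of_int L powr (1 - beta1) \<le> C * real_of_int L powr (1 - \<beta>)"
      using C_pos \<beta> L1 by (intro mult_left_mono powr_mono) auto
    show "\<bar>mm (k + L) $ i1 - mm (k - L) $ i1 - 2 * real_of_int L\<bar> \<le> C * real_of_int L powr (1 - \<beta>)"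
      using H1[OF N(1) LN N(2)] weak by linarith
    have "(\<Sum>j\<in>{k - L..k + L}. rho j \<bullet> phi j) = (\<Sum>j\<in>{k - L..k + L}. rho j \<bullet> qvec P Q R mm j)
        - D * (\<Sum>j\<in>{k - L..k + L}. \<Sum>i\<in>UNIV. rho j $ i)"
      by (simp add: phi_def inner_vec_def right_diff_distrib sum_subtractf sum_distrib_left mult.commute)
    \<comment> \<open>The two linear terms 2 L b and D * 2 L a cancel; this is what determines D = b
      / a.\<close>
    also have "\<dots> = ((\<Sum>j\<in>{k - L..k + L}. rho j \<bullet> qvec P Q R mm j) - 2 * real_of_int L * b)
        - D * ((\<Sum>j\<in>{k - L..k + L}. \<Sum>i\<in>UNIV. rho j $ i) - 2 * real_of_int L * a)"
      using ab by (simp add: D_def field_simps)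
    also have "\<bar>\<dots>\<bar> \<le> C * real_of_int L powr (1 - \<beta>) + D * (C * real_of_int L powr (1 - \<beta>))"
    proof (rule order_trans[OF abs_triangle_ineq4 add_mono])
      show "\<bar>(\<Sum>j\<in>{k - L..k + L}. rho j \<bullet> qvec P Q R mm j) - 2 * real_of_int L * b\<bar> \<le> C * real_of_int L powr (1 - \<beta>)"
        using H3[OF N(1) LN N(2)] weak by linarith
      show "\<bar>D * ((\<Sum>j\<in>{k - L..k + L}. \<Sum>i\<in>UNIV. rho j $ i) - 2 * real_of_int L * a)\<bar> \<le> D * (C * real_of_int L powr (1 - \<beta>))"
        unfolding abs_mult abs_of_pos[OF D]
        by (intro mult_left_mono order_trans[OF H2[OF N(1) LN N(2)] weak]) (use D in auto)
    qed
    finally show "\<bar>\<Sum>j\<in>{k - L..k + L}. rho j \<bullet> phi j\<bar> \<le> (C + D * C) * real_of_int L powr (1 - \<beta>)"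
      by (simp add: algebra_simps)
  qed
  have lin: "\<exists>C\<ge>1. \<forall>N\<ge>1. \<forall>u v. \<bar>real_of_int v\<bar> \<le> \<kappa> * real N \<longrightarrow>
      \<bar>mf u i1 - mf v i1 - real_of_int (u - v)\<bar> \<le> C * (\<bar>real_of_int (u - v)\<bar> + real N powr ((1 - \<beta>) / 2)) powr (1 - \<beta>)"
    if \<kappa>: "\<kappa> \<ge> 1" for \<kappa>
  proof -
    \<comment> \<open>The drift is subtracted, so the averaging hypothesis becomes a bound on
      increments over centred windows.\<close>
    define h where "h = (\<lambda>n. mm n $ i1 - real_of_int n)"
    have "\<exists>C\<ge>1. \<forall>N\<ge>1. \<forall>u v. \<bar>real_of_int v\<bar> \<le> \<kappa> * real N \<longrightarrow>
      \<bar>h u - h v\<bar> \<le> C * (\<bar>real_of_int (u - v)\<bar> + real N powr ((1 - \<beta>) / 2)) powr (1 - \<beta>)"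
    proof (rule interval_growth[OF \<beta>(1,2) \<kappa>])
      show "\<bar>h (n + 1) - h n\<bar> \<le> K + 1" for n using K[of "n + 1" n i1 i1] by (simp add: h_def abs_le_iff)
      show "\<bar>h (k + L) - h (k - L)\<bar> \<le> C * real_of_int L powr (1 - \<beta>)"
        if "max 1 \<bar>real_of_int k\<bar> powr 0.01 \<le> real_of_int L" for k L
        using avg(1)[OF that] by (simp add: h_def algebra_simps)
    qed (use C_pos in simp)
    moreover have "mf u i1 - mf v i1 - real_of_int (u - v) = h u - h v" for u v by (simp add: h_def mf_def)
    ultimately show ?thesis by simp
  qed
  \<comment> \<open>A discrete antiderivative of the terms \<open>rho n \<bullet> phi n\<close> on
    all integers, glued at 0 from an upward and a downward recursion.\<close>
  obtain hu where hu: "hu 0 = 0" "\<forall>n>0. hu n = hu (n - 1) + rho n \<bullet> phi n"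
    using recursive_family_up[of 0 "0::real" "\<lambda>n x. x + rho n \<bullet> phi n"] by blast
  obtain hd where hd: "hd 0 = 0" "\<forall>n<0. hd n = hd (n + 1) - rho (n + 1) \<bullet> phi (n + 1)"
    using recursive_family_down[of 0 "0::real" "\<lambda>n x. x - rho (n + 1) \<bullet> phi (n + 1)"] by blast
  define h where "h = (\<lambda>n. if n \<ge> 0 then hu n else hd n)"
  have h: "h n = h (n - 1) + rho n \<bullet> phi n" for n
  proof -
    consider "n > 0" | "n = 0" | "n < 0" by linarith
    then show ?thesis
      by cases (use hu(1) hd(1) hu(2)[rule_format, of n] hd(2)[rule_format, of "n - 1"] in \<open>auto simp: h_def\<close>)
  qed
  have h_sum: "h v - h (u - 1) = (\<Sum>j\<in>{u..v}. rho j \<bullet> phi j)" if "u - 1 \<le> v" for u v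
    using that
  proof (induction v rule: int_ge_induct)
    case (step v)
    have "{u..v + 1} = insert (v + 1) {u..v}" using step.hyps by auto
    then show ?case using step.IH h[of "v + 1"] by simp
  qed simp
  have rp: "\<bar>rho n \<bullet> phi n\<bar> \<le> m * (B * F)" for n
  proof -
    have "\<bar>rho n \<bullet> phi n\<bar> \<le> (\<Sum>i\<in>UNIV. \<bar>rho n $ i * phi n $ i\<bar>)" unfolding inner_vec_def inner_real_def by (rule sum_abs)
    also have "\<dots> \<le> (\<Sum>i\<in>(UNIV::'m set). B * F)"
      unfolding abs_mult using B B0 rho_pos phiF by (intro sum_mono mult_mono) (auto simp: abs_of_pos)
    finally show ?thesis by (simp add: m_def)
  qed
  have mBF: "m * (B * F) \<ge> 0" using rp[of 0] by linarith
  have corr: "\<exists>C\<ge>1. \<forall>N\<ge>1. \<forall>y. \<bar>real_of_int y\<bar> \<le> \<kappa> * real N \<longrightarrow>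
        (\<exists>G. (\<forall>n i. \<bar>n\<bar> \<le> int N \<longrightarrow> el.T G n i = G n i + (qvec P Q R mm n $ i - D))
           \<and> (\<forall>n i. \<bar>n\<bar> \<le> int N \<longrightarrow> \<bar>G n i\<bar> \<le> C * (\<bar>real_of_int (n - y)\<bar> + real N powr ((1 - \<beta>) / 2)) powr (2 - \<beta>))
           \<and> (\<forall>n n' i j. \<bar>n\<bar> \<le> int N \<longrightarrow> \<bar>n' - n\<bar> \<le> 1 \<longrightarrow>
                \<bar>G n' j - G n i\<bar> \<le> C * (\<bar>real_of_int (n - y)\<bar> + real N powr ((1 - \<beta>) / 2)) powr (1 - \<beta>)))"
    if \<kappa>: "\<kappa> \<ge> 1" for \<kappa>
  proof -
    have "\<exists>C\<ge>1. \<forall>N\<ge>1. \<forall>u v. \<bar>real_of_int v\<bar> \<le> \<kappa> * real N \<longrightarrow>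
      \<bar>h u - h v\<bar> \<le> C * (\<bar>real_of_int (u - v)\<bar> + real N powr ((1 - \<beta>) / 2)) powr (1 - \<beta>)"
    proof (rule interval_growth[OF \<beta>(1,2) \<kappa>])
      show "\<bar>h (n + 1) - h n\<bar> \<le> m * (B * F)" for n using h[of "n + 1"] rp[of "n + 1"] by simp
      show "\<bar>h (k + L) - h (k - L)\<bar> \<le> (C + D * C + m * (B * F)) * real_of_int L powr (1 - \<beta>)"
        if L: "max 1 \<bar>real_of_int k\<bar> powr 0.01 \<le> real_of_int L" for k L
      proof -
        have "1 \<le> max 1 \<bar>real_of_int k\<bar> powr 0.01" by (intro ge_one_powr_ge_zero) auto
        then have L1: "1 \<le> real_of_int L" using L by linarith
        then have pw: "1 \<le> real_of_int L powr (1 - \<beta>)" using \<beta> by (intro ge_one_powr_ge_zero) auto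
        \<comment> \<open>The window has 2 L + 1 sites but the increment of h only 2 L terms; the
          term at k - L is surplus and is bounded separately.\<close>
        have "h (k + L) - h (k - L) = (\<Sum>j\<in>{k - L..k + L}. rho j \<bullet> phi j) - rho (k - L) \<bullet> phi (k - L)"
          using h_sum[of "k - L" "k + L"] h[of "k - L"] L1 by simp
        then have "\<bar>h (k + L) - h (k - L)\<bar> \<le> (C + D * C) * real_of_int L powr (1 - \<beta>) + m * (B * F)"
          using avg(2)[OF L] rp[of "k - L"] by linarith
        also have "m * (B * F) \<le> m * (B * F) * real_of_int L powr (1 - \<beta>)" using mult_left_mono[OF pw mBF] by simp
        finally show ?thesis by (simp add: algebra_simps)
      qed
    qed (use C_pos D mBF in simp)
    then obtain Ch where Ch: "Ch \<ge> 1" "\<forall>N\<ge>1. \<forall>u v. \<bar>real_of_int v\<bar> \<le> \<kappa> * real N \<longrightarrow>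
      \<bar>h u - h v\<bar> \<le> Ch * (\<bar>real_of_int (u - v)\<bar> + real N powr ((1 - \<beta>) / 2)) powr (1 - \<beta>)" by blast
    obtain Cg where Cg: "Cg \<ge> 1" "\<forall>\<sigma>\<ge>1. \<forall>y (N::nat). (\<forall>u. \<bar>h u - h y\<bar> \<le> Ch * (\<bar>real_of_int (u - y)\<bar> + \<sigma>) powr (1 - \<beta>)) \<longrightarrow>
      (\<exists>G. (\<forall>n i. \<bar>n\<bar> \<le> int N \<longrightarrow> el.T G n i = G n i + phi n $ i)
       \<and> (\<forall>n i. \<bar>n\<bar> \<le> int N \<longrightarrow> \<bar>G n i\<bar> \<le> Cg * (\<bar>real_of_int (n - y)\<bar> + \<sigma>) powr (2 - \<beta>))
       \<and> (\<forall>n n' i j. \<bar>n\<bar> \<le> int N \<longrightarrow> \<bar>n' - n\<bar> \<le> 1 \<longrightarrow>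
            \<bar>G n' j - G n i\<bar> \<le> Cg * (\<bar>real_of_int (n - y)\<bar> + \<sigma>) powr (1 - \<beta>)))"
      using po.corrector_exists[OF \<beta>(1,2) phiF h Ch(1)] by blast
    have phi_nth: "phi n $ i = qvec P Q R mm n $ i - D" for n i by (simp add: phi_def)
    show ?thesis
    proof (intro exI[of _ Cg] conjI[OF Cg(1)] allI impI)
      fix N :: nat and y :: int assume N: "1 \<le> N" and y: "\<bar>real_of_int y\<bar> \<le> \<kappa> * real N"
      have s: "1 \<le> real N powr ((1 - \<beta>) / 2)" using N \<beta> by (intro ge_one_powr_ge_zero) auto
      show "\<exists>G. (\<forall>n i. \<bar>n\<bar> \<le> int N \<longrightarrow> el.T G n i = G n i + (qvec P Q R mm n $ i - D))
           \<and> (\<forall>n i. \<bar>n\<bar> \<le> int N \<longrightarrow> \<bar>G n i\<bar> \<le> Cg * (\<bar>real_of_int (n - y)\<bar> + real N powr ((1 - \<beta>) / 2)) powr (2 - \<beta>))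
           \<and> (\<forall>n n' i j. \<bar>n\<bar> \<le> int N \<longrightarrow> \<bar>n' - n\<bar> \<le> 1 \<longrightarrow>
                \<bar>G n' j - G n i\<bar> \<le> Cg * (\<bar>real_of_int (n - y)\<bar> + real N powr ((1 - \<beta>) / 2)) powr (1 - \<beta>))"
        using Cg(2)[rule_format, OF s, of y N] Ch(2) N y unfolding phi_nth by blast
    qed
  qed
  interpret clt: strip_clt P Q R i0 mf "\<lambda>n i. qvec P Q R mm n $ i" i1 D \<beta> K
  proof unfold_locales
    show "\<bar>mf n i - mf n' j\<bar> \<le> K" if "\<bar>n - n'\<bar> \<le> 1" for n n' i j unfolding mf_def by (rule K[OF that])
  qed (rule D \<beta> mf_harm q_eq lin corr; assumption?)+
  obtain C' where C': "C' \<ge> 0"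
    "\<forall>N\<ge>1. \<forall>x. \<bar>walk_cdf P Q R i0 N (x * sqrt (D * real N)) - Phi x\<bar> \<le> C' * real N powr - (\<beta> / 2)"
    using clt.walk_cdf_rate by blast
  show ?thesis
  proof (intro allI impI exI[of _ C'])
    fix \<epsilon> :: real and N :: nat and x :: real assume e: "0 < \<epsilon>" and N: "1 \<le> N"
    have "\<bar>walk_cdf P Q R i0 N (x * sqrt (b / a * real N)) - Phi x\<bar> \<le> C' * real N powr - (\<beta> / 2)"
      using C'(2) N unfolding D_def by blast
    \<comment> \<open>For N >= 1 a larger exponent only weakens the bound, so the constant does not
      depend on \<open>\<epsilon>\<close>.\<close>
    also have "\<dots> \<le> C' * real N powr (- ((1/2) * min (1/4) beta1 - \<epsilon>))"
      using C'(1) N e by (intro mult_left_mono powr_mono) (auto simp: \<beta>_def)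
    finally show "\<bar>walk_cdf P Q R i0 N (x * sqrt (b / a * real N)) - Phi x\<bar>
        \<le> C' * real N powr (- ((1/2) * min (1/4) beta1 - \<epsilon>))" .
  qed
qed

end
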